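(* Suppose $f$ satisfies the structure conditions (i)–(vi) below in $K_n^+$ and in addition \[ \sum_i f_i(\lambda)>\sum_i\lambda_i^2 f_i(\lambda)\quad\text{for all }\lambda\in K_n^+\text{ with }0<f(\lambda)<1. \] Let $\Omega\subset\mathbb{R}^n$ be a bounded smooth domain and $\sigma\in(0,1)$. Then: (a) there is at most one admissible $u\in C^\infty(\Omega)\cap C^1(\overline\Omega)$ with $f(\kappa[\mathrm{graph}\,u])=\sigma$ in $\Omega$ and $u=0$ on $\partial\Omega$ (equivalently, at most one complete strictly locally convex hypersurface with $f(\kappa)=\sigma$ and asymptotic boundary $\partial\Omega\times\{0\}$); (b) for each $\epsilon>0$ there is at most one admissible $u\in C^\infty(\overline\Omega)$ with $f(\kappa[\mathrm{graph}\,u])=\sigma$ in $\Omega$ and $u=\epsilon$ on $\partial\Omega$. In particular these uniqueness statements hold for $f=(H_n/H_l)^{1/(n-l)}$ with $l=n-1$ or $l=n-2$.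
   Context: Half-space model $\mathbb{H}^{n+1}=\{(x,x_{n+1}):x_{n+1}>0\}$, metric $\sum dx_i^2/x_{n+1}^2$. For a graph $x_{n+1}=u(x)$, $u>0$, oriented upward, the hyperbolic principal curvatures $\kappa[\mathrm{graph}\,u]$ are the eigenvalues of $h_{ij}=\frac{\delta_{ij}+u_iu_j+uu_{ij}}{u^2\sqrt{1+|Du|^2}}$ relative to $g_{ij}=\frac{\delta_{ij}+u_iu_j}{u^2}$. Admissible: $u>0$ and $\{\delta_{ij}+u_iu_j+uu_{ij}\}>0$. $K_n^+=\{\lambda:\lambda_i>0\}$; $f_i=\partial f/\partial\lambda_i$. Structure conditions on smooth symmetric $f$ on $K_n^+$: (i) $f_i>0$; (ii) concave; (iii) $f>0$ in $K_n^+$, $f=0$ on $\partial K_n^+$; (iv) $f(1,\dots,1)=1$; (v) homogeneous of degree one; (vi) there are $\varepsilon_0,\delta_0>0$ with $\lim_{R\to\infty}f(\lambda_1,\dots,\lambda_{n-1},\lambda_n+R)\ge1+\varepsilon_0$ uniformly on $B_{\delta_0}(1,\dots,1)$. $H_l$ is the normalized $l$-th elementary symmetric polynomial ($H_0=1$). *)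

theory Defs
  imports "HOL-Analysis.Analysis"
begin

definition pd :: "'n::finite \<Rightarrow> (real^'n \<Rightarrow> real) \<Rightarrow> real^'n \<Rightarrow> real" where
  "pd i g x = deriv (\<lambda>t. g (x + t *\<^sub>R axis i 1)) 0"

fun pds :: "'n::finite list \<Rightarrow> (real^'n \<Rightarrow> real) \<Rightarrow> real^'n \<Rightarrow> real" where
  "pds [] g = g"
| "pds (i # is) g = pd i (pds is g)"

fun Ck :: "nat \<Rightarrow> (real^'n::finite) set \<Rightarrow> (real^'n \<Rightarrow> real) \<Rightarrow> bool" where
  "Ck 0 S g = continuous_on S g"
| "Ck (Suc k) S g = (continuous_on S g \<and>
      (\<forall>i. \<forall>x\<in>S. (\<lambda>t. g (x + t *\<^sub>R axis i 1)) differentiable (at 0)) \<and>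
      (\<forall>i. Ck k S (pd i g)))"

definition smooth_on :: "(real^'n::finite) set \<Rightarrow> (real^'n \<Rightarrow> real) \<Rightarrow> bool" where
  "smooth_on S g \<longleftrightarrow> (\<forall>k. Ck k S g)"

definition smooth_upto :: "(real^'n::finite) set \<Rightarrow> (real^'n \<Rightarrow> real) \<Rightarrow> bool" where
  "smooth_upto S g \<longleftrightarrow> smooth_on S g \<and>
     (\<forall>is. \<exists>G. continuous_on (closure S) G \<and> (\<forall>x\<in>S. G x = pds is g x)) \<and>
     continuous_on (closure S) g"

definition C1_upto :: "(real^'n::finite) set \<Rightarrow> (real^'n \<Rightarrow> real) \<Rightarrow> bool" where
  "C1_upto S g \<longleftrightarrow> Ck 1 S g \<and> continuous_on (closure S) g \<and>
     (\<forall>i. \<exists>G. continuous_on (closure S) G \<and> (\<forall>x\<in>S. G x = pd i g x))"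

definition bounded_smooth_domain :: "(real^'n::finite) set \<Rightarrow> bool" where
  "bounded_smooth_domain \<Omega> \<longleftrightarrow> open \<Omega> \<and> connected \<Omega> \<and> bounded \<Omega> \<and> \<Omega> \<noteq> {} \<and>
     (\<exists>\<rho>. smooth_on UNIV \<rho> \<and> \<Omega> = {x. \<rho> x < 0} \<and>
          (\<forall>x. \<rho> x = 0 \<longrightarrow> (\<exists>i. pd i \<rho> x \<noteq> 0)))"

definition pos_def :: "real^'n^'n \<Rightarrow> bool" where
  "pos_def A \<longleftrightarrow> (\<forall>\<xi>. \<xi> \<noteq> 0 \<longrightarrow> \<xi> \<bullet> (A *v \<xi>) > 0)"

definition Amat :: "(real^'n::finite \<Rightarrow> real) \<Rightarrow> real^'n \<Rightarrow> real^'n^'n" where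
  "Amat u x = (\<chi> i j. (if i = j then 1 else 0) + pd i u x * pd j u x + u x * pd i (pd j u) x)"

definition gmat :: "(real^'n::finite \<Rightarrow> real) \<Rightarrow> real^'n \<Rightarrow> real^'n^'n" where
  "gmat u x = (\<chi> i j. ((if i = j then 1 else 0) + pd i u x * pd j u x) / (u x)\<^sup>2)"

definition hmat :: "(real^'n::finite \<Rightarrow> real) \<Rightarrow> real^'n \<Rightarrow> real^'n^'n" where
  "hmat u x = (1 / ((u x)\<^sup>2 * sqrt (1 + (\<Sum>i\<in>UNIV. (pd i u x)\<^sup>2)))) *\<^sub>R Amat u x"

text \<open>kappa is a list of the hyperbolic principal curvatures of graph u at x (with multiplicity):
  the eigenvalues of h relative to g, i.e. the roots of det(h - t g).\<close>
definition principal_curvatures :: "(real^'n::finite \<Rightarrow> real) \<Rightarrow> real^'n \<Rightarrow> real^'n \<Rightarrow> bool" where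
  "principal_curvatures u x \<kappa> \<longleftrightarrow>
     (\<forall>t. det (hmat u x - t *\<^sub>R gmat u x) = det (gmat u x) * (\<Prod>i\<in>UNIV. \<kappa> $ i - t))"

text \<open>f(kappa[graph u]) = sigma at x (well-defined since f is symmetric).\<close>
definition curv_eq :: "(real^'n::finite \<Rightarrow> real) \<Rightarrow> (real^'n \<Rightarrow> real) \<Rightarrow> real^'n \<Rightarrow> real \<Rightarrow> bool" where
  "curv_eq f u x \<sigma> \<longleftrightarrow> (\<exists>\<kappa>. principal_curvatures u x \<kappa> \<and> f \<kappa> = \<sigma>)"

definition admissible :: "(real^'n::finite) set \<Rightarrow> (real^'n \<Rightarrow> real) \<Rightarrow> bool" where
  "admissible \<Omega> u \<longleftrightarrow> (\<forall>x\<in>\<Omega>. u x > 0 \<and> pos_def (Amat u x))"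

definition Kpos :: "(real^'n::finite) set" where
  "Kpos = {\<mu>. \<forall>i. \<mu> $ i > 0}"

definition structure_conditions :: "(real^'n::finite \<Rightarrow> real) \<Rightarrow> bool" where
  "structure_conditions f \<longleftrightarrow>
     smooth_on Kpos f \<and>
     (\<forall>p \<mu>. p permutes (UNIV::'n set) \<longrightarrow> \<mu> \<in> Kpos \<longrightarrow> f (\<chi> i. \<mu> $ p i) = f \<mu>) \<and>
     (\<forall>\<mu>\<in>Kpos. \<forall>i. pd i f \<mu> > 0) \<and>
     concave_on Kpos f \<and>
     (\<forall>\<mu>\<in>Kpos. f \<mu> > 0) \<and> (\<forall>\<mu>\<in>frontier Kpos. f \<mu> = 0) \<and>
     f (\<chi> i. 1) = 1 \<and>
     (\<forall>\<mu>\<in>Kpos. \<forall>t>0. f (t *\<^sub>R \<mu>) = t * f \<mu>) \<and>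
     (\<exists>\<epsilon>0>0. \<exists>\<delta>0>0. \<forall>k. \<exists>R0. \<forall>\<mu>\<in>ball (\<chi> i. 1) \<delta>0 \<inter> Kpos. \<forall>R\<ge>R0.
         f (\<mu> + R *\<^sub>R axis k 1) \<ge> 1 + \<epsilon>0)"

definition extra_condition :: "(real^'n::finite \<Rightarrow> real) \<Rightarrow> bool" where
  "extra_condition f \<longleftrightarrow> (\<forall>\<mu>\<in>Kpos. 0 < f \<mu> \<and> f \<mu> < 1 \<longrightarrow>
      (\<Sum>i\<in>UNIV. pd i f \<mu>) > (\<Sum>i\<in>UNIV. (\<mu> $ i)\<^sup>2 * pd i f \<mu>))"

definition uniqueness :: "(real^'n::finite \<Rightarrow> real) \<Rightarrow> (real^'n) set \<Rightarrow> real \<Rightarrow> bool" where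
  "uniqueness f \<Omega> \<sigma> \<longleftrightarrow>
    (\<forall>u v. (admissible \<Omega> u \<and> smooth_on \<Omega> u \<and> C1_upto \<Omega> u \<and>
            (\<forall>x\<in>\<Omega>. curv_eq f u x \<sigma>) \<and> (\<forall>x\<in>frontier \<Omega>. u x = 0)) \<longrightarrow>
           (admissible \<Omega> v \<and> smooth_on \<Omega> v \<and> C1_upto \<Omega> v \<and>
            (\<forall>x\<in>\<Omega>. curv_eq f v x \<sigma>) \<and> (\<forall>x\<in>frontier \<Omega>. v x = 0)) \<longrightarrow>
           (\<forall>x\<in>\<Omega>. u x = v x)) \<and>
    (\<forall>\<epsilon>>0. \<forall>u v. (admissible \<Omega> u \<and> smooth_upto \<Omega> u \<and>
            (\<forall>x\<in>\<Omega>. curv_eq f u x \<sigma>) \<and> (\<forall>x\<in>frontier \<Omega>. u x = \<epsilon>)) \<longrightarrow>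
           (admissible \<Omega> v \<and> smooth_upto \<Omega> v \<and>
            (\<forall>x\<in>\<Omega>. curv_eq f v x \<sigma>) \<and> (\<forall>x\<in>frontier \<Omega>. v x = \<epsilon>)) \<longrightarrow>
           (\<forall>x\<in>\<Omega>. u x = v x))"

definition Hsym :: "nat \<Rightarrow> real^'n::finite \<Rightarrow> real" where
  "Hsym l \<mu> = (\<Sum>S\<in>{S. S \<subseteq> (UNIV::'n set) \<and> card S = l}. \<Prod>i\<in>S. \<mu> $ i)
               / real (CARD('n) choose l)"

definition Hquot :: "nat \<Rightarrow> real^'n::finite \<Rightarrow> real" where
  "Hquot l \<mu> = (Hsym CARD('n) \<mu> / Hsym l \<mu>) powr (1 / real (CARD('n) - l))"

end

theory Submission
  imports Defs
begin

text \<open>In the projective model \<open>(x, s) \<mapsto> (x, s\<^sup>2 + |x|\<^sup>2)\<close> totally geodesic hypersurfaces become affine and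
  admissibility of \<open>u\<close> becomes local convexity of \<open>u\<^sup>2 + |x|\<^sup>2\<close>; with the boundary condition the region
  above the graph, extended by \<open>\<epsilon>\<close> outside \<open>\<Omega>\<close>, is globally convex. Suppose a second solution \<open>v\<close> is
  somewhere below \<open>u\<close> and take a point of its graph at maximal distance \<open>d\<close> from this convex region. The
  nearest point of the region is strictly higher, hence lies on the graph of \<open>u\<close> over \<open>\<Omega>\<close>, and the outer
  parallel hypersurface of \<open>u\<close> at distance \<open>d\<close> touches the graph of \<open>v\<close> from below. Moving outwards changes
  principal curvatures by \<open>\<kappa>' = 1 - \<kappa>\<^sup>2\<close>, so the extra condition makes \<open>f(\<kappa>)\<close> leave the value \<open>\<sigma>\<close> upwards,
  which contradicts the comparison of curvatures at the point of contact. The maximal distance is attained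
  because \<open>u\<close> and \<open>v\<close> are asymptotic at the boundary: for \<open>\<epsilon> = 0\<close> both are squeezed between equidistant caps
  of curvature \<open>\<sigma>\<close> over interior and exterior tangent balls.\<close>

section \<open>Calculus with iterated partial derivatives\<close>

text \<open>The gap between two solutions is measured by hyperbolic distance, not vertically,
  because the change of curvature under normal motion is explicit: the derivative of f(\<kappa>) in
  the distance is the sum of the f_i (1 - \<kappa>_i^2), whose positivity is the extra condition. A
  distance d enters through T = sinh d and C = cosh d; cosh of the distance of (x, r) and (y, s) is
  (|x - y|^2 + r^2 + s^2) / (2 r s). The obstacle is that the parallel hypersurface is not given as
  a graph, and proving it to be a smooth one would need an inverse function argument. Instead,
  contact is expressed by a function of two independent points, x for the graph of v and y for the
  graph of u, that is maximal at the contact pair. Its second derivative along any pair of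
  directions gives an inequality, and the optimal direction in y recovers the curvatures of the
  parallel hypersurface. The locale \<open>curvature_function\<close> condenses the conditions on f,
  so that \<open>Hquot\<close> can be treated through the reciprocals of the curvatures.\<close>

definition grad :: "(real^'n::finite \<Rightarrow> real) \<Rightarrow> real^'n \<Rightarrow> real^'n" where
  "grad g x = (\<chi> i. pd i g x)"

definition hess :: "(real^'n::finite \<Rightarrow> real) \<Rightarrow> real^'n \<Rightarrow> real^'n^'n" where
  "hess g x = (\<chi> i j. pd i (pd j g) x)"

lemma Ck_continuous_on: "Ck k S g \<Longrightarrow> continuous_on S g"
  by (cases k) auto

lemma Ck_pd_has_derivative:
  assumes "Ck (Suc k) S g" and "x + t *\<^sub>R axis i 1 \<in> S"
  shows "((\<lambda>t. g (x + t *\<^sub>R axis i 1)) has_real_derivative pd i g (x + t *\<^sub>R axis i 1)) (at t)"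
proof -
  have "(\<lambda>s. g (x + t *\<^sub>R axis i 1 + s *\<^sub>R axis i 1)) differentiable (at 0)"
    using assms by auto
  hence "((\<lambda>s. g (x + t *\<^sub>R axis i 1 + s *\<^sub>R axis i 1)) has_real_derivative
          pd i g (x + t *\<^sub>R axis i 1)) (at 0)"
    unfolding pd_def by (metis DERIV_deriv_iff_real_differentiable)
  hence "((\<lambda>s. g (x + (s + t) *\<^sub>R axis i 1)) has_real_derivative
          pd i g (x + t *\<^sub>R axis i 1)) (at 0)"
    by (simp add: scaleR_add_left add_ac)
  thus ?thesis
    using DERIV_shift[of "\<lambda>t. g (x + t *\<^sub>R axis i 1)" _ 0 t] by simp
qed

text \<open>\<open>Ck\<close> speaks of partial derivatives only. The coordinates of
  \<open>h\<close> are changed one at a time, each change being controlled by the mean value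
  inequality; the induction runs over the set \<open>I\<close> of coordinates changed.\<close>

lemma partial_increment:
  fixes g :: "real^'n::finite \<Rightarrow> real"
  assumes C: "Ck 1 S g" and b: "ball x d \<subseteq> S"
    and e: "\<And>y i. y \<in> ball x d \<Longrightarrow> \<bar>pd i g y - pd i g x\<bar> \<le> e"
    and I: "finite I"
  shows "norm h < d \<Longrightarrow> (\<And>i. i \<notin> I \<Longrightarrow> h $ i = 0) \<Longrightarrow>
    \<bar>g (x + h) - g x - (\<Sum>i\<in>I. h $ i * pd i g x)\<bar> \<le> e * (\<Sum>i\<in>I. \<bar>h $ i\<bar>)"
  using I
proof (induction I arbitrary: h rule: finite_induct)
  case empty
  hence "h = 0" by (simp add: vec_eq_iff)
  thus ?case by simp
next
  case (insert j I)
  define h' where "h' = h - (h $ j) *\<^sub>R axis j 1"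
  \<comment> \<open>Shrinking one coordinate does not increase the norm, so the segment from
    \<open>x + h'\<close> to \<open>x + h\<close> stays in the ball.\<close>
  have le: "norm (h' + t *\<^sub>R axis j 1) \<le> norm h" if "\<bar>t\<bar> \<le> \<bar>h $ j\<bar>" for t
  proof (rule norm_le_componentwise_cart)
    fix i show "norm ((h' + t *\<^sub>R axis j 1) $ i) \<le> norm (h $ i)"
      using that by (auto simp: h'_def axis_def)
  qed
  have h'n: "norm h' < d" using le[of 0] insert.prems by simp
  have h'i: "h' $ i = h $ i" if "i \<noteq> j" for i using that by (simp add: h'_def axis_def)
  have IH: "\<bar>g (x + h') - g x - (\<Sum>i\<in>I. h' $ i * pd i g x)\<bar> \<le> e * (\<Sum>i\<in>I. \<bar>h' $ i\<bar>)"
    by (rule insert.IH[OF h'n]) (use insert.prems in \<open>auto simp: h'_def axis_def\<close>)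
  have eqs: "(\<Sum>i\<in>I. h' $ i * pd i g x) = (\<Sum>i\<in>I. h $ i * pd i g x)"
            "(\<Sum>i\<in>I. \<bar>h' $ i\<bar>) = (\<Sum>i\<in>I. \<bar>h $ i\<bar>)"
    by (rule sum.cong, simp, metis h'i insert.hyps(2))+
  define \<psi> where "\<psi> t = g (x + h' + t *\<^sub>R axis j 1) - t * pd j g x" for t
  have "norm (\<psi> (h $ j) - \<psi> 0) \<le> e * norm (h $ j - 0)"
  proof (rule field_differentiable_bound)
    show "convex (cball (0::real) \<bar>h $ j\<bar>)" by simp
    fix t assume t: "t \<in> cball (0::real) \<bar>h $ j\<bar>"
    have "norm (h' + t *\<^sub>R axis j 1) < d"
      using le[of t] insert.prems t by simp
    hence yb: "x + h' + t *\<^sub>R axis j 1 \<in> ball x d"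
      using norm_minus_cancel[of "h' + t *\<^sub>R axis j 1"]
      by (simp add: dist_norm add.assoc)
    have "(\<psi> has_real_derivative (pd j g (x + h' + t *\<^sub>R axis j 1) - pd j g x)) (at t)"
      unfolding \<psi>_def
      using DERIV_diff[OF Ck_pd_has_derivative[where k=0, OF _ subsetD[OF b yb]]
          DERIV_cmult_right[OF DERIV_ident, of "pd j g x"]] C by simp
    thus "(\<psi> has_field_derivative (pd j g (x + h' + t *\<^sub>R axis j 1) - pd j g x))
          (at t within cball 0 \<bar>h $ j\<bar>)"
      by (rule has_field_derivative_at_within)
    show "norm (pd j g (x + h' + t *\<^sub>R axis j 1) - pd j g x) \<le> e"
      using e[OF yb] by simp
  qed auto
  hence "\<bar>g (x + h) - g (x + h') - h $ j * pd j g x\<bar> \<le> e * \<bar>h $ j\<bar>"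
    by (simp add: \<psi>_def h'_def algebra_simps)
  with IH show ?case unfolding eqs sum.insert[OF insert.hyps]
    by (simp add: algebra_simps abs_le_iff)
qed

lemma C1_has_derivative:
  fixes g :: "real^'n::finite \<Rightarrow> real"
  assumes C: "Ck 1 S g" and S: "open S" "x \<in> S"
  shows "(g has_derivative (\<lambda>h. grad g x \<bullet> h)) (at x)"
  unfolding has_derivative_iff_norm
proof
  show "bounded_linear (\<lambda>h. grad g x \<bullet> h)" by (rule bounded_linear_inner_right)
next
  show "(\<lambda>y. norm (g y - g x - grad g x \<bullet> (y - x)) / norm (y - x)) \<midarrow>x\<rightarrow> 0"
  proof (rule LIM_I)
    fix r :: real assume r: "0 < r"
    \<comment> \<open>The factor \<open>CARD('n)\<close> pays for bounding the sum of the
      \<open>\<bar>(y - x) $ i\<bar>\<close> by the norm, the 2 for strictness at the end.\<close>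
    define e where "e = r / (2 * real CARD('n))"
    have e0: "e > 0" using r by (simp add: e_def)
    have cont: "\<forall>i. \<exists>d>0. \<forall>y. dist y x < d \<longrightarrow> \<bar>pd i g y - pd i g x\<bar> < e"
    proof
      fix i
      have "continuous_on S (pd i g)" using C by simp
      hence "continuous (at x) (pd i g)" using S continuous_on_eq_continuous_at by blast
      thus "\<exists>d>0. \<forall>y. dist y x < d \<longrightarrow> \<bar>pd i g y - pd i g x\<bar> < e"
        using e0 unfolding continuous_at_eps_delta dist_real_def by blast
    qed
    then obtain D where D: "\<And>i. D i > 0" "\<And>i y. dist y x < D i \<Longrightarrow> \<bar>pd i g y - pd i g x\<bar> < e"
      by metis
    obtain d0 where d0: "d0 > 0" "ball x d0 \<subseteq> S" using S openE by blast
    define d where "d = Min (insert d0 (range D))"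
    have d: "d > 0" "d \<le> d0" using D d0 by (auto simp: d_def)
    have d': "d \<le> D i" for i unfolding d_def by (rule Min_le) auto
    have b: "ball x d \<subseteq> S" using d d0 by (meson order_trans subset_ball)
    have main: "\<bar>g y - g x - grad g x \<bullet> (y - x)\<bar> / norm (y - x) < r"
      if y: "y \<noteq> x" "norm (y - x) < d" for y
    proof -
      have "\<bar>g (x + (y - x)) - g x - (\<Sum>i\<in>UNIV. (y - x) $ i * pd i g x)\<bar>
            \<le> e * (\<Sum>i\<in>UNIV. \<bar>(y - x) $ i\<bar>)"
        by (rule partial_increment[OF C b])
           (use y in \<open>auto simp: dist_commute intro!: less_imp_le D(2) less_le_trans[OF _ d']\<close>)
      also have "(\<Sum>i\<in>UNIV. \<bar>(y - x) $ i\<bar>) \<le> real CARD('n) * norm (y - x)"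
        using sum_bounded_above[of UNIV "\<lambda>i. \<bar>(y - x) $ i\<bar>" "norm (y - x)"]
          component_le_norm_cart by (auto simp del: vector_minus_component)
      finally have "\<bar>g y - g x - grad g x \<bullet> (y - x)\<bar> \<le> e * (real CARD('n) * norm (y - x))"
        using e0 by (simp add: grad_def inner_vec_def mult.commute)
      also have "\<dots> = (r / 2) * norm (y - x)" by (simp add: e_def)
      also have "\<dots> < r * norm (y - x)" using y r by simp
      finally show ?thesis using y by (simp add: divide_less_eq)
    qed
    show "\<exists>s>0. \<forall>y. y \<noteq> x \<and> norm (y - x) < s \<longrightarrow>
       norm (norm (g y - g x - grad g x \<bullet> (y - x)) / norm (y - x) - 0) < r"
      using main d(1) by (intro exI[of _ d]) auto
  qed
qed

lemma Ck_line_deriv: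
  assumes "Ck (Suc k) S g" "open S" "y + s *\<^sub>R \<eta> \<in> S"
  shows "((\<lambda>s. g (y + s *\<^sub>R \<eta>)) has_real_derivative grad g (y + s *\<^sub>R \<eta>) \<bullet> \<eta>) (at s)"
proof -
  have C: "Ck 1 S g" using assms(1) by (auto dest: Ck_continuous_on)
  have "((\<lambda>s. g (y + s *\<^sub>R \<eta>)) has_derivative
      (\<lambda>h. grad g (y + s *\<^sub>R \<eta>) \<bullet> (h *\<^sub>R \<eta>))) (at s)"
  proof (rule has_derivative_compose[where f="\<lambda>s. y + s *\<^sub>R \<eta>" and g=g])
    have "((\<lambda>s. y + s *\<^sub>R \<eta>) has_derivative (\<lambda>h. 0 + h *\<^sub>R \<eta>)) (at s)"
      by (intro has_derivative_add has_derivative_const has_derivative_scaleR_left has_derivative_ident)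
    thus "((\<lambda>s. y + s *\<^sub>R \<eta>) has_derivative (\<lambda>h. h *\<^sub>R \<eta>)) (at s)" by simp
  qed (rule C1_has_derivative[OF C assms(2,3)])
  thus ?thesis by (rule has_derivative_imp_has_field_derivative) simp
qed

lemma Ck2_isCont:
  assumes C: "Ck 2 S g" and S: "open S" "x \<in> S"
  shows "continuous (at x) (pd i (pd j g))"
proof -
  have "continuous_on S (pd i (pd j g))" using C by (simp add: numeral_2_eq_2)
  thus ?thesis using S continuous_on_eq_continuous_at by blast
qed

text \<open>Two mean value steps show that the second difference over a square of side
  \<open>h\<close> is \<open>h\<^sup>2\<close> times a mixed derivative at some nearby point, in
  either order of differentiation. The difference is symmetric in the two directions, and continuity
  at \<open>x\<close> finishes.\<close>

lemma Schwarz_Ck: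
  fixes g :: "real^'n::finite \<Rightarrow> real"
  assumes C: "Ck 2 S g" and S: "open S" "x \<in> S"
  shows "pd i (pd j g) x = pd j (pd i g) x"
proof -
  have key: "\<exists>z\<in>ball x r. pd j (pd i g) z * h\<^sup>2 =
      g (x + h *\<^sub>R axis i 1 + h *\<^sub>R axis j 1) - g (x + h *\<^sub>R axis i 1) - g (x + h *\<^sub>R axis j 1) + g x"
    if rS: "ball x r \<subseteq> S" and h: "0 < h" "2 * h < r" for i j r h
  proof -
    let ?e = "axis i (1::real) :: real^'n" and ?f = "axis j (1::real) :: real^'n"
    have inb: "x + s *\<^sub>R ?e + t *\<^sub>R ?f \<in> ball x r" if "0 \<le> s" "s \<le> h" "0 \<le> t" "t \<le> h" for s t
    proof -
      have "norm (s *\<^sub>R ?e + t *\<^sub>R ?f) \<le> s + t"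
        using norm_triangle_ineq[of "s *\<^sub>R ?e" "t *\<^sub>R ?f"] that by simp
      hence "norm (s *\<^sub>R ?e + t *\<^sub>R ?f) < r" using that h by linarith
      moreover have "dist x (x + (s *\<^sub>R ?e + t *\<^sub>R ?f)) = norm (s *\<^sub>R ?e + t *\<^sub>R ?f)"
        by (metis add_diff_cancel_left' dist_commute dist_norm)
      ultimately show ?thesis by (simp add: add.assoc)
    qed
    have C1: "Ck (Suc 1) S g" using C by (simp add: numeral_2_eq_2)
    have C2: "Ck (Suc 0) S (pd i g)" using C by (simp add: numeral_2_eq_2)
    define F where "F s = g (x + h *\<^sub>R ?f + s *\<^sub>R ?e) - g (x + s *\<^sub>R ?e)" for s
    have "\<exists>z>0. z < h \<and> F h - F 0 =
        (h - 0) * (pd i g (x + h *\<^sub>R ?f + z *\<^sub>R ?e) - pd i g (x + z *\<^sub>R ?e))"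
    proof (rule MVT2)
      show "0 < h" by fact
      fix s assume s: "0 \<le> s" "s \<le> h"
      have "x + s *\<^sub>R ?e + h *\<^sub>R ?f \<in> ball x r" "x + s *\<^sub>R ?e + 0 *\<^sub>R ?f \<in> ball x r"
        by (rule inb; use s h in simp)+
      hence "x + h *\<^sub>R ?f + s *\<^sub>R ?e \<in> S" "x + s *\<^sub>R ?e \<in> S"
        using rS by (auto simp only: add_ac scaleR_zero_left add_0_right add_0_left)
      thus "(F has_real_derivative pd i g (x + h *\<^sub>R ?f + s *\<^sub>R ?e) - pd i g (x + s *\<^sub>R ?e)) (at s)"
        unfolding F_def by (intro derivative_intros Ck_pd_has_derivative[OF C1])
    qed
    then obtain z where z: "0 < z" "z < h" "F h - F 0 =
        h * (pd i g (x + h *\<^sub>R ?f + z *\<^sub>R ?e) - pd i g (x + z *\<^sub>R ?e))" by auto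
    have "\<exists>t>0. t < h \<and> pd i g (x + z *\<^sub>R ?e + h *\<^sub>R ?f) - pd i g (x + z *\<^sub>R ?e + 0 *\<^sub>R ?f) =
        (h - 0) * pd j (pd i g) (x + z *\<^sub>R ?e + t *\<^sub>R ?f)"
    proof (rule MVT2)
      show "0 < h" by fact
      fix t assume t: "0 \<le> t" "t \<le> h"
      show "((\<lambda>t. pd i g (x + z *\<^sub>R ?e + t *\<^sub>R ?f)) has_real_derivative
             pd j (pd i g) (x + z *\<^sub>R ?e + t *\<^sub>R ?f)) (at t)"
        by (rule Ck_pd_has_derivative[OF C2], rule subsetD[OF rS], rule inb) (use z t in auto)
    qed
    then obtain t where t: "0 < t" "t < h"
      "pd i g (x + z *\<^sub>R ?e + h *\<^sub>R ?f) - pd i g (x + z *\<^sub>R ?e) =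
        h * pd j (pd i g) (x + z *\<^sub>R ?e + t *\<^sub>R ?f)" by auto
    show ?thesis
    proof (rule bexI)
      show "x + z *\<^sub>R ?e + t *\<^sub>R ?f \<in> ball x r" using inb z t by auto
      show "pd j (pd i g) (x + z *\<^sub>R ?e + t *\<^sub>R ?f) * h\<^sup>2 =
        g (x + h *\<^sub>R ?e + h *\<^sub>R ?f) - g (x + h *\<^sub>R ?e) - g (x + h *\<^sub>R ?f) + g x"
      proof -
        have "pd j (pd i g) (x + z *\<^sub>R ?e + t *\<^sub>R ?f) * h\<^sup>2
            = h * (h * pd j (pd i g) (x + z *\<^sub>R ?e + t *\<^sub>R ?f))"
          by (simp only: power2_eq_square mult_ac)
        also have "\<dots> = h * (pd i g (x + z *\<^sub>R ?e + h *\<^sub>R ?f) - pd i g (x + z *\<^sub>R ?e))"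
          by (simp only: t(3))
        also have "\<dots> = F h - F 0" by (simp only: z(3) add_ac)
        also have "\<dots> = g (x + h *\<^sub>R ?e + h *\<^sub>R ?f) - g (x + h *\<^sub>R ?e) - g (x + h *\<^sub>R ?f) + g x"
          by (simp add: F_def add.assoc add.commute[of "h *\<^sub>R ?f"])
        finally show ?thesis .
      qed
    qed
  qed
  have cont: "continuous (at x) (pd i (pd j g))" "continuous (at x) (pd j (pd i g))"
    using Ck2_isCont[OF C S] by auto
  have "\<bar>pd i (pd j g) x - pd j (pd i g) x\<bar> \<le> 2 * e" if e: "e > 0" for e
  proof -
    obtain d1 where d1: "d1 > 0" "\<And>y. dist y x < d1 \<Longrightarrow> \<bar>pd i (pd j g) y - pd i (pd j g) x\<bar> < e"
      using cont(1) e unfolding continuous_at_eps_delta dist_real_def by blast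
    obtain d2 where d2: "d2 > 0" "\<And>y. dist y x < d2 \<Longrightarrow> \<bar>pd j (pd i g) y - pd j (pd i g) x\<bar> < e"
      using cont(2) e unfolding continuous_at_eps_delta dist_real_def by blast
    obtain d0 where d0: "d0 > 0" "ball x d0 \<subseteq> S" using S openE by blast
    define r where "r = min d0 (min d1 d2)"
    have r: "r > 0" "ball x r \<subseteq> S" using d0 d1 d2 by (auto simp: r_def)
    define h where "h = r / 3"
    have h: "0 < h" "2 * h < r" using r by (auto simp: h_def)
    obtain z1 where z1: "z1 \<in> ball x r" "pd j (pd i g) z1 * h\<^sup>2 =
      g (x + h *\<^sub>R axis i 1 + h *\<^sub>R axis j 1) - g (x + h *\<^sub>R axis i 1) - g (x + h *\<^sub>R axis j 1) + g x"
      using key[OF r(2) h] by blast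
    obtain z2 where z2: "z2 \<in> ball x r" "pd i (pd j g) z2 * h\<^sup>2 =
      g (x + h *\<^sub>R axis j 1 + h *\<^sub>R axis i 1) - g (x + h *\<^sub>R axis j 1) - g (x + h *\<^sub>R axis i 1) + g x"
      using key[OF r(2) h] by blast
    have "pd j (pd i g) z1 * h\<^sup>2 = pd i (pd j g) z2 * h\<^sup>2"
      unfolding z1(2) z2(2) by (simp add: add.assoc add.commute[of "h *\<^sub>R axis i 1"])
    hence "pd j (pd i g) z1 = pd i (pd j g) z2" using h by simp
    moreover have "dist z1 x < d2" "dist z2 x < d1"
      using z1(1) z2(1) by (auto simp: r_def dist_commute)
    ultimately show ?thesis using d1(2) d2(2) by (smt (verit))
  qed
  from this[of "\<bar>pd i (pd j g) x - pd j (pd i g) x\<bar> / 4"] show ?thesis by argo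
qed

lemma hess_symmetric:
  assumes "Ck 2 S g" "open S" "x \<in> S"
  shows "a \<bullet> (hess g x *v b) = b \<bullet> (hess g x *v a)"
proof -
  have "transpose (hess g x) = hess g x"
    using Schwarz_Ck[OF assms] by (simp add: hess_def transpose_def vec_eq_iff)
  thus ?thesis by (metis dot_lmul_matrix inner_commute transpose_matrix_vector)
qed

lemma grad_line_deriv:
  assumes C: "Ck 2 S g" and S: "open S" "y + s *\<^sub>R \<eta> \<in> S"
  shows "((\<lambda>s. grad g (y + s *\<^sub>R \<eta>)) has_vector_derivative (hess g (y + s *\<^sub>R \<eta>) *v \<eta>)) (at s)"
proof -
  have C2: "Ck (Suc 0) S (pd i g)" for i using C by (simp add: numeral_2_eq_2)
  have "((\<lambda>s. grad g (y + s *\<^sub>R \<eta>)) has_derivative (\<lambda>h. h *\<^sub>R (hess g (y + s *\<^sub>R \<eta>) *v \<eta>))) (at s)"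
  proof (subst has_derivative_componentwise_within, rule ballI)
    fix b :: "real^'a" assume "b \<in> Basis"
    then obtain i where b: "b = axis i 1" by (auto simp: Basis_vec_def)
    have "((\<lambda>s. pd i g (y + s *\<^sub>R \<eta>)) has_real_derivative
        grad (pd i g) (y + s *\<^sub>R \<eta>) \<bullet> \<eta>) (at s)"
      by (rule Ck_line_deriv[OF C2 S])
    moreover have "grad (pd i g) (y + s *\<^sub>R \<eta>) \<bullet> \<eta> = (hess g (y + s *\<^sub>R \<eta>) *v \<eta>) $ i"
      unfolding grad_def hess_def inner_vec_def matrix_vector_mult_def
      by (auto intro!: sum.cong simp: Schwarz_Ck[OF C S])
    ultimately show "((\<lambda>x. grad g (y + x *\<^sub>R \<eta>) \<bullet> b) has_derivative
             (\<lambda>x. x *\<^sub>R (hess g (y + s *\<^sub>R \<eta>) *v \<eta>) \<bullet> b)) (at s)"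
      by (simp add: b inner_axis grad_def has_field_derivative_def mult_commute_abs)
  qed
  thus ?thesis unfolding has_vector_derivative_def .
qed

lemma continuous_line_hess:
  assumes C: "Ck 2 S g" and S: "open S" "y \<in> S"
  shows "continuous (at 0) (\<lambda>s. hess g (y + s *\<^sub>R \<eta>) *v \<zeta>)"
proof -
  have c1: "continuous (at y) (\<lambda>x. hess g x *v \<zeta>)"
  proof -
    have "continuous (at y) (pd i (pd j g))" for i j
      by (rule Ck2_isCont[OF C S])
    thus ?thesis unfolding hess_def matrix_vector_mult_def continuous_def
      by (auto intro!: tendsto_intros simp: continuous_at)
  qed
  have "continuous (at 0) (\<lambda>s. y + s *\<^sub>R \<eta>)" by (intro continuous_intros)
  from continuous_at_compose[OF this, of "\<lambda>x. hess g x *v \<zeta>"] show ?thesis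
    using c1 by (simp add: o_def)
qed

text \<open>A product rule with a merely continuous factor: as \<open>E\<close> vanishes at 0, the
  difference quotient pairs \<open>M s\<close> with \<open>E s / s\<close>. It permits one more
  differentiation of a term whose factor \<open>M\<close> already contains second derivatives of the
  solution.\<close>

lemma has_derivative_inner_zero:
  fixes M E :: "real \<Rightarrow> 'a::real_inner"
  assumes M: "continuous (at 0) M" and E: "(E has_vector_derivative E') (at 0)" and 0: "E 0 = 0"
  shows "((\<lambda>s. M s \<bullet> E s) has_real_derivative M 0 \<bullet> E') (at 0)"
proof -
  have "((\<lambda>s. norm (E s - s *\<^sub>R E') / norm s) \<longlongrightarrow> 0) (at 0)"
    using E 0 by (simp add: has_vector_derivative_def has_derivative_at)
  moreover have "\<forall>\<^sub>F s in at 0. norm (E s - s *\<^sub>R E') / norm s = norm ((1 / s) *\<^sub>R E s - E')"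
  proof (rule eventually_at_filter[THEN iffD2], rule always_eventually, intro allI impI)
    fix s :: real assume s: "s \<noteq> 0"
    have "(1 / s) *\<^sub>R E s - E' = (1 / s) *\<^sub>R (E s - s *\<^sub>R E')"
      using s by (simp add: scaleR_diff_right)
    thus "norm (E s - s *\<^sub>R E') / norm s = norm ((1 / s) *\<^sub>R E s - E')"
      by (simp only: norm_scaleR) simp
  qed
  ultimately have "((\<lambda>s. norm ((1 / s) *\<^sub>R E s - E')) \<longlongrightarrow> 0) (at 0)"
    by (rule Lim_transform_eventually)
  hence "((\<lambda>s. (1 / s) *\<^sub>R E s) \<longlongrightarrow> E') (at 0)"
    by (metis Lim_null tendsto_norm_zero_iff)
  hence "((\<lambda>s. M s \<bullet> ((1 / s) *\<^sub>R E s)) \<longlongrightarrow> M 0 \<bullet> E') (at 0)"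
    using M by (intro tendsto_inner) (auto simp: continuous_at)
  thus ?thesis using 0 by (simp add: has_field_derivative_iff)
qed

lemma local_min_second_order:
  fixes g :: "real \<Rightarrow> real"
  assumes d: "0 < d" and g: "\<And>s. \<bar>s\<bar> < d \<Longrightarrow> (g has_real_derivative g' s) (at s)"
    and g'': "(g' has_real_derivative D) (at 0)"
    and min: "\<And>s. \<bar>s\<bar> < d \<Longrightarrow> g 0 \<le> g s"
  shows "g' 0 = 0" "0 \<le> D"
proof -
  show z: "g' 0 = 0"
    by (rule DERIV_local_min[OF g[of 0] d]) (use d min in auto)
  show "0 \<le> D"
  proof (rule ccontr)
    assume "\<not> 0 \<le> D"
    then obtain e where e: "e > 0" "\<And>h. h > 0 \<Longrightarrow> h < e \<Longrightarrow> g' (0 + h) < g' 0"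
      using DERIV_neg_dec_right[OF g''] by (metis not_le)
    define h where "h = min d e / 2"
    have h: "0 < h" "h < d" "h < e" using d e by (auto simp: h_def)
    have "\<exists>z>0. z < h \<and> g h - g 0 = (h - 0) * g' z"
      by (rule MVT2) (use h g in auto)
    then obtain z where "0 < z" "z < h" "g h - g 0 = h * g' z" by auto
    moreover have "g' z < 0" using e(2)[of z] z \<open>0 < z\<close> \<open>z < h\<close> h by auto
    ultimately have "g h < g 0" using h by (smt (verit) mult_pos_neg)
    thus False using min[of h] h by auto
  qed
qed

section \<open>Simultaneous diagonalization and comparison of eigenvalues\<close>

lemma matrix_vector_mult_sum_right: "A *v (\<Sum>i\<in>I. f i) = (\<Sum>i\<in>I. A *v f i)"
  for A :: "real^'n::finite^'m::finite"
  by (rule linear_sum[OF matrix_vector_mul_linear])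

text \<open>First-order condition at a maximum of a nonpositive form, without calculus: for b =
  \<open>h \<bullet> (A *v v)\<close> the form at \<open>v + t *\<^sub>R h\<close> is 2 t b plus a
  multiple of t^2, and \<open>t = b / c\<close> makes it at least b^2 / c.\<close>

lemma sym_form_zero:
  assumes s: "\<And>a b. a \<bullet> (A *v b) = b \<bullet> (A *v (a::real^'n::finite))"
    and nn: "\<And>h t. h \<in> V \<Longrightarrow> (v + t *\<^sub>R h) \<bullet> (A *v (v + t *\<^sub>R h)) \<le> 0"
    and z: "v \<bullet> (A *v v) = 0" and h: "h \<in> V"
  shows "h \<bullet> (A *v v) = 0"
proof (rule ccontr)
  assume n: "h \<bullet> (A *v v) \<noteq> 0"
  define b c where "b = h \<bullet> (A *v v)" and "c = \<bar>h \<bullet> (A *v h)\<bar> + 1"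
  have c: "c > 0" "h \<bullet> (A *v h) > - c" by (auto simp: c_def)
  define t where "t = b / c"
  have "(v + t *\<^sub>R h) \<bullet> (A *v (v + t *\<^sub>R h)) = 2 * t * b + t\<^sup>2 * (h \<bullet> (A *v h))"
    using z s[of v h] unfolding b_def
    by (simp add: matrix_vector_right_distrib matrix_vector_mult_scaleR inner_add_left inner_add_right
        power2_eq_square algebra_simps)
  also have "\<dots> \<ge> 2 * t * b - t\<^sup>2 * c"
    using mult_left_mono[of "-c" "h \<bullet> (A *v h)" "t\<^sup>2"] c by simp
  also have "2 * t * b - t\<^sup>2 * c = b\<^sup>2 / c"
    using c by (simp add: t_def power2_eq_square field_simps)
  finally have "b\<^sup>2 / c \<le> 0" using nn[OF h, of t] by linarith
  thus False using n c by (simp add: b_def divide_le_0_iff)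
qed

text \<open>The next eigenvector maximises \<open>x \<bullet> A x\<close> on the \<open>G\<close>-unit sphere of the
  \<open>G\<close>-orthogonal complement of the previous ones.\<close>

lemma simultaneous_diagonalization_aux:
  fixes A G :: "real^'n::finite^'n"
  assumes sA: "\<And>a b. a \<bullet> (A *v b) = b \<bullet> (A *v a)" and sG: "\<And>a b. a \<bullet> (G *v b) = b \<bullet> (G *v a)"
    and pG: "\<And>a. a \<noteq> 0 \<Longrightarrow> a \<bullet> (G *v a) > 0"
    and "finite (I :: 'n set)"
  shows "\<exists>b \<kappa>. (\<forall>i\<in>I. \<forall>j\<in>I. b i \<bullet> (G *v b j) = (if i = j then 1 else 0)) \<and>
    (\<forall>i\<in>I. A *v b i = \<kappa> i *\<^sub>R (G *v b i))"
  using \<open>finite I\<close>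
proof (induction I rule: finite_induct)
  case empty show ?case by simp
next
  case (insert k I)
  then obtain b \<kappa> where b: "\<And>i j. i \<in> I \<Longrightarrow> j \<in> I \<Longrightarrow> b i \<bullet> (G *v b j) = (if i = j then 1 else 0)"
    and k: "\<And>i. i \<in> I \<Longrightarrow> A *v b i = \<kappa> i *\<^sub>R (G *v b i)" by blast
  define V where "V = {x. \<forall>i\<in>I. x \<bullet> (G *v b i) = 0}"
  define Q where "Q = {x. x \<bullet> (G *v x) = 1} \<inter> V"
  have contG: "continuous_on UNIV (\<lambda>x. x \<bullet> (G *v x))" and contA: "continuous_on UNIV (\<lambda>x. x \<bullet> (A *v x))"
    by (intro continuous_intros matrix_vector_mult_linear_continuous_on)+
  have "card ((\<lambda>i. G *v b i) ` I) < CARD('n)"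
  proof -
    have "card ((\<lambda>i. G *v b i) ` I) \<le> card I" by (rule card_image_le) (rule insert)
    also have "\<dots> < card (insert k I)" using insert by simp
    also have "\<dots> \<le> CARD('n)" by (rule card_mono) auto
    finally show ?thesis .
  qed
  hence "dim ((\<lambda>i. G *v b i) ` I) < DIM(real^'n)"
    using dim_le_card'[of "(\<lambda>i. G *v b i) ` I"] insert by (simp add: less_le_trans)
  then obtain x0 where x0: "x0 \<noteq> 0" "\<And>y. y \<in> span ((\<lambda>i. G *v b i) ` I) \<Longrightarrow> orthogonal x0 y"
    using orthogonal_to_subspace_exists by metis
  hence x0V: "x0 \<in> V" unfolding V_def by (auto simp: orthogonal_def span_base)
  define x1 where "x1 = (1 / sqrt (x0 \<bullet> (G *v x0))) *\<^sub>R x0"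
  have "x1 \<in> Q" using x0V pG[OF x0(1)]
    by (auto simp: Q_def V_def x1_def matrix_vector_mult_scaleR)
  have "V = (\<Inter>i\<in>I. {x. x \<bullet> (G *v b i) = 0})" by (auto simp: V_def)
  hence "closed V" by (auto intro!: closed_INT closed_Collect_eq continuous_intros)
  moreover have "closed {x. x \<bullet> (G *v x) = 1}"
    using contG by (intro closed_Collect_eq) (auto intro: continuous_intros)
  ultimately have clQ: "closed Q" unfolding Q_def by blast
  \<comment> \<open>The least value of the form \<open>G\<close> on the Euclidean unit sphere; it
    bounds the \<open>G\<close>-unit sphere and hence \<open>Q\<close>.\<close>
  obtain m where m: "m > 0" "\<And>x. m * (norm x)\<^sup>2 \<le> x \<bullet> (G *v x)"
  proof -
    have "compact (sphere (0::real^'n) 1)" by simp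
    moreover have "sphere (0::real^'n) 1 \<noteq> {}" by simp
    ultimately obtain z where z: "z \<in> sphere 0 1" "\<And>y. y \<in> sphere 0 1 \<Longrightarrow> z \<bullet> (G *v z) \<le> y \<bullet> (G *v y)"
      using continuous_attains_inf[of "sphere 0 1" "\<lambda>x. x \<bullet> (G *v x)"] contG continuous_on_subset by blast
    have "(z \<bullet> (G *v z)) * (norm x)\<^sup>2 \<le> x \<bullet> (G *v x)" for x
    proof (cases "x = 0")
      case False
      have "z \<bullet> (G *v z) \<le> ((1 / norm x) *\<^sub>R x) \<bullet> (G *v ((1 / norm x) *\<^sub>R x))"
        using False by (intro z) simp
      thus ?thesis using False
        by (simp add: matrix_vector_mult_scaleR field_simps power2_eq_square)
    qed simp
    moreover have "z \<bullet> (G *v z) > 0" using z(1) by (intro pG) auto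
    ultimately show ?thesis using that by blast
  qed
  have "bounded Q"
  proof (rule boundedI)
    fix x assume "x \<in> Q"
    hence "m * (norm x)\<^sup>2 \<le> 1" using m(2)[of x] by (auto simp: Q_def)
    hence "(norm x)\<^sup>2 \<le> 1 / m" using m(1) by (simp add: field_simps)
    thus "norm x \<le> sqrt (1 / m)" by (rule real_le_rsqrt)
  qed
  hence "compact Q" using clQ compact_eq_bounded_closed by blast
  then obtain v where v: "v \<in> Q" "\<And>y. y \<in> Q \<Longrightarrow> y \<bullet> (A *v y) \<le> v \<bullet> (A *v v)"
    using continuous_attains_sup[of Q "\<lambda>x. x \<bullet> (A *v x)"] \<open>x1 \<in> Q\<close> contA continuous_on_subset by blast
  define l where "l = v \<bullet> (A *v v)"
  define M where "M = A - l *\<^sub>R G"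
  have M: "M *v x = A *v x - l *\<^sub>R (G *v x)" for x
    by (simp add: M_def matrix_vector_mult_diff_rdistrib scaleR_matrix_vector_assoc)
  have vV: "v \<in> V" and v1: "v \<bullet> (G *v v) = 1" using v by (auto simp: Q_def)
  have neg: "x \<bullet> (M *v x) \<le> 0" if x: "x \<in> V" for x
  proof (cases "x = 0")
    case False
    have p: "x \<bullet> (G *v x) > 0" by (rule pG[OF False])
    have "(1 / sqrt (x \<bullet> (G *v x))) *\<^sub>R x \<in> Q" using x p
      by (auto simp: Q_def V_def matrix_vector_mult_scaleR)
    from v(2)[OF this] have "x \<bullet> (A *v x) \<le> l * (x \<bullet> (G *v x))" using p
      by (simp add: l_def matrix_vector_mult_scaleR field_simps)
    thus ?thesis by (simp add: M inner_diff_right)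
  qed simp
  have onV: "h \<bullet> (M *v v) = 0" if "h \<in> V" for h
  proof (rule sym_form_zero[of M V])
    show "a \<bullet> (M *v b) = b \<bullet> (M *v a)" for a b
      by (metis M inner_diff_right inner_scaleR_right sA sG)
    show "(v + t *\<^sub>R h) \<bullet> (M *v (v + t *\<^sub>R h)) \<le> 0" if "h \<in> V" for h t
      using that vV by (intro neg) (auto simp: V_def inner_add_left)
    show "v \<bullet> (M *v v) = 0" by (simp add: M inner_diff_right v1 l_def)
  qed fact
  have onb: "b i \<bullet> (M *v v) = 0" if "i \<in> I" for i
  proof -
    have "b i \<bullet> (A *v v) = 0" using k[OF that] vV that sA[of "b i" v] by (auto simp: V_def)
    moreover have "b i \<bullet> (G *v v) = 0" using vV that sG[of "b i" v] by (auto simp: V_def)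
    ultimately show ?thesis by (simp add: M inner_diff_right)
  qed
  \<comment> \<open>Subtracting the \<open>G\<close>-projection onto the earlier eigenvectors leaves
    a vector of \<open>V\<close>; \<open>M *v v\<close> is orthogonal to both parts.\<close>
  have "x \<bullet> (M *v v) = 0" for x
  proof -
    define y where "y = x - (\<Sum>i\<in>I. (x \<bullet> (G *v b i)) *\<^sub>R b i)"
    have "y \<bullet> (G *v b j) = 0" if "j \<in> I" for j
    proof -
      have "(\<Sum>i\<in>I. (x \<bullet> (G *v b i)) *\<^sub>R b i) \<bullet> (G *v b j)
        = (\<Sum>i\<in>I. (x \<bullet> (G *v b i)) * (if i = j then 1 else 0))"
        using that by (simp add: inner_sum_left b)
      also have "\<dots> = x \<bullet> (G *v b j)" using that insert.hyps by (simp add: if_distrib sum.delta cong: if_cong)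
      finally show ?thesis by (simp add: y_def inner_diff_left)
    qed
    hence "y \<bullet> (M *v v) = 0" by (intro onV) (simp add: V_def)
    moreover have "(\<Sum>i\<in>I. (x \<bullet> (G *v b i)) *\<^sub>R b i) \<bullet> (M *v v) = 0"
      by (simp add: inner_sum_left onb)
    ultimately show ?thesis by (simp add: y_def inner_diff_left)
  qed
  hence "M *v v = 0" by (metis inner_eq_zero_iff)
  hence eig: "A *v v = l *\<^sub>R (G *v v)" by (simp add: M)
  have vb: "v \<bullet> (G *v b i) = 0" "b i \<bullet> (G *v v) = 0" if "i \<in> I" for i
    using vV that sG[of "b i" v] by (auto simp: V_def)
  have "k \<notin> I" by fact
  hence ne: "i \<noteq> k" if "i \<in> I" for i using that by blast
  show ?case
    by (rule exI[of _ "b(k := v)"], rule exI[of _ "\<kappa>(k := l)"])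
       (use ne b k vb v1 eig in \<open>auto\<close>)
qed

definition orthonormal_wrt :: "real^'n::finite^'n \<Rightarrow> ('n \<Rightarrow> real^'n) \<Rightarrow> bool" where
  "orthonormal_wrt G b \<longleftrightarrow> (\<forall>i j. b i \<bullet> (G *v b j) = (if i = j then 1 else 0))"

lemma simultaneous_diagonalization:
  fixes A G :: "real^'n::finite^'n"
  assumes "\<And>a b. a \<bullet> (A *v b) = b \<bullet> (A *v a)" and "\<And>a b. a \<bullet> (G *v b) = b \<bullet> (G *v a)"
    and "\<And>a. a \<noteq> 0 \<Longrightarrow> a \<bullet> (G *v a) > 0"
  obtains b and \<kappa> :: "real^'n" where "orthonormal_wrt G b" "\<And>i. A *v b i = \<kappa> $ i *\<^sub>R (G *v b i)"
proof -
  obtain b :: "'n \<Rightarrow> real^'n" and \<kappa> where "\<forall>i j. b i \<bullet> (G *v b j) = (if i = j then 1 else 0)"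
    "\<forall>i. A *v b i = \<kappa> i *\<^sub>R (G *v b i)"
    using simultaneous_diagonalization_aux[OF assms, of UNIV] by auto
  thus ?thesis using that[of b "\<chi> i. \<kappa> i"] by (auto simp: orthonormal_wrt_def)
qed

lemma orthonormal_wrt_sum:
  assumes "orthonormal_wrt G b" and "finite I"
  shows "(\<Sum>i\<in>I. c i *\<^sub>R b i) \<bullet> (G *v (\<Sum>i\<in>I. c i *\<^sub>R b i)) = (\<Sum>i\<in>I. (c i)\<^sup>2)"
proof -
  have "(\<Sum>i\<in>I. c i *\<^sub>R b i) \<bullet> (G *v (\<Sum>i\<in>I. c i *\<^sub>R b i))
     = (\<Sum>i\<in>I. \<Sum>j\<in>I. c i * (c j * (if j = i then 1 else 0)))"
    using assms(1) by (simp add: matrix_vector_mult_sum_right inner_sum_left inner_sum_right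
        matrix_vector_mult_scaleR orthonormal_wrt_def sum_distrib_left)
  also have "\<dots> = (\<Sum>i\<in>I. (c i)\<^sup>2)"
    using assms(2) by (simp add: if_distrib power2_eq_square cong: if_cong)
  finally show ?thesis .
qed

lemma eigenbasis_sum:
  assumes "orthonormal_wrt G b" and "finite I" and "\<And>i. M *v b i = \<mu> i *\<^sub>R (G *v b i)"
  shows "(\<Sum>i\<in>I. c i *\<^sub>R b i) \<bullet> (M *v (\<Sum>i\<in>I. c i *\<^sub>R b i)) = (\<Sum>i\<in>I. \<mu> i * (c i)\<^sup>2)"
proof -
  have "(\<Sum>i\<in>I. c i *\<^sub>R b i) \<bullet> (M *v (\<Sum>i\<in>I. c i *\<^sub>R b i))
     = (\<Sum>i\<in>I. \<Sum>j\<in>I. c i * \<mu> i * (c j * (if j = i then 1 else 0)))"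
    using assms(1,3) by (simp add: matrix_vector_mult_sum_right inner_sum_left inner_sum_right
        matrix_vector_mult_scaleR orthonormal_wrt_def sum_distrib_left)
  also have "\<dots> = (\<Sum>i\<in>I. \<mu> i * (c i)\<^sup>2)"
    using assms(2) by (simp add: if_distrib power2_eq_square mult_ac cong: if_cong)
  finally show ?thesis .
qed

lemma orthonormal_wrt_independent:
  assumes o: "orthonormal_wrt G b"
  shows "independent (b ` I)" and "inj b"
proof -
  show inj: "inj b"
  proof (rule injI)
    fix i j assume e: "b i = b j"
    have "b i \<bullet> (G *v b i) = 1" using o by (simp add: orthonormal_wrt_def)
    hence "b i \<bullet> (G *v b j) = 1" by (simp only: e)
    thus "i = j" using o by (auto simp: orthonormal_wrt_def split: if_splits)
  qed
  show "independent (b ` I)"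
  proof (rule independent_if_scalars_zero)
    show "finite (b ` I)" by simp
    fix f x assume s: "(\<Sum>x\<in>b ` I. f x *\<^sub>R x) = 0" and x: "x \<in> b ` I"
    have "(\<Sum>i\<in>I. f (b i) *\<^sub>R b i) = 0"
      using s inj by (simp add: sum.reindex inj_on_subset)
    hence "(\<Sum>i\<in>I. (f (b i))\<^sup>2) = 0"
      using orthonormal_wrt_sum[OF o, of I "\<lambda>i. f (b i)"] by simp
    hence "\<forall>i\<in>I. f (b i) = 0" by (simp add: sum_nonneg_eq_0_iff)
    thus "f x = 0" using x by auto
  qed
qed

section \<open>Monotonicity of eigenvalues by counting and matching\<close>

lemma span_image_sum:
  assumes "x \<in> span (b ` I)" "inj b" "finite I"
  obtains c where "x = (\<Sum>i\<in>I. c i *\<^sub>R b i)"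
proof -
  obtain u where "x = (\<Sum>v\<in>b ` I. u v *\<^sub>R v)"
    using assms by (auto simp: span_finite)
  also have "\<dots> = (\<Sum>i\<in>I. u (b i) *\<^sub>R b i)"
    using assms by (simp add: sum.reindex inj_on_subset)
  finally show ?thesis using that[of "\<lambda>i. u (b i)"] by blast
qed

text \<open>Weyl's monotonicity by dimension: if the count failed, the span of the
  \<open>e i\<close> with \<open>t \<le> l i\<close> and that of the \<open>b i\<close> with
  \<open>\<mu> i < t\<close> would share some nonzero \<open>x\<close>. There the form of
  \<open>M\<close> is at least t times the \<open>G\<close>-square of \<open>x\<close> by
  \<open>lo\<close>, and less than that by the eigenbasis. In \<open>e\<close> the form is just
  bounded below by a diagonal one, which is what second-order contact provides.\<close>

lemma eigenvalue_count:
  fixes e b :: "'n::finite \<Rightarrow> real^'n"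
  assumes e: "orthonormal_wrt G e" and b: "orthonormal_wrt G b"
    and lo: "\<And>c. (\<Sum>i\<in>UNIV. l i * (c i)\<^sup>2) \<le>
                (\<Sum>i\<in>UNIV. c i *\<^sub>R e i) \<bullet> (M *v (\<Sum>i\<in>UNIV. c i *\<^sub>R e i))"
    and eig: "\<And>i. M *v b i = \<mu> i *\<^sub>R (G *v b i)"
  shows "card {i. t \<le> l i} \<le> card {i. t \<le> \<mu> i}"
proof (rule ccontr)
  assume nle: "\<not> card {i. t \<le> l i} \<le> card {i. t \<le> \<mu> i}"
  define I J where "I = {i. t \<le> l i}" and "J = {i. \<mu> i < t}"
  have "card J + card {i. t \<le> \<mu> i} = CARD('n)"
    unfolding J_def by (subst card_Un_disjoint[symmetric]) (auto intro: arg_cong[where f=card])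
  hence gt: "card I + card J > CARD('n)" using nle by (simp add: I_def)
  have dI: "dim (span (e ` I)) = card I" and dJ: "dim (span (b ` J)) = card J"
    using orthonormal_wrt_independent[OF e] orthonormal_wrt_independent[OF b]
    by (simp_all add: dim_eq_card_independent card_image inj_on_subset)
  have "dim {x + y |x y. x \<in> span (e ` I) \<and> y \<in> span (b ` J)} + dim (span (e ` I) \<inter> span (b ` J))
      = card I + card J"
    using dim_sums_Int[of "span (e ` I)" "span (b ` J)"] dI dJ by simp
  moreover have "dim {x + y |x y. x \<in> span (e ` I) \<and> y \<in> span (b ` J)} \<le> CARD('n)"
    using dim_subset_UNIV[of "{x + y |x y. x \<in> span (e ` I) \<and> y \<in> span (b ` J)}"] by simp
  ultimately have "dim (span (e ` I) \<inter> span (b ` J)) \<noteq> 0" using gt by linarith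
  then obtain x where x: "x \<in> span (e ` I)" "x \<in> span (b ` J)" "x \<noteq> 0"
    by (auto simp: dim_eq_0)
  obtain c where c: "x = (\<Sum>i\<in>I. c i *\<^sub>R e i)"
    using span_image_sum[OF x(1)] orthonormal_wrt_independent(2)[OF e] by auto
  obtain d where d: "x = (\<Sum>i\<in>J. d i *\<^sub>R b i)"
    using span_image_sum[OF x(2)] orthonormal_wrt_independent(2)[OF b] by auto
  have N: "(\<Sum>i\<in>I. (c i)\<^sup>2) = (\<Sum>i\<in>J. (d i)\<^sup>2)"
    using orthonormal_wrt_sum[OF e, of I c] orthonormal_wrt_sum[OF b, of J d] c d by simp
  obtain j where j: "j \<in> J" "d j \<noteq> 0" 
  proof (rule ccontr)
    assume "\<not> thesis"
    hence "\<forall>j\<in>J. d j = 0" using that by blast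
    thus False using x(3) d by simp
  qed
  define c' where "c' i = (if i \<in> I then c i else 0)" for i
  have x': "x = (\<Sum>i\<in>UNIV. c' i *\<^sub>R e i)"
    unfolding c c'_def by (intro sum.mono_neutral_cong_left) auto
  have "t * (\<Sum>i\<in>I. (c i)\<^sup>2) \<le> (\<Sum>i\<in>I. l i * (c i)\<^sup>2)"
    unfolding sum_distrib_left by (intro sum_mono mult_right_mono) (auto simp: I_def)
  also have "\<dots> = (\<Sum>i\<in>UNIV. l i * (c' i)\<^sup>2)"
    unfolding c'_def by (intro sum.mono_neutral_cong_left) auto
  also have "\<dots> \<le> x \<bullet> (M *v x)" unfolding x' by (rule lo)
  also have "\<dots> = (\<Sum>i\<in>J. \<mu> i * (d i)\<^sup>2)"
    unfolding d by (rule eigenbasis_sum[OF b _ eig]) simp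
  also have "\<dots> < (\<Sum>i\<in>J. t * (d i)\<^sup>2)"
  proof (rule sum_strict_mono_ex1)
    show "\<forall>i\<in>J. \<mu> i * (d i)\<^sup>2 \<le> t * (d i)\<^sup>2" by (auto simp: J_def intro!: mult_right_mono)
    show "\<exists>i\<in>J. \<mu> i * (d i)\<^sup>2 < t * (d i)\<^sup>2" using j by (auto simp: J_def)
  qed simp
  finally show False by (simp add: N sum_distrib_left)
qed

lemma finite_arg_max:
  fixes l :: "'a \<Rightarrow> real"
  assumes "finite I" "I \<noteq> {}"
  obtains i where "i \<in> I" "\<And>j. j \<in> I \<Longrightarrow> l j \<le> l i"
proof -
  have "Max (l ` I) \<in> l ` I" using assms by (intro Max_in) auto
  then obtain i where "i \<in> I" "l i = Max (l ` I)" by auto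
  thus ?thesis using that[of i] assms(1) by simp
qed

lemma bij_betw_extend:
  assumes "bij_betw p (I - {i}) (J - {j})" "i \<in> I" "j \<in> J"
  shows "bij_betw (p(i := j)) I J"
proof -
  let ?p = "p(i := j)"
  have "bij_betw ?p (I - {i}) (J - {j})"
    by (rule bij_betw_cong[THEN iffD1, OF _ assms(1)]) auto
  hence "bij_betw ?p ((I - {i}) \<union> {i}) ((J - {j}) \<union> {?p i})"
    by (subst notIn_Un_bij_betw3[symmetric]) auto
  moreover have "(I - {i}) \<union> {i} = I" "(J - {j}) \<union> {?p i} = J" using assms(2,3) by auto
  ultimately show ?thesis by simp
qed

text \<open>Pair a largest \<open>l\<close> with a largest \<open>m\<close> and recurse: for
  thresholds up to the largest \<open>l\<close> both counts drop by one, above it the left count is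
  zero. Counts thus become a termwise inequality up to a permutation, to which a symmetric f is
  blind.\<close>

lemma bij_of_counts:
  fixes l :: "'a \<Rightarrow> real" and m :: "'b \<Rightarrow> real"
  assumes "finite I" "finite J" "card I = card J"
    and "\<And>t. card {i\<in>I. t \<le> l i} \<le> card {j\<in>J. t \<le> m j}"
  shows "\<exists>p. bij_betw p I J \<and> (\<forall>i\<in>I. l i \<le> m (p i))"
  using assms
proof (induction "card I" arbitrary: I J)
  case 0 thus ?case by (auto simp: bij_betw_def)
next
  case (Suc n)
  have ne: "I \<noteq> {}" "J \<noteq> {}" using Suc by auto
  obtain i0 where i0: "i0 \<in> I" "\<And>i. i \<in> I \<Longrightarrow> l i \<le> l i0"
    using finite_arg_max[of I l] ne Suc.prems by metis
  obtain j0 where j0: "j0 \<in> J" "\<And>j. j \<in> J \<Longrightarrow> m j \<le> m j0"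
    using finite_arg_max[of J m] ne Suc.prems by metis
  have "card {i\<in>I. l i0 \<le> l i} > 0" using i0 Suc.prems by (auto simp: card_gt_0_iff)
  hence "card {j\<in>J. l i0 \<le> m j} > 0" using Suc.prems(4)[of "l i0"] by linarith
  then obtain j where "j \<in> J" "l i0 \<le> m j" by (auto simp: card_gt_0_iff)
  hence le: "l i0 \<le> m j0" using j0 by force
  have "\<exists>p. bij_betw p (I - {i0}) (J - {j0}) \<and> (\<forall>i\<in>I - {i0}. l i \<le> m (p i))"
  proof (rule Suc.hyps(1))
    show "n = card (I - {i0})" "card (I - {i0}) = card (J - {j0})" using Suc i0 j0 by auto
    fix t show "card {i \<in> I - {i0}. t \<le> l i} \<le> card {j \<in> J - {j0}. t \<le> m j}"
    proof (cases "t \<le> l i0")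
      case True
      have "{i \<in> I - {i0}. t \<le> l i} = {i \<in> I. t \<le> l i} - {i0}"
           "{j \<in> J - {j0}. t \<le> m j} = {j \<in> J. t \<le> m j} - {j0}" by auto
      thus ?thesis using Suc.prems(4)[of t] True le i0 j0 Suc.prems by (simp add: card_Diff_singleton diff_le_mono)
    next
      case False
      hence "{i \<in> I - {i0}. t \<le> l i} = {}" using i0 by fastforce
      thus ?thesis by (metis card.empty le0)
    qed
  qed (use Suc.prems in auto)
  then obtain p where p: "bij_betw p (I - {i0}) (J - {j0})" "\<And>i. i \<in> I - {i0} \<Longrightarrow> l i \<le> m (p i)" by blast
  show ?case using bij_betw_extend[OF p(1) i0(1) j0(1)] p(2) le by (intro exI[of _ "p(i0 := j0)"]) auto
qed

section \<open>Principal curvatures\<close>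

text \<open>The Euclidean first fundamental form, that is \<open>gmat\<close> without its conformal
  factor. After common factors are removed, \<kappa> is an eigenvalue of \<open>hmat\<close>
  relative to \<open>gmat\<close> iff \<open>slope\<close> times \<kappa> is one of
  \<open>Amat\<close> relative to this matrix.\<close>

definition metric_matrix :: "(real^'n::finite \<Rightarrow> real) \<Rightarrow> real^'n \<Rightarrow> real^'n^'n" where
  "metric_matrix u x = (\<chi> i j. (if i = j then 1 else 0) + pd i u x * pd j u x)"

definition slope :: "(real^'n::finite \<Rightarrow> real) \<Rightarrow> real^'n \<Rightarrow> real" where
  "slope u x = sqrt (1 + grad u x \<bullet> grad u x)"

lemma slope_ge_1: "1 \<le> slope u x"
  by (simp add: slope_def)

lemma slope_sq: "(slope u x)\<^sup>2 = 1 + grad u x \<bullet> grad u x"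
  by (simp add: slope_def)

lemma metric_matrix_mult: "metric_matrix u x *v a = a + (grad u x \<bullet> a) *\<^sub>R grad u x"
proof -
  have "(metric_matrix u x *v a) $ i = (a + (grad u x \<bullet> a) *\<^sub>R grad u x) $ i" for i
  proof -
    have "(metric_matrix u x *v a) $ i = (\<Sum>j\<in>UNIV. (if i = j then a $ j else 0) + pd i u x * (pd j u x * a $ j))"
      by (simp add: metric_matrix_def matrix_vector_mult_def) (auto intro!: sum.cong simp: distrib_right)
    also have "\<dots> = a $ i + pd i u x * (\<Sum>j\<in>UNIV. pd j u x * a $ j)"
      by (simp add: sum.distrib sum_distrib_left)
    finally show ?thesis by (simp add: grad_def inner_vec_def)
  qed
  thus ?thesis by (simp add: vec_eq_iff)
qed

lemma Amat_mult: "Amat u x *v a = metric_matrix u x *v a + u x *\<^sub>R (hess u x *v a)"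
proof -
  have "Amat u x = metric_matrix u x + u x *\<^sub>R hess u x"
    by (simp add: metric_matrix_def Amat_def hess_def vec_eq_iff)
  thus ?thesis by (simp add: matrix_vector_mult_add_rdistrib scaleR_matrix_vector_assoc[symmetric])
qed

lemma metric_matrix_form: "a \<bullet> (metric_matrix u x *v b) = a \<bullet> b + (grad u x \<bullet> a) * (grad u x \<bullet> b)"
  by (simp add: metric_matrix_mult inner_add_right inner_commute[of a])

lemma metric_matrix_sym: "a \<bullet> (metric_matrix u x *v b) = b \<bullet> (metric_matrix u x *v a)"
  by (simp add: metric_matrix_form inner_commute)

lemma metric_matrix_pos: "a \<noteq> 0 \<Longrightarrow> a \<bullet> (metric_matrix u x *v a) > 0"
  by (simp add: metric_matrix_form add_pos_nonneg)

lemma Amat_sym: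
  assumes "Ck 2 S u" "open S" "x \<in> S"
  shows "a \<bullet> (Amat u x *v b) = b \<bullet> (Amat u x *v a)"
  using metric_matrix_sym[of a u x b] hess_symmetric[OF assms, of a b] by (simp add: Amat_mult inner_add_right)

text \<open>A root of the left product is a root of the right one, so a factor cancels. The
  cancelled identity is first known away from that root; continuity extends it to the root
  itself.\<close>

lemma linear_factors_unique:
  fixes a :: "'a \<Rightarrow> real" and b :: "'b \<Rightarrow> real"
  assumes "finite I" "finite J" "card I = card J"
    and "\<And>t. (\<Prod>i\<in>I. a i - t) = (\<Prod>j\<in>J. b j - t)"
  shows "\<exists>p. bij_betw p I J \<and> (\<forall>i\<in>I. a i = b (p i))"
  using assms
proof (induction "card I" arbitrary: I J)
  case 0 thus ?case by (auto simp: bij_betw_def)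
next
  case (Suc n)
  then obtain i0 where i0: "i0 \<in> I" by fastforce
  have "(\<Prod>j\<in>J. b j - a i0) = 0"
    using Suc.prems(4)[of "a i0"] i0 Suc.prems(1) by (metis diff_self prod_zero_iff)
  then obtain j0 where j0: "j0 \<in> J" "b j0 = a i0" using Suc.prems(2) by auto
  define F where "F t = (\<Prod>i\<in>I - {i0}. a i - t) - (\<Prod>j\<in>J - {j0}. b j - t)" for t
  have F0: "F t = 0" if "t \<noteq> a i0" for t
  proof -
    have "(a i0 - t) * F t = (\<Prod>i\<in>I. a i - t) - (\<Prod>j\<in>J. b j - t)"
      using i0 j0 Suc.prems by (simp add: F_def right_diff_distrib prod.remove)
    thus ?thesis using Suc.prems(4) that by simp
  qed
  have "isCont F (a i0)" unfolding F_def by (intro continuous_intros)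
  moreover have "(F \<longlongrightarrow> 0) (at (a i0))"
    by (rule tendsto_eventually) (auto simp: eventually_at_filter F0)
  ultimately have "F (a i0) = 0" by (metis LIM_unique isCont_def)
  hence F: "F t = 0" for t using F0 by metis
  have "\<exists>p. bij_betw p (I - {i0}) (J - {j0}) \<and> (\<forall>i\<in>I - {i0}. a i = b (p i))"
    by (rule Suc.hyps(1)) (use Suc i0 j0 F in \<open>auto simp: F_def\<close>)
  then obtain p where p: "bij_betw p (I - {i0}) (J - {j0})" "\<And>i. i \<in> I - {i0} \<Longrightarrow> a i = b (p i)" by blast
  show ?case using bij_betw_extend[OF p(1) i0 j0(1)] p(2) j0 by (intro exI[of _ "p(i0 := j0)"]) auto
qed

text \<open>With the \<open>b j\<close> as columns of \<open>B\<close>, the product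
  \<open>transpose B ** M ** B\<close> is diagonal. This evaluates the characteristic polynomial of
  h relative to g in a simultaneous eigenbasis without inverting g.\<close>

lemma det_congruence:
  fixes M :: "real^'n::finite^'n"
  assumes "\<And>i j. b i \<bullet> (M *v b j) = (if i = j then d i else 0)"
  shows "(det (\<chi> i j. b j $ i))\<^sup>2 * det M = (\<Prod>i\<in>UNIV. d i)"
proof -
  define B :: "real^'n^'n" where "B = (\<chi> i j. b j $ i)"
  have "transpose B ** (M ** B) = (\<chi> i j. if i = j then d i else 0)"
  proof -
    have "(transpose B ** (M ** B)) $ i $ j = b i \<bullet> (M *v b j)" for i j
      by (simp add: B_def transpose_def matrix_matrix_mult_def matrix_vector_mult_def inner_vec_def)
    thus ?thesis using assms by (simp add: vec_eq_iff)
  qed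
  moreover have "det (\<chi> i j. if i = j then d i else (0::real)) = (\<Prod>i\<in>UNIV. d i)"
    by (subst det_diagonal) auto
  ultimately have "det (transpose B ** (M ** B)) = (\<Prod>i\<in>UNIV. d i)" by simp
  thus ?thesis by (simp add: det_mul B_def[symmetric] power2_eq_square mult_ac)
qed

text \<open>\<open>principal_curvatures\<close> fixes only a characteristic polynomial. A
  simultaneous eigenbasis of \<open>Amat\<close> and \<open>metric_matrix\<close> yields a list with
  the same polynomial, hence equal to \<kappa> up to a permutation, by which the basis is
  relabelled.\<close>

lemma principal_basis:
  fixes u :: "real^'n::finite \<Rightarrow> real"
  assumes pc: "principal_curvatures u x \<kappa>" and u: "u x \<noteq> 0"
    and S: "Ck 2 S u" "open S" "x \<in> S"
  obtains b where "orthonormal_wrt (metric_matrix u x) b"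
    "\<And>i. Amat u x *v b i = (slope u x * \<kappa> $ i) *\<^sub>R (metric_matrix u x *v b i)"
proof -
  let ?G = "metric_matrix u x" and ?A = "Amat u x" and ?W = "slope u x"
  obtain b and l :: "real^'n" where b: "orthonormal_wrt ?G b" and l: "\<And>i. ?A *v b i = l $ i *\<^sub>R (?G *v b i)"
    using simultaneous_diagonalization[of ?A ?G, OF Amat_sym[OF S] metric_matrix_sym metric_matrix_pos] by blast
  have W: "?W > 0" using slope_ge_1[of u x] by linarith
  have G: "b i \<bullet> (?G *v b j) = (if i = j then 1 else 0)" for i j using b by (simp add: orthonormal_wrt_def)
  define D where "D = (det (\<chi> i j. b j $ i))\<^sup>2"
  have sl: "?W = sqrt (1 + (\<Sum>i\<in>UNIV. (pd i u x)\<^sup>2))"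
    by (simp add: slope_def grad_def inner_vec_def power2_eq_square)
  have gm: "gmat u x = (1 / (u x)\<^sup>2) *\<^sub>R ?G"
    by (simp add: gmat_def metric_matrix_def vec_eq_iff)
  have hm: "hmat u x = (1 / ((u x)\<^sup>2 * ?W)) *\<^sub>R ?A"
    unfolding hmat_def sl ..
  have g: "D * det (gmat u x) = (\<Prod>i\<in>(UNIV::'n set). 1 / (u x)\<^sup>2)"
    unfolding D_def by (rule det_congruence) (simp add: gm scaleR_matrix_vector_assoc[symmetric] G)
  hence D0: "D * det (gmat u x) \<noteq> 0" using u by simp
  have h: "D * det (hmat u x - t *\<^sub>R gmat u x) = (\<Prod>i\<in>UNIV. (1 / (u x)\<^sup>2) * (l $ i / ?W - t))" for t
    unfolding D_def
  proof (rule det_congruence)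
    fix i j
    show "b i \<bullet> ((hmat u x - t *\<^sub>R gmat u x) *v b j) = (if i = j then 1 / (u x)\<^sup>2 * (l $ i / ?W - t) else 0)"
      using W u by (simp add: gm hm matrix_vector_mult_diff_rdistrib scaleR_matrix_vector_assoc[symmetric]
          inner_diff_right l G field_simps)
  qed
  have "(\<Prod>i\<in>UNIV. l $ i / ?W - t) = (\<Prod>i\<in>UNIV. \<kappa> $ i - t)" for t
  proof -
    have "D * det (gmat u x) * (\<Prod>i\<in>UNIV. l $ i / ?W - t) = D * det (hmat u x - t *\<^sub>R gmat u x)"
      unfolding h g by (simp only: prod.distrib)
    also have "\<dots> = D * det (gmat u x) * (\<Prod>i\<in>UNIV. \<kappa> $ i - t)"
      using pc by (simp add: principal_curvatures_def)
    finally show ?thesis by (rule mult_left_cancel[OF D0, THEN iffD1])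
  qed
  then obtain p where p: "bij_betw p UNIV UNIV" "\<And>i. \<kappa> $ i = l $ p i / ?W"
    using linear_factors_unique[of "UNIV::'n set" "UNIV::'n set" "\<lambda>i. \<kappa> $ i" "\<lambda>i. l $ i / ?W"] by auto
  show ?thesis
  proof (rule that[of "\<lambda>i. b (p i)"])
    have "p i = p j \<longleftrightarrow> i = j" for i j using p(1) by (auto simp: bij_betw_def inj_on_def)
    thus "orthonormal_wrt ?G (\<lambda>i. b (p i))" by (simp add: orthonormal_wrt_def G)
    show "?A *v b (p i) = (?W * \<kappa> $ i) *\<^sub>R (?G *v b (p i))" for i
      using W by (simp add: l p(2))
  qed
qed

text \<open>What the geometry asks of f. \<open>f_diag\<close> serves the comparison with umbilic
  spheres. In \<open>f_flow\<close>, \<open>T\<close> and \<open>C\<close> are sinh and cosh of a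
  distance, and f is evaluated at the curvatures of the parallel hypersurface at that
  distance.\<close>

locale curvature_function =
  fixes f :: "real^'n::finite \<Rightarrow> real" and \<sigma> :: real
  assumes sigma: "0 < \<sigma>" "\<sigma> < 1"
    and f_perm: "\<And>p \<mu>. p permutes UNIV \<Longrightarrow> \<mu> \<in> Kpos \<Longrightarrow> f (\<chi> i. \<mu> $ p i) = f \<mu>"
    and f_mono: "\<And>\<nu> \<mu>. \<nu> \<in> Kpos \<Longrightarrow> \<mu> \<in> Kpos \<Longrightarrow> (\<And>i. \<nu> $ i \<le> \<mu> $ i) \<Longrightarrow> f \<nu> \<le> f \<mu>"
    and f_diag: "\<And>\<tau>. \<tau> > 0 \<Longrightarrow> f (\<chi> i. \<tau>) = \<tau>"
    and f_flow: "\<And>\<kappa> T C. \<kappa> \<in> Kpos \<Longrightarrow> f \<kappa> = \<sigma> \<Longrightarrow> 0 < T \<Longrightarrow> C = sqrt (1 + T\<^sup>2) \<Longrightarrow>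
      \<sigma> < f (\<chi> i. (T + C * \<kappa> $ i) / (C + T * \<kappa> $ i))"
begin

text \<open>Covers both problems of \<open>uniqueness\<close>, \<epsilon> = 0 being the asymptotic
  one; \<open>C1_upto\<close> and \<open>smooth_upto\<close> each supply the continuity on the
  closure.\<close>

definition solution :: "(real^'n) set \<Rightarrow> real \<Rightarrow> (real^'n \<Rightarrow> real) \<Rightarrow> bool" where
  "solution \<Omega> \<epsilon> u \<longleftrightarrow> admissible \<Omega> u \<and> smooth_on \<Omega> u \<and> continuous_on (closure \<Omega>) u \<and>
     (\<forall>x\<in>\<Omega>. curv_eq f u x \<sigma>) \<and> (\<forall>x\<in>frontier \<Omega>. u x = \<epsilon>)"

lemma solutionD:
  assumes "solution \<Omega> \<epsilon> u"
  shows "Ck k \<Omega> u" "continuous_on (closure \<Omega>) u" "x \<in> frontier \<Omega> \<Longrightarrow> u x = \<epsilon>"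
    "x \<in> \<Omega> \<Longrightarrow> u x > 0" "x \<in> \<Omega> \<Longrightarrow> \<xi> \<noteq> 0 \<Longrightarrow> \<xi> \<bullet> (Amat u x *v \<xi>) > 0"
  using assms by (auto simp: solution_def smooth_on_def admissible_def pos_def_def)

text \<open>Admissibility, tested on an eigenvector, makes each principal curvature positive, so
  \<kappa> lies in \<open>Kpos\<close>, where the assumptions on f apply.\<close>

lemma curvature_basis:
  assumes "open \<Omega>" "x \<in> \<Omega>" and s: "solution \<Omega> \<epsilon> u"
  obtains \<kappa> b where "\<kappa> \<in> Kpos" "f \<kappa> = \<sigma>" "orthonormal_wrt (metric_matrix u x) b"
    "\<And>i. Amat u x *v b i = (slope u x * \<kappa> $ i) *\<^sub>R (metric_matrix u x *v b i)"
proof -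
  obtain \<kappa> where k: "principal_curvatures u x \<kappa>" "f \<kappa> = \<sigma>"
    using s assms(2) by (auto simp: solution_def curv_eq_def)
  have ux: "u x \<noteq> 0" using solutionD(4)[OF s assms(2)] by simp
  obtain b where b: "orthonormal_wrt (metric_matrix u x) b"
    "\<And>i. Amat u x *v b i = (slope u x * \<kappa> $ i) *\<^sub>R (metric_matrix u x *v b i)"
    using principal_basis[OF k(1) ux solutionD(1)[OF s] assms(1,2)] by blast
  have "\<kappa> $ i > 0" for i
  proof -
    have 1: "b i \<bullet> (metric_matrix u x *v b i) = 1" using b(1) by (simp add: orthonormal_wrt_def)
    hence "b i \<noteq> 0" by auto
    hence "b i \<bullet> (Amat u x *v b i) > 0" by (rule solutionD(5)[OF s assms(2)])
    hence "slope u x * \<kappa> $ i > 0" using 1 by (simp add: b(2))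
    thus ?thesis using slope_ge_1[of u x] by (simp add: zero_less_mult_iff)
  qed
  thus ?thesis using that[OF _ k(2) b] by (simp add: Kpos_def)
qed

text \<open>All principal curvatures are at least \<tau>, and f is \<tau> at an umbilic point of
  curvature \<tau>. This and its mirror image below turn contact with a sphere into an inequality
  for \<sigma>.\<close>

lemma curvature_lower_bound:
  assumes "open \<Omega>" "x \<in> \<Omega>" "solution \<Omega> \<epsilon> u" and t: "\<tau> > 0"
    and lo: "\<And>\<xi>. \<xi> \<bullet> (Amat u x *v \<xi>) \<ge> \<tau> * slope u x * (\<xi> \<bullet> (metric_matrix u x *v \<xi>))"
  shows "\<tau> \<le> \<sigma>"
proof -
  obtain \<kappa> b where k: "\<kappa> \<in> Kpos" "f \<kappa> = \<sigma>" and b: "orthonormal_wrt (metric_matrix u x) b"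
    "\<And>i. Amat u x *v b i = (slope u x * \<kappa> $ i) *\<^sub>R (metric_matrix u x *v b i)"
    using curvature_basis[OF assms(1-3)] by blast
  have "\<tau> \<le> \<kappa> $ i" for i
    using lo[of "b i"] b slope_ge_1[of u x] by (simp add: orthonormal_wrt_def)
  hence "f (\<chi> i. \<tau>) \<le> f \<kappa>" using t k by (intro f_mono) (auto simp: Kpos_def)
  thus ?thesis using f_diag[OF t] k by simp
qed

lemma curvature_upper_bound:
  assumes "open \<Omega>" "x \<in> \<Omega>" "solution \<Omega> \<epsilon> u" and t: "\<tau> > 0"
    and up: "\<And>\<xi>. \<xi> \<bullet> (Amat u x *v \<xi>) \<le> \<tau> * slope u x * (\<xi> \<bullet> (metric_matrix u x *v \<xi>))"
  shows "\<sigma> \<le> \<tau>"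
proof -
  obtain \<kappa> b where k: "\<kappa> \<in> Kpos" "f \<kappa> = \<sigma>" and b: "orthonormal_wrt (metric_matrix u x) b"
    "\<And>i. Amat u x *v b i = (slope u x * \<kappa> $ i) *\<^sub>R (metric_matrix u x *v b i)"
    using curvature_basis[OF assms(1-3)] by blast
  have "\<kappa> $ i \<le> \<tau>" for i
    using up[of "b i"] b slope_ge_1[of u x] by (simp add: orthonormal_wrt_def)
  hence "f \<kappa> \<le> f (\<chi> i. \<tau>)" using t k by (intro f_mono) (auto simp: Kpos_def)
  thus ?thesis using f_diag[OF t] k by simp
qed

text \<open>By \<open>lo\<close>, counting and matching, the parallel curvatures are bounded by
  those of v up to a permutation. Monotonicity then puts their f-value at most at \<sigma>, while
  \<open>f_flow\<close> puts it strictly above.\<close>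

lemma no_touching_parallel:
  assumes "open \<Omega>" "x \<in> \<Omega>" "solution \<Omega> \<epsilon> v" and k: "\<kappa> \<in> Kpos" "f \<kappa> = \<sigma>"
    and T: "0 < T" "C = sqrt (1 + T\<^sup>2)" and e: "orthonormal_wrt (metric_matrix v x) e"
    and lo: "\<And>c. (\<Sum>i\<in>UNIV. slope v x * ((T + C * \<kappa> $ i) / (C + T * \<kappa> $ i)) * (c i)\<^sup>2) \<le>
      (\<Sum>i\<in>UNIV. c i *\<^sub>R e i) \<bullet> (Amat v x *v (\<Sum>i\<in>UNIV. c i *\<^sub>R e i))"
  shows False
proof -
  define \<kappa>' :: "real^'n" where "\<kappa>' = (\<chi> i. (T + C * \<kappa> $ i) / (C + T * \<kappa> $ i))"
  have C: "C > 0" using T by (simp add: add_pos_nonneg)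
  have k': "\<kappa>' \<in> Kpos" using k T C by (auto simp: \<kappa>'_def Kpos_def intro!: divide_pos_pos add_pos_pos)
  obtain \<mu> b where m: "\<mu> \<in> Kpos" "f \<mu> = \<sigma>" and b: "orthonormal_wrt (metric_matrix v x) b"
    "\<And>i. Amat v x *v b i = (slope v x * \<mu> $ i) *\<^sub>R (metric_matrix v x *v b i)"
    using curvature_basis[OF assms(1-3)] by blast
  have W: "slope v x > 0" using slope_ge_1[of v x] by linarith
  have "card {i. t \<le> slope v x * \<kappa>' $ i} \<le> card {i. t \<le> slope v x * \<mu> $ i}" for t
    by (rule eigenvalue_count[OF e b(1) _ b(2)]) (use lo in \<open>simp add: \<kappa>'_def\<close>)
  hence "\<exists>p. bij_betw p UNIV UNIV \<and> (\<forall>i\<in>UNIV. slope v x * \<kappa>' $ i \<le> slope v x * \<mu> $ p i)"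
    by (intro bij_of_counts) auto
  then obtain p where p: "bij p" "\<And>i. \<kappa>' $ i \<le> \<mu> $ p i" using W by auto
  have "p permutes UNIV" by (rule bij_imp_permutes) (use p(1) in auto)
  hence "f (\<chi> i. \<mu> $ p i) = \<sigma>" using f_perm m by simp
  moreover have "f \<kappa>' \<le> f (\<chi> i. \<mu> $ p i)"
    using k' m p(2) by (intro f_mono) (auto simp: Kpos_def)
  moreover have "\<sigma> < f \<kappa>'" unfolding \<kappa>'_def by (rule f_flow[OF k T])
  ultimately show False by simp
qed

end

section \<open>Touching spheres and barriers\<close>

lemma line_in_ball:
  fixes x \<xi> :: "'a::real_normed_vector"
  assumes "0 < r"
  obtains d where "0 < d" "\<And>s. \<bar>s\<bar> < d \<Longrightarrow> x + s *\<^sub>R \<xi> \<in> ball x r"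
proof
  show "0 < r / (norm \<xi> + 1)" using assms by (simp add: add_nonneg_pos)
  fix s assume "\<bar>s\<bar> < r / (norm \<xi> + 1)"
  hence "\<bar>s\<bar> * (norm \<xi> + 1) < r" by (simp add: pos_less_divide_eq add_nonneg_pos)
  moreover have "\<bar>s\<bar> * norm \<xi> \<le> \<bar>s\<bar> * (norm \<xi> + 1)" by (intro mult_left_mono) auto
  ultimately show "x + s *\<^sub>R \<xi> \<in> ball x r" by (simp add: dist_norm)
qed

lemma line_has_vector_derivative: "((\<lambda>s. y + s *\<^sub>R \<eta>) has_vector_derivative \<eta>) (at s)"
  by (auto intro!: derivative_eq_intros)

lemma grad_hess_line_deriv:
  assumes C: "Ck 2 S g" and S: "open S" "y + s *\<^sub>R \<eta> \<in> S"
  shows "((\<lambda>s. grad g (y + s *\<^sub>R \<eta>) \<bullet> \<eta>) has_real_derivative \<eta> \<bullet> (hess g (y + s *\<^sub>R \<eta>) *v \<eta>)) (at s)"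
  using bounded_linear.has_vector_derivative[OF bounded_linear_inner_left grad_line_deriv[OF C S], of \<eta>]
  by (simp add: has_real_derivative_iff_has_vector_derivative inner_commute)

lemma norm_line_deriv:
  fixes y c :: "'a::real_inner"
  shows "((\<lambda>s. (norm (y + s *\<^sub>R \<eta> - c))\<^sup>2) has_real_derivative 2 * ((y + s *\<^sub>R \<eta> - c) \<bullet> \<eta>)) (at s)"
proof -
  have "((\<lambda>s. (norm (y - c))\<^sup>2 + 2 * s * ((y - c) \<bullet> \<eta>) + s\<^sup>2 * (norm \<eta>)\<^sup>2) has_real_derivative
     2 * ((y - c) \<bullet> \<eta>) + 2 * s * (norm \<eta>)\<^sup>2) (at s)"
    by (auto intro!: derivative_eq_intros)
  moreover have "(\<lambda>s. (norm (y - c))\<^sup>2 + 2 * s * ((y - c) \<bullet> \<eta>) + s\<^sup>2 * (norm \<eta>)\<^sup>2) = (\<lambda>s. (norm (y + s *\<^sub>R \<eta> - c))\<^sup>2)"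
    unfolding power2_norm_eq_inner
    by (auto simp: algebra_simps inner_add_left inner_diff_left inner_commute power2_eq_square fun_eq_iff)
  moreover have "2 * ((y - c) \<bullet> \<eta>) + 2 * s * (norm \<eta>)\<^sup>2 = 2 * ((y + s *\<^sub>R \<eta> - c) \<bullet> \<eta>)"
    unfolding power2_norm_eq_inner by (simp add: algebra_simps)
  ultimately show ?thesis by simp
qed

lemma local_min_grad_hess:
  fixes u :: "real^'n::finite \<Rightarrow> real"
  assumes C: "Ck 2 S u" and S: "open S" "x \<in> S" and r: "0 < r"
    and min: "\<And>y. y \<in> ball x r \<Longrightarrow> u x \<le> u y"
  shows "grad u x = 0" "0 \<le> \<xi> \<bullet> (hess u x *v \<xi>)"
proof -
  obtain r0 where r0: "r0 > 0" "ball x r0 \<subseteq> S" using S openE by blast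
  define q where "q = min r r0"
  have q: "q > 0" "ball x q \<subseteq> S" "ball x q \<subseteq> ball x r" using r r0 by (auto simp: q_def)
  have main: "grad u x \<bullet> \<xi> = 0 \<and> 0 \<le> \<xi> \<bullet> (hess u x *v \<xi>)" for \<xi>
  proof -
    obtain d where d: "d > 0" "\<And>s. \<bar>s\<bar> < d \<Longrightarrow> x + s *\<^sub>R \<xi> \<in> ball x q"
      using line_in_ball[OF q(1)] by metis
    have "Ck (Suc 1) S u" using C by (simp add: numeral_2_eq_2)
    hence 1: "((\<lambda>s. u (x + s *\<^sub>R \<xi>)) has_real_derivative grad u (x + s *\<^sub>R \<xi>) \<bullet> \<xi>) (at s)" if "\<bar>s\<bar> < d" for s
      using Ck_line_deriv[OF _ S(1)] d(2)[OF that] q(2) by blast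
    have 2: "((\<lambda>s. grad u (x + s *\<^sub>R \<xi>) \<bullet> \<xi>) has_real_derivative \<xi> \<bullet> (hess u (x + 0 *\<^sub>R \<xi>) *v \<xi>)) (at 0)"
      by (rule grad_hess_line_deriv[OF C S(1)]) (use S in simp)
    have 3: "u (x + 0 *\<^sub>R \<xi>) \<le> u (x + s *\<^sub>R \<xi>)" if "\<bar>s\<bar> < d" for s
      using min d(2)[OF that] q(3) by auto
    from local_min_second_order[OF d(1) 1 2 3] show ?thesis by simp
  qed
  thus "0 \<le> \<xi> \<bullet> (hess u x *v \<xi>)" by blast
  show "grad u x = 0" using main by (metis inner_eq_zero_iff)
qed

text \<open>The level sets of \<open>(x, s) \<mapsto> |x - c|\<^sup>2 + s\<^sup>2 - 2 b s\<close> are the Euclidean spheres centred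
  at \<open>(c, b)\<close>, which are umbilic in hyperbolic space.\<close>

lemma sphere_touch:
  fixes u :: "real^'n::finite \<Rightarrow> real"
  assumes C: "Ck 2 S u" and S: "open S" "x \<in> S" and r: "0 < r"
    and min: "\<And>y. y \<in> ball x r \<Longrightarrow> (norm (x - c))\<^sup>2 + (u x)\<^sup>2 - 2 * b * u x \<le> (norm (y - c))\<^sup>2 + (u y)\<^sup>2 - 2 * b * u y"
  shows "x - c = (b - u x) *\<^sub>R grad u x" "b * (\<xi> \<bullet> (hess u x *v \<xi>)) \<le> \<xi> \<bullet> (Amat u x *v \<xi>)"
proof -
  obtain r0 where r0: "r0 > 0" "ball x r0 \<subseteq> S" using S openE by blast
  define q where "q = min r r0"
  have q: "q > 0" "ball x q \<subseteq> S" "ball x q \<subseteq> ball x r" using r r0 by (auto simp: q_def)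
  have main: "((x - c) + (u x - b) *\<^sub>R grad u x) \<bullet> \<xi> = 0 \<and> b * (\<xi> \<bullet> (hess u x *v \<xi>)) \<le> \<xi> \<bullet> (Amat u x *v \<xi>)" for \<xi>
  proof -
    obtain d where d: "d > 0" "\<And>s. \<bar>s\<bar> < d \<Longrightarrow> x + s *\<^sub>R \<xi> \<in> ball x q"
      using line_in_ball[OF q(1)] by metis
    have C': "Ck (Suc 1) S u" using C by (simp add: numeral_2_eq_2)
    let ?g = "\<lambda>s. (norm (x + s *\<^sub>R \<xi> - c))\<^sup>2 + (u (x + s *\<^sub>R \<xi>))\<^sup>2 - 2 * b * u (x + s *\<^sub>R \<xi>)"
    let ?g' = "\<lambda>s. 2 * ((x + s *\<^sub>R \<xi> - c) \<bullet> \<xi>) + 2 * (u (x + s *\<^sub>R \<xi>) - b) * (grad u (x + s *\<^sub>R \<xi>) \<bullet> \<xi>)"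
    let ?D = "2 * (\<xi> \<bullet> \<xi>) + 2 * (grad u x \<bullet> \<xi>)\<^sup>2 + 2 * (u x - b) * (\<xi> \<bullet> (hess u x *v \<xi>))"
    have u1: "((\<lambda>s. u (x + s *\<^sub>R \<xi>)) has_real_derivative grad u (x + s *\<^sub>R \<xi>) \<bullet> \<xi>) (at s)" if "\<bar>s\<bar> < d" for s
      using Ck_line_deriv[OF C' S(1)] d(2)[OF that] q(2) by blast
    have u2: "((\<lambda>s. grad u (x + s *\<^sub>R \<xi>) \<bullet> \<xi>) has_real_derivative \<xi> \<bullet> (hess u (x + 0 *\<^sub>R \<xi>) *v \<xi>)) (at 0)"
      by (rule grad_hess_line_deriv[OF C S(1)]) (use S in simp)
    have l: "((\<lambda>s. (x + s *\<^sub>R \<xi> - c) \<bullet> \<xi>) has_real_derivative \<xi> \<bullet> \<xi>) (at s)" for s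
    proof -
      have "((\<lambda>s. (x - c) \<bullet> \<xi> + s * (\<xi> \<bullet> \<xi>)) has_real_derivative \<xi> \<bullet> \<xi>) (at s)"
        by (auto intro!: derivative_eq_intros)
      thus ?thesis by (simp add: inner_add_left inner_diff_left algebra_simps)
    qed
    have 1: "(?g has_real_derivative ?g' s) (at s)" if "\<bar>s\<bar> < d" for s
      by (rule derivative_eq_intros norm_line_deriv u1[OF that] refl)+ (simp add: algebra_simps)
    have 2: "(?g' has_real_derivative ?D) (at 0)"
      by (rule derivative_eq_intros l u1[of 0] u2 d refl | simp add: d algebra_simps power2_eq_square)+
    have 3: "?g 0 \<le> ?g s" if "\<bar>s\<bar> < d" for s
      using min[of "x + s *\<^sub>R \<xi>"] d(2)[OF that] q(3) by auto
    \<comment> \<open>Half of \<open>?D\<close> is \<open>\<xi> \<bullet> (Amat u x *v \<xi>) - b *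
      (\<xi> \<bullet> (hess u x *v \<xi>))\<close>, the Hessian term with factor u completing the
      metric part to \<open>Amat\<close>.\<close>
    have "?g' 0 = 0" "0 \<le> ?D" using local_min_second_order[OF d(1) 1 2 3] by simp_all
    thus ?thesis by (simp add: Amat_mult metric_matrix_form inner_add_left inner_add_right power2_eq_square algebra_simps)
  qed
  thus "b * (\<xi> \<bullet> (hess u x *v \<xi>)) \<le> \<xi> \<bullet> (Amat u x *v \<xi>)" by blast
  have "(x - c) + (u x - b) *\<^sub>R grad u x = 0" using main by (metis inner_eq_zero_iff)
  thus "x - c = (b - u x) *\<^sub>R grad u x"
    by (simp add: algebra_simps)
qed

text \<open>If \<open>a\<close> is the sinh of a distance to a totally geodesic hypersurface,
  \<open>a / sqrt (1 + a\<^sup>2)\<close> is its tanh, the curvature of the equidistant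
  surface.\<close>

lemma tanh_mono:
  fixes a b :: real
  assumes "0 \<le> a" "a < b"
  shows "a / sqrt (1 + a\<^sup>2) < b / sqrt (1 + b\<^sup>2)"
proof -
  have "a\<^sup>2 * (1 + b\<^sup>2) < b\<^sup>2 * (1 + a\<^sup>2)"
    using power_strict_mono[of a b 2] assms by (simp add: algebra_simps)
  hence "sqrt (a\<^sup>2 * (1 + b\<^sup>2)) < sqrt (b\<^sup>2 * (1 + a\<^sup>2))" by (rule real_sqrt_less_mono)
  hence "a * sqrt (1 + b\<^sup>2) < b * sqrt (1 + a\<^sup>2)" using assms by (simp add: real_sqrt_mult)
  moreover have "sqrt (1 + a\<^sup>2) > 0" "sqrt (1 + b\<^sup>2) > 0" by (simp_all add: add_pos_nonneg)
  ultimately show ?thesis by (simp add: field_simps)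
qed

context curvature_function
begin

text \<open>\<open>\<sigma>\<close> is the hyperbolic tangent, and \<open>\<sigma>sinh\<close> the hyperbolic sine, of the distance to a totally
  geodesic hypersurface at which all principal curvatures are \<open>\<sigma>\<close>.\<close>

definition "\<sigma>sinh = \<sigma> / sqrt (1 - \<sigma>\<^sup>2)"

lemma \<sigma>sinh: "0 < \<sigma>sinh" "\<sigma>sinh / sqrt (1 + \<sigma>sinh\<^sup>2) = \<sigma>"
proof -
  have 1: "1 - \<sigma>\<^sup>2 > 0" using sigma by (simp add: power_less_one_iff)
  thus "0 < \<sigma>sinh" using sigma by (simp add: \<sigma>sinh_def)
  have "1 + \<sigma>sinh\<^sup>2 = 1 / (1 - \<sigma>\<^sup>2)" using 1 by (simp add: \<sigma>sinh_def power_divide field_simps)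
  hence "sqrt (1 + \<sigma>sinh\<^sup>2) = 1 / sqrt (1 - \<sigma>\<^sup>2)" by (simp add: real_sqrt_divide)
  thus "\<sigma>sinh / sqrt (1 + \<sigma>sinh\<^sup>2) = \<sigma>" using 1 by (simp add: \<sigma>sinh_def)
qed

text \<open>The sphere has centre (c, -B) and the square root as radius L. Its upper cap is umbilic
  of curvature B / L and touches the graph from below.\<close>

lemma sphere_touch_lower:
  assumes O: "open \<Omega>" "x \<in> \<Omega>" "solution \<Omega> \<epsilon> u" and r: "0 < r" and B: "0 < B"
    and min: "\<And>y. y \<in> ball x r \<Longrightarrow> (norm (x - c))\<^sup>2 + (u x)\<^sup>2 + 2 * B * u x \<le> (norm (y - c))\<^sup>2 + (u y)\<^sup>2 + 2 * B * u y"
  shows "B / sqrt ((norm (x - c))\<^sup>2 + (u x + B)\<^sup>2) \<le> \<sigma>"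
proof -
  have t: "x - c = (-B - u x) *\<^sub>R grad u x" "-B * (\<xi> \<bullet> (hess u x *v \<xi>)) \<le> \<xi> \<bullet> (Amat u x *v \<xi>)" for \<xi>
    using sphere_touch[OF solutionD(1)[OF O(3)] O(1,2) r, of c "-B"] min by simp_all
  have u: "u x > 0" by (rule solutionD(4)[OF O(3,2)])
  have W: "slope u x > 0" using slope_ge_1[of u x] by linarith
  have "(norm (x - c))\<^sup>2 + (u x + B)\<^sup>2 = ((u x + B) * slope u x)\<^sup>2"
    unfolding power_mult_distrib slope_sq t(1) power2_norm_eq_inner
    by (simp add: algebra_simps power2_eq_square)
  hence L: "sqrt ((norm (x - c))\<^sup>2 + (u x + B)\<^sup>2) = (u x + B) * slope u x"
    using u B W by simp
  show ?thesis
  proof (rule curvature_lower_bound[OF O])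
    show "0 < B / sqrt ((norm (x - c))\<^sup>2 + (u x + B)\<^sup>2)" unfolding L using u B W by simp
    fix \<xi>
    have "\<xi> \<bullet> (Amat u x *v \<xi>) = \<xi> \<bullet> (metric_matrix u x *v \<xi>) + u x * (\<xi> \<bullet> (hess u x *v \<xi>))"
      by (simp add: Amat_mult inner_add_right)
    moreover have "u x * (-B * (\<xi> \<bullet> (hess u x *v \<xi>))) \<le> u x * (\<xi> \<bullet> (Amat u x *v \<xi>))"
      using t(2) u by (intro mult_left_mono) auto
    ultimately have "B * (\<xi> \<bullet> (metric_matrix u x *v \<xi>)) \<le> (u x + B) * (\<xi> \<bullet> (Amat u x *v \<xi>))"
      by (simp add: algebra_simps)
    hence "B / (u x + B) * (\<xi> \<bullet> (metric_matrix u x *v \<xi>)) \<le> \<xi> \<bullet> (Amat u x *v \<xi>)"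
      using u B by (simp add: field_simps)
    thus "B / sqrt ((norm (x - c))\<^sup>2 + (u x + B)\<^sup>2) * slope u x * (\<xi> \<bullet> (metric_matrix u x *v \<xi>)) \<le> \<xi> \<bullet> (Amat u x *v \<xi>)"
      unfolding L using W by simp
  qed
qed

text \<open>The centre (c, b) is not below the contact point, so the lower half of the sphere
  touches, from above; its curvature is b over the radius. \<open>x \<noteq> c\<close> excludes
  \<open>u x = b\<close>, where the first-order condition gives \<open>x = c\<close>.\<close>

lemma sphere_touch_upper:
  assumes O: "open \<Omega>" "x \<in> \<Omega>" "solution \<Omega> \<epsilon> u" and r: "0 < r" and b: "u x \<le> b" and xc: "x \<noteq> c"
    and min: "\<And>y. y \<in> ball x r \<Longrightarrow> (norm (x - c))\<^sup>2 + (u x)\<^sup>2 - 2 * b * u x \<le> (norm (y - c))\<^sup>2 + (u y)\<^sup>2 - 2 * b * u y"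
  shows "\<sigma> \<le> b / sqrt ((norm (x - c))\<^sup>2 + (u x - b)\<^sup>2)"
proof -
  have t: "x - c = (b - u x) *\<^sub>R grad u x" "b * (\<xi> \<bullet> (hess u x *v \<xi>)) \<le> \<xi> \<bullet> (Amat u x *v \<xi>)" for \<xi>
    using sphere_touch[OF solutionD(1)[OF O(3)] O(1,2) r, of c b] min by simp_all
  have u: "u x > 0" by (rule solutionD(4)[OF O(3,2)])
  have b': "u x < b" using b xc t(1) by (cases "b = u x") auto
  have W: "slope u x > 0" using slope_ge_1[of u x] by linarith
  have "(norm (x - c))\<^sup>2 = (b - u x)\<^sup>2 * (grad u x \<bullet> grad u x)"
    unfolding t(1) power2_norm_eq_inner by (simp add: power2_eq_square)
  hence "(norm (x - c))\<^sup>2 + (u x - b)\<^sup>2 = ((b - u x) * slope u x)\<^sup>2"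
    by (simp add: power_mult_distrib slope_sq distrib_left power2_commute[of "u x" b])
  hence L: "sqrt ((norm (x - c))\<^sup>2 + (u x - b)\<^sup>2) = (b - u x) * slope u x"
    using b' W by simp
  show ?thesis
  proof (rule curvature_upper_bound[OF O])
    show "0 < b / sqrt ((norm (x - c))\<^sup>2 + (u x - b)\<^sup>2)" unfolding L using u b' W by simp
    fix \<xi>
    have "\<xi> \<bullet> (Amat u x *v \<xi>) = \<xi> \<bullet> (metric_matrix u x *v \<xi>) + u x * (\<xi> \<bullet> (hess u x *v \<xi>))"
      by (simp add: Amat_mult inner_add_right)
    moreover have "u x * (b * (\<xi> \<bullet> (hess u x *v \<xi>))) \<le> u x * (\<xi> \<bullet> (Amat u x *v \<xi>))"
      using t(2) u by (intro mult_left_mono) auto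
    ultimately have "(b - u x) * (\<xi> \<bullet> (Amat u x *v \<xi>)) \<le> b * (\<xi> \<bullet> (metric_matrix u x *v \<xi>))"
      by (simp add: algebra_simps)
    hence "\<xi> \<bullet> (Amat u x *v \<xi>) \<le> b / (b - u x) * (\<xi> \<bullet> (metric_matrix u x *v \<xi>))"
      using b' by (simp add: field_simps)
    thus "\<xi> \<bullet> (Amat u x *v \<xi>) \<le> b / sqrt ((norm (x - c))\<^sup>2 + (u x - b)\<^sup>2) * slope u x * (\<xi> \<bullet> (metric_matrix u x *v \<xi>))"
      unfolding L using W by simp
  qed
qed

text \<open>At an interior minimum a horosphere touches from below. Its curvatures are 1, which
  exceeds \<sigma>, so the minimum is on the frontier.\<close>

lemma minimum_principle:
  assumes O: "open \<Omega>" "bounded \<Omega>" and s: "solution \<Omega> \<epsilon> u" and x: "x \<in> \<Omega>"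
  shows "\<epsilon> \<le> u x"
proof -
  have "compact (closure \<Omega>)" using O by (simp add: compact_closure)
  then obtain z where z: "z \<in> closure \<Omega>" "\<And>y. y \<in> closure \<Omega> \<Longrightarrow> u z \<le> u y"
    using continuous_attains_inf[of "closure \<Omega>" u] x solutionD(2)[OF s] closure_subset by blast
  have "\<epsilon> \<le> u z"
  proof (cases "z \<in> \<Omega>")
    case True
    obtain r where r: "r > 0" "ball z r \<subseteq> \<Omega>" using O True openE by blast
    have g: "grad u z = 0" "0 \<le> \<xi> \<bullet> (hess u z *v \<xi>)" for \<xi>
      using local_min_grad_hess[OF solutionD(1)[OF s] O(1) True r(1)] z(2) r(2) closure_subset by blast+
    have "1 \<le> \<sigma>"
    proof (rule curvature_lower_bound[OF O(1) True s])
      fix \<xi>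
      show "1 * slope u z * (\<xi> \<bullet> (metric_matrix u z *v \<xi>)) \<le> \<xi> \<bullet> (Amat u z *v \<xi>)"
        using solutionD(4)[OF s True] g by (simp add: Amat_mult inner_add_right slope_def)
    qed simp
    thus ?thesis using sigma by simp
  next
    case False
    hence "z \<in> frontier \<Omega>" using z(1) O(1) by (simp add: frontier_def interior_open)
    thus ?thesis using solutionD(3)[OF s] by simp
  qed
  also have "u z \<le> u x" using z(2) x closure_subset by blast
  finally show ?thesis .
qed

text \<open>\<open>Z y\<close> is the parameter of the sphere through the graph point over y that
  meets height 0 in the sphere of radius r about c: centre (c, -r Z), radius r sqrt (1 + Z^2),
  curvature Z / sqrt (1 + Z^2). At a maximum of \<open>Z\<close> this cap touches v from below, so a
  value above \<open>\<sigma>sinh\<close> would force a curvature above \<sigma>.\<close>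

lemma interior_cap:
  assumes O: "open \<Omega>" "solution \<Omega> \<epsilon> v" and r: "0 < r" "cball c r \<subseteq> \<Omega>" and x: "x \<in> cball c r"
  shows "r\<^sup>2 - (norm (x - c))\<^sup>2 - (v x)\<^sup>2 \<le> 2 * v x * r * \<sigma>sinh"
proof (rule ccontr)
  assume n: "\<not> ?thesis"
  define Z where "Z y = (r\<^sup>2 - (norm (y - c))\<^sup>2 - (v y)\<^sup>2) / (2 * v y * r)" for y
  have v: "v y > 0" if "y \<in> cball c r" for y using solutionD(4)[OF O(2)] that r by blast
  have "continuous_on (cball c r) v"
    using Ck_continuous_on[OF solutionD(1)[OF O(2)]] continuous_on_subset r(2) by blast
  hence "continuous_on (cball c r) Z"
    unfolding Z_def using v r by (intro continuous_intros) force+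
  then obtain z where z: "z \<in> cball c r" "\<And>y. y \<in> cball c r \<Longrightarrow> Z y \<le> Z z"
    using continuous_attains_sup[of "cball c r" Z] x compact_cball by blast
  have "Z x > \<sigma>sinh" using n v[OF x] r by (simp add: Z_def field_simps)
  hence zs: "Z z > \<sigma>sinh" using z(2)[OF x] by linarith
  hence zp: "Z z > 0" using \<sigma>sinh by linarith
  have eq: "r\<^sup>2 - (norm (z - c))\<^sup>2 - (v z)\<^sup>2 = 2 * (r * Z z) * v z"
    using v[OF z(1)] r by (simp add: Z_def)
  \<comment> \<open>A positive numerator keeps the maximum off the rim of the ball, so a full
    neighbourhood is available for contact.\<close>
  have "norm (z - c) < r"
  proof -
    have "r\<^sup>2 - (norm (z - c))\<^sup>2 - (v z)\<^sup>2 > 0" unfolding eq using v[OF z(1)] r zp by simp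
    moreover have "(v z)\<^sup>2 \<ge> 0" by simp
    ultimately have "(norm (z - c))\<^sup>2 < r\<^sup>2" by linarith
    thus ?thesis using r power2_less_imp_less by fastforce
  qed
  hence zb: "z \<in> ball c r" by (simp add: dist_norm norm_minus_commute)
  obtain q where q: "q > 0" "ball z q \<subseteq> ball c r" using zb open_ball openE by blast
  have zO: "z \<in> \<Omega>" using z r by blast
  have "r * Z z / sqrt ((norm (z - c))\<^sup>2 + (v z + r * Z z)\<^sup>2) \<le> \<sigma>"
  proof (rule sphere_touch_lower[OF O(1) zO O(2) q(1)])
    show "0 < r * Z z" using r zp by simp
    fix y assume "y \<in> ball z q"
    hence y: "y \<in> cball c r" using q by auto
    have "r\<^sup>2 - (norm (y - c))\<^sup>2 - (v y)\<^sup>2 \<le> 2 * (r * Z z) * v y"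
      using z(2)[OF y] v[OF y] r unfolding Z_def[of y] by (simp add: pos_divide_le_eq mult_ac)
    thus "(norm (z - c))\<^sup>2 + (v z)\<^sup>2 + 2 * (r * Z z) * v z \<le> (norm (y - c))\<^sup>2 + (v y)\<^sup>2 + 2 * (r * Z z) * v y"
      using eq by linarith
  qed
  also have "(norm (z - c))\<^sup>2 + (v z + r * Z z)\<^sup>2 = (norm (z - c))\<^sup>2 + (v z)\<^sup>2 + 2 * (r * Z z) * v z + r\<^sup>2 * (Z z)\<^sup>2"
    by (simp add: power2_sum power_mult_distrib)
  also have "\<dots> = r\<^sup>2 * (1 + (Z z)\<^sup>2)"
    unfolding eq[symmetric] by (simp add: distrib_left)
  finally have "Z z / sqrt (1 + (Z z)\<^sup>2) \<le> \<sigma>" using r by (simp add: real_sqrt_mult)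
  thus False using tanh_mono[OF less_imp_le[OF \<sigma>sinh(1)] zs] \<sigma>sinh(2) by linarith
qed

text \<open>Mirror image of the interior cap, with spheres centred at (c, r Y). Minimising
  \<open>Y\<close> over the region below the graph, instead of over the graph alone, forces contact
  with the lower half of the sphere. The gap \<open>d\<close> makes \<open>Y\<close> exceed
  \<open>\<sigma>sinh\<close> near height 0, so the minimum stays away from the boundary.\<close>

lemma exterior_cap_aux:
  assumes O: "open \<Omega>" "bounded \<Omega>" "solution \<Omega> 0 u" and r: "0 < r" and d: "0 < d"
    and dist: "\<And>x. x \<in> \<Omega> \<Longrightarrow> r\<^sup>2 + d \<le> (norm (x - c))\<^sup>2" and x: "x \<in> \<Omega>"
  shows "2 * u x * r * \<sigma>sinh \<le> (norm (x - c))\<^sup>2 - r\<^sup>2 + (u x)\<^sup>2"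
proof (rule ccontr)
  assume n: "\<not> ?thesis"
  define Y where "Y p = ((norm (fst p - c))\<^sup>2 - r\<^sup>2 + (snd p)\<^sup>2) / (2 * snd p * r)" for p :: "(real^'n) \<times> real"
  have ux: "u x > 0" by (rule solutionD(4)[OF O(3) x])
  have Yx: "Y (x, u x) < \<sigma>sinh" using n ux r by (simp add: Y_def field_simps)
  \<comment> \<open>Up to this height \<open>2 * r * \<sigma>sinh * s\<close> is at most the gap
    \<open>d\<close>, which gives \<open>low\<close>; cutting the region off at \<delta> makes
    \<open>Q\<close> compact with all its points over \<Omega>.\<close>
  define \<delta> where "\<delta> = d / (2 * r * \<sigma>sinh)"
  have \<delta>: "\<delta> > 0" using d r \<sigma>sinh(1) by (simp add: \<delta>_def)
  have low: "\<sigma>sinh < Y (y, s)" if "y \<in> \<Omega>" "0 < s" "s \<le> \<delta>" for y s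
  proof -
    have "2 * r * \<sigma>sinh * s \<le> 2 * r * \<sigma>sinh * \<delta>" using that r \<sigma>sinh(1) by (intro mult_left_mono) auto
    also have "\<dots> = d" using r \<sigma>sinh(1) by (simp add: \<delta>_def)
    also have "\<dots> < (norm (y - c))\<^sup>2 - r\<^sup>2 + s\<^sup>2" using dist[OF that(1)] that(2) zero_less_power[of s 2] by linarith
    finally show ?thesis using that r by (simp add: Y_def field_simps)
  qed
  define Q where "Q = {p. fst p \<in> closure \<Omega> \<and> \<delta> \<le> snd p \<and> snd p \<le> u (fst p)}"
  have cu: "continuous_on (closure \<Omega>) u" by (rule solutionD(2)[OF O(3)])
  have cO: "compact (closure \<Omega>)" using O by (simp add: compact_closure)
  have QO: "fst p \<in> \<Omega>" if "p \<in> Q" for p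
  proof (rule ccontr)
    assume "fst p \<notin> \<Omega>"
    hence "fst p \<in> frontier \<Omega>" using that O(1) by (simp add: Q_def frontier_def interior_open)
    hence "u (fst p) = 0" by (rule solutionD(3)[OF O(3)])
    thus False using that \<delta> by (simp add: Q_def)
  qed
  obtain m where m: "\<And>y. y \<in> closure \<Omega> \<Longrightarrow> u y \<le> u m"
    using continuous_attains_sup[OF cO _ cu] x closure_subset by blast
  have "compact Q"
  proof -
    let ?P = "closure \<Omega> \<times> {\<delta>..u m}"
    have P: "compact ?P" using cO by (intro compact_Times) auto
    have "continuous_on ?P (\<lambda>p. u (fst p))"
      by (rule continuous_on_compose2[OF cu]) (auto intro: continuous_intros)
    hence "closed {p \<in> ?P. snd p \<le> u (fst p)}"
      using compact_imp_closed[OF P] by (intro continuous_on_closed_Collect_le continuous_intros)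
    moreover have "Q = ?P \<inter> {p \<in> ?P. snd p \<le> u (fst p)}"
      using m by (force simp: Q_def)
    ultimately show ?thesis using compact_Int_closed[OF P] by simp
  qed
  moreover have "continuous_on Q Y"
    unfolding Y_def using \<delta> r by (intro continuous_intros) (auto simp: Q_def)
  moreover have xQ: "(x, u x) \<in> Q"
    using x closure_subset Yx low[OF x ux] by (force simp: Q_def)
  ultimately obtain p where p: "p \<in> Q" "\<And>q. q \<in> Q \<Longrightarrow> Y p \<le> Y q"
    using continuous_attains_inf[of Q Y] by blast
  obtain z s where zs: "p = (z, s)" by force
  have z: "z \<in> \<Omega>" using QO[OF p(1)] zs by simp
  have s: "\<delta> \<le> s" "s \<le> u z" using p(1) zs by (auto simp: Q_def)
  have uz: "u z > 0" by (rule solutionD(4)[OF O(3) z])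
  have Yp: "Y p < \<sigma>sinh" using p(2)[OF xQ] Yx by linarith
  have s\<delta>: "\<delta> < s" using low[OF z, of \<delta>] \<delta> s Yp zs by (cases "s = \<delta>") auto
  obtain q where q: "q > 0" "ball z q \<subseteq> \<Omega>" using O(1) z openE by blast
  have zc: "z \<noteq> c"
  proof
    assume "z = c"
    hence "r\<^sup>2 + d \<le> 0" using dist[OF z] by simp
    thus False using d zero_le_power2[of r] by linarith
  qed
  define b where "b = r * Y p"
  have eq: "(norm (z - c))\<^sup>2 - r\<^sup>2 + s\<^sup>2 = 2 * b * s"
    using s\<delta> \<delta> r by (simp add: b_def zs Y_def)
  have ineq: "2 * b * t \<le> (norm (y - c))\<^sup>2 - r\<^sup>2 + t\<^sup>2" if "y \<in> closure \<Omega>" "\<delta> \<le> t" "t \<le> u y" for y t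
  proof -
    have "Y p \<le> Y (y, t)" using that by (intro p(2)) (simp add: Q_def)
    thus ?thesis using that \<delta> r by (simp add: b_def Y_def field_simps)
  qed
  \<comment> \<open>Strictly below the graph there is room to move towards \<open>c\<close> at
    constant height, which lowers \<open>Y\<close>.\<close>
  have "s = u z"
  proof (rule ccontr)
    assume "s \<noteq> u z"
    hence "s < u z" using s by simp
    moreover have "isCont u z" using Ck_continuous_on[OF solutionD(1)[OF O(3)]] O(1) z
      by (metis continuous_on_eq_continuous_at)
    ultimately have "\<forall>\<^sub>F y in nhds z. s < u y"
      by (metis continuous_at isCont_def order_tendstoD(1) tendsto_at_iff_tendsto_nhds)
    then obtain q' where q': "q' > 0" "\<And>y. dist y z < q' \<Longrightarrow> s < u y" by (auto simp: eventually_nhds_metric)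
    define t where "t = min (1/2) (min q q' / (2 * norm (z - c)))"
    have nz: "norm (z - c) > 0" using zc by simp
    have t: "0 < t" "t \<le> 1/2" using q q' nz by (auto simp: t_def)
    have "t * norm (z - c) \<le> min q q' / (2 * norm (z - c)) * norm (z - c)"
      by (intro mult_right_mono) (auto simp: t_def)
    also have "\<dots> = min q q' / 2" using nz by simp
    finally have tn: "t * norm (z - c) < q" "t * norm (z - c) < q'" using q q' by auto
    define y where "y = z - t *\<^sub>R (z - c)"
    have "dist y z = t * norm (z - c)" using t by (simp add: y_def dist_norm)
    hence "y \<in> \<Omega>" "s < u y" using tn q q' by (auto simp: dist_commute)
    hence "2 * b * s \<le> (norm (y - c))\<^sup>2 - r\<^sup>2 + s\<^sup>2" using s closure_subset by (intro ineq) auto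
    hence "(norm (z - c))\<^sup>2 \<le> (norm (y - c))\<^sup>2" using eq by linarith
    hence "norm (z - c) \<le> norm (y - c)" by simp
    moreover have "y - c = (1 - t) *\<^sub>R (z - c)" by (simp add: y_def algebra_simps)
    hence "norm (y - c) = (1 - t) * norm (z - c)" using t by simp
    ultimately have "t * norm (z - c) \<le> 0" by (simp add: left_diff_distrib)
    thus False using mult_pos_pos[OF t(1) nz] by linarith
  qed
  \<comment> \<open>From above the height of the centre, lowering the point would decrease
    \<open>Y\<close>; \<open>t\<close> is kept at least \<delta> to remain in
    \<open>Q\<close>.\<close>
  have sb: "s \<le> b"
  proof (rule ccontr)
    assume "\<not> s \<le> b"
    define t where "t = max \<delta> ((s + b) / 2)"
    have t0: "\<delta> \<le> t" "(s + b) / 2 \<le> t" "t < s" using \<open>\<not> s \<le> b\<close> s\<delta> by (auto simp: t_def)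
    have "b < s" using \<open>\<not> s \<le> b\<close> by simp
    hence "2 * b < s + t" using t0(2) by (simp add: field_simps)
    note t = t0(1,3) this
    have "2 * b * t \<le> (norm (z - c))\<^sup>2 - r\<^sup>2 + t\<^sup>2" using t s z closure_subset by (intro ineq) auto
    hence "(s - t) * (s + t) \<le> (s - t) * (2 * b)" using eq by (simp add: algebra_simps power2_eq_square)
    thus False using t by (simp add: mult_le_cancel_left)
  qed
  have "isCont u z" using Ck_continuous_on[OF solutionD(1)[OF O(3)]] O(1) z
    by (metis continuous_on_eq_continuous_at)
  hence "\<forall>\<^sub>F y in nhds z. \<delta> < u y" using s\<delta> \<open>s = u z\<close>
    by (metis continuous_at isCont_def order_tendstoD(1) tendsto_at_iff_tendsto_nhds)
  then obtain q' where q': "q' > 0" "\<And>y. dist y z < q' \<Longrightarrow> \<delta> < u y" by (auto simp: eventually_nhds_metric)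
  have "\<sigma> \<le> b / sqrt ((norm (z - c))\<^sup>2 + (u z - b)\<^sup>2)"
  proof (rule sphere_touch_upper[OF O(1) z O(3), of "min q q'"])
    show "0 < min q q'" "u z \<le> b" "z \<noteq> c" using q q' sb zc \<open>s = u z\<close> by auto
    fix y assume y: "y \<in> ball z (min q q')"
    hence yq: "y \<in> ball z q" "dist y z < q'" by (auto simp: dist_commute)
    have "y \<in> closure \<Omega>" using yq(1) q(2) closure_subset by blast
    moreover have "\<delta> \<le> u y" using q'(2)[OF yq(2)] by simp
    ultimately have "2 * b * u y \<le> (norm (y - c))\<^sup>2 - r\<^sup>2 + (u y)\<^sup>2" by (intro ineq) auto
    thus "(norm (z - c))\<^sup>2 + (u z)\<^sup>2 - 2 * b * u z \<le> (norm (y - c))\<^sup>2 + (u y)\<^sup>2 - 2 * b * u y"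
      using eq[unfolded \<open>s = u z\<close>] by linarith
  qed
  also have "(norm (z - c))\<^sup>2 + (u z - b)\<^sup>2 = (norm (z - c))\<^sup>2 + s\<^sup>2 - 2 * b * s + r\<^sup>2 * (Y p)\<^sup>2"
    by (simp add: \<open>s = u z\<close> power2_diff b_def power_mult_distrib)
  also have "\<dots> = r\<^sup>2 * (1 + (Y p)\<^sup>2)"
    unfolding eq[symmetric] by (simp add: distrib_left)
  finally have "\<sigma> \<le> Y p / sqrt (1 + (Y p)\<^sup>2)" using r by (simp add: real_sqrt_mult b_def)
  moreover have "0 < Y p" using sb s\<delta> \<delta> r by (simp add: b_def) (metis less_le_trans less_trans zero_less_mult_pos)
  ultimately show False using tanh_mono[OF _ Yp] \<sigma>sinh(2) by linarith
qed

end

section \<open>Second-order contact with a parallel hypersurface\<close>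

text \<open>The Euclidean normal of the graph over y meets height 0 at this point, which is
  therefore the centre of the tangent hemisphere.\<close>

definition sphere_center :: "(real^'n::finite \<Rightarrow> real) \<Rightarrow> real^'n \<Rightarrow> real^'n" where
  "sphere_center u y = y + u y *\<^sub>R grad u y"

lemma Amat_mult_alt: "Amat u x *v \<eta> - \<eta> = (grad u x \<bullet> \<eta>) *\<^sub>R grad u x + u x *\<^sub>R (hess u x *v \<eta>)"
  by (simp add: Amat_mult metric_matrix_mult)

text \<open>\<open>u\<close> times its gradient is the gradient of u^2 / 2, whose Hessian is
  \<open>Amat\<close> minus the identity.\<close>

lemma u_grad_line_deriv:
  assumes C: "Ck 2 S u" and S: "open S" "y + s *\<^sub>R \<eta> \<in> S"
  shows "((\<lambda>s. u (y + s *\<^sub>R \<eta>) *\<^sub>R grad u (y + s *\<^sub>R \<eta>)) has_vector_derivative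
    (Amat u (y + s *\<^sub>R \<eta>) *v \<eta> - \<eta>)) (at s)"
proof -
  have "Ck (Suc 1) S u" using C by (simp add: numeral_2_eq_2)
  from has_vector_derivative_scaleR[OF Ck_line_deriv[OF this S] grad_line_deriv[OF C S]]
  show ?thesis by (simp add: Amat_mult_alt add.commute)
qed

lemma continuous_line_Amat:
  assumes C: "Ck 2 S u" and S: "open S" "y \<in> S"
  shows "continuous (at 0) (\<lambda>s. Amat u (y + s *\<^sub>R \<eta>) *v \<eta>)"
proof -
  have C1: "Ck (Suc 1) S u" using C by (simp add: numeral_2_eq_2)
  have S0: "y + 0 *\<^sub>R \<eta> \<in> S" using S by simp
  have "continuous (at 0) (\<lambda>s. u (y + s *\<^sub>R \<eta>))"
    using Ck_line_deriv[OF C1 S(1) S0] by (rule DERIV_isCont)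
  moreover have "continuous (at 0) (\<lambda>s. grad u (y + s *\<^sub>R \<eta>))"
    using grad_line_deriv[OF C S(1) S0] by (rule has_vector_derivative_continuous)
  moreover have "continuous (at 0) (\<lambda>s. hess u (y + s *\<^sub>R \<eta>) *v \<eta>)"
    by (rule continuous_line_hess[OF C S])
  ultimately have "continuous (at 0) (\<lambda>s. \<eta> + ((grad u (y + s *\<^sub>R \<eta>) \<bullet> \<eta>) *\<^sub>R grad u (y + s *\<^sub>R \<eta>)
      + u (y + s *\<^sub>R \<eta>) *\<^sub>R (hess u (y + s *\<^sub>R \<eta>) *v \<eta>)))"
    by (intro continuous_intros)
  thus ?thesis by (simp add: Amat_mult metric_matrix_mult add.assoc)
qed

text \<open>\<open>\<phi>(x, y) = R(y)\<^sup>2 - |x - c(y)|\<^sup>2 - v(x)\<^sup>2 - 2 T v(x) R(y)\<close> is nonpositive iff the point of the graph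
  of \<open>v\<close> over \<open>x\<close> has signed distance at most \<open>arsinh T\<close> to the hemisphere tangent to the graph of
  \<open>u\<close> over \<open>y\<close>; that hemisphere has centre \<open>c(y)\<close> and radius \<open>R(y)\<close>.\<close>

lemma contact_second_order:
  fixes u v :: "real^'n::finite \<Rightarrow> real"
  assumes Cu: "Ck 2 \<Omega> u" and Cv: "Ck 2 \<Omega> v" and O: "open \<Omega>" "x0 \<in> \<Omega>" "y0 \<in> \<Omega>"
    and pos: "\<And>y. y \<in> \<Omega> \<Longrightarrow> u y > 0"
    and \<phi>: "\<And>x y. \<phi> x y = (u y * slope u y)\<^sup>2 - (norm (x - sphere_center u y))\<^sup>2 - (v x)\<^sup>2 - 2 * T * v x * (u y * slope u y)"
    and max: "\<And>x y. x \<in> \<Omega> \<Longrightarrow> y \<in> \<Omega> \<Longrightarrow> \<phi> x y \<le> \<phi> x0 y0"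
    and R: "R = u y0 * slope u y0" and a: "a = u y0 *\<^sub>R grad u y0"
    and k: "k = T * v x0 / R" and crit: "x0 - y0 = k *\<^sub>R a"
  shows "sphere_center u y0 - x0 = (v x0 + T * R) *\<^sub>R grad v x0"
    and "2 * (\<xi> \<bullet> (Amat u y0 *v \<eta>)) - 2 * (T / R) * (a \<bullet> (Amat u y0 *v \<eta>)) * (grad v x0 \<bullet> \<xi>)
      - (1 - k) * (\<eta> \<bullet> (Amat u y0 *v \<eta>))
      - k * ((Amat u y0 *v \<eta>) \<bullet> (Amat u y0 *v \<eta>) - (a \<bullet> (Amat u y0 *v \<eta>))\<^sup>2 / R\<^sup>2)
      \<le> \<xi> \<bullet> (Amat v x0 *v \<xi>) + T * R * (\<xi> \<bullet> (hess v x0 *v \<xi>))"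
proof -
  obtain r where r: "r > 0" "ball x0 r \<subseteq> \<Omega>" "ball y0 r \<subseteq> \<Omega>"
  proof -
    obtain r1 r2 where "r1 > 0" "ball x0 r1 \<subseteq> \<Omega>" "r2 > 0" "ball y0 r2 \<subseteq> \<Omega>"
      using O openE by metis
    thus ?thesis using that[of "min r1 r2"] by (auto simp: subset_iff)
  qed
  have Cu1: "Ck (Suc 1) \<Omega> u" and Cv1: "Ck (Suc 1) \<Omega> v" using Cu Cv by (auto simp: numeral_2_eq_2)
  have Rpos: "R > 0" using pos[OF O(3)] slope_ge_1[of u y0] by (simp add: R)
  have main: "(sphere_center u y0 - x0) \<bullet> \<xi> - (v x0 + T * R) * (grad v x0 \<bullet> \<xi>) = 0 \<and>
    2 * (\<xi> \<bullet> (Amat u y0 *v \<eta>)) - 2 * (T / R) * (a \<bullet> (Amat u y0 *v \<eta>)) * (grad v x0 \<bullet> \<xi>)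
      - (1 - k) * (\<eta> \<bullet> (Amat u y0 *v \<eta>))
      - k * ((Amat u y0 *v \<eta>) \<bullet> (Amat u y0 *v \<eta>) - (a \<bullet> (Amat u y0 *v \<eta>))\<^sup>2 / R\<^sup>2)
      \<le> \<xi> \<bullet> (Amat v x0 *v \<xi>) + T * R * (\<xi> \<bullet> (hess v x0 *v \<xi>))" for \<xi> \<eta>
  proof -
    obtain d1 where d1: "d1 > 0" "\<And>s. \<bar>s\<bar> < d1 \<Longrightarrow> x0 + s *\<^sub>R \<xi> \<in> ball x0 r"
      using line_in_ball[OF r(1)] by metis
    obtain d2 where d2: "d2 > 0" "\<And>s. \<bar>s\<bar> < d2 \<Longrightarrow> y0 + s *\<^sub>R \<eta> \<in> ball y0 r"
      using line_in_ball[OF r(1)] by metis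
    define d where "d = min d1 d2"
    have d: "d > 0" and xin: "\<bar>s\<bar> < d \<Longrightarrow> x0 + s *\<^sub>R \<xi> \<in> \<Omega>" and yin: "\<bar>s\<bar> < d \<Longrightarrow> y0 + s *\<^sub>R \<eta> \<in> \<Omega>" for s
      using d1 d2 r by (auto simp: d_def)
    define X where "X s = x0 + s *\<^sub>R \<xi>" for s
    define Y where "Y s = y0 + s *\<^sub>R \<eta>" for s
    define al where "al s = u (Y s) *\<^sub>R grad u (Y s)" for s
    define A where "A s = Amat u (Y s) *v \<eta>" for s
    define q where "q s = (u (Y s))\<^sup>2 + al s \<bullet> al s" for s
    define V where "V s = v (X s)" for s
    define V' where "V' s = grad v (X s) \<bullet> \<xi>" for s
    \<comment> \<open>Moving y in direction \<eta> changes \<open>\<phi>\<close> at rate 2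
      \<open>A s \<bullet> E s\<close>, so \<open>E\<close> is the vector of the first-order
      condition in y; \<open>crit\<close> says that \<open>E 0 = 0\<close>.\<close>
    define E where "E s = (X s - Y s) - (T * V s / sqrt (q s)) *\<^sub>R al s" for s
    define g where "g s = q s - (X s - Y s - al s) \<bullet> (X s - Y s - al s) - (V s)\<^sup>2 - 2 * T * (V s * sqrt (q s))" for s
    define g' where "g' s = 2 * (A s \<bullet> E s) - 2 * ((X s - Y s - al s) \<bullet> \<xi>) - 2 * ((V s + T * sqrt (q s)) * V' s)" for s
    have slq: "(u y * slope u y)\<^sup>2 = (u y)\<^sup>2 + (u y *\<^sub>R grad u y) \<bullet> (u y *\<^sub>R grad u y)" for y
      unfolding power_mult_distrib slope_sq by (simp add: algebra_simps power2_eq_square)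
    have qpos: "q s > 0" if "\<bar>s\<bar> < d" for s
      using pos[OF yin[OF that]] by (simp add: q_def Y_def add_pos_nonneg)
    have sq: "sqrt (q s) = u (Y s) * slope u (Y s)" if "\<bar>s\<bar> < d" for s
    proof (rule real_sqrt_unique)
      show "(u (Y s) * slope u (Y s))\<^sup>2 = q s" unfolding slq q_def al_def ..
      show "0 \<le> u (Y s) * slope u (Y s)"
        using pos[OF yin[OF that]] slope_ge_1[of u "Y s"] by (simp add: Y_def)
    qed
    have g\<phi>: "g s = \<phi> (X s) (Y s)" if "\<bar>s\<bar> < d" for s
      unfolding g_def \<phi> sq[OF that] V_def power2_norm_eq_inner
      by (simp only: q_def slq al_def sphere_center_def) (simp add: algebra_simps)
    have X0: "X 0 = x0" "Y 0 = y0" by (simp_all add: X_def Y_def)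
    have q0: "sqrt (q 0) = R" using sq[of 0] d by (simp add: X0 R)
    have al0: "al 0 = a" by (simp add: al_def X0 a)
    have V0: "V 0 = v x0" by (simp add: V_def X0)
    have V'0: "V' 0 = grad v x0 \<bullet> \<xi>" by (simp add: V'_def X0)
    have A0: "A 0 = Amat u y0 *v \<eta>" by (simp add: A_def X0)
    have E0: "E 0 = 0" by (simp add: E_def X0 q0 al0 V0 crit k)
    have dX: "(X has_vector_derivative \<xi>) (at s)" and dY: "(Y has_vector_derivative \<eta>) (at s)" for s
      unfolding X_def Y_def by (rule line_has_vector_derivative)+
    have dal: "(al has_vector_derivative (A s - \<eta>)) (at s)" if "\<bar>s\<bar> < d" for s
      unfolding al_def A_def Y_def by (rule u_grad_line_deriv[OF Cu O(1) yin[OF that]])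
    have du: "((\<lambda>s. u (Y s)) has_real_derivative (grad u (Y s) \<bullet> \<eta>)) (at s)" if "\<bar>s\<bar> < d" for s
      unfolding Y_def by (rule Ck_line_deriv[OF Cu1 O(1) yin[OF that]])
    have dV: "(V has_real_derivative V' s) (at s)" if "\<bar>s\<bar> < d" for s
      unfolding V_def V'_def X_def by (rule Ck_line_deriv[OF Cv1 O(1) xin[OF that]])
    have dV': "(V' has_real_derivative \<xi> \<bullet> (hess v x0 *v \<xi>)) (at 0)"
      using grad_hess_line_deriv[OF Cv O(1) xin[of 0]] d unfolding V'_def X_def by simp
    have inner: "((\<lambda>s. f s \<bullet> h s) has_real_derivative (f' \<bullet> h s + f s \<bullet> h')) (at s)"
      if "(f has_vector_derivative f') (at s)" "(h has_vector_derivative h') (at s)"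
      for f h :: "real \<Rightarrow> real^'n" and f' h' s
    proof -
      have "((\<lambda>s. f s \<bullet> h s) has_derivative (\<lambda>t. f s \<bullet> (t *\<^sub>R h') + (t *\<^sub>R f') \<bullet> h s)) (at s)"
        using that unfolding has_vector_derivative_def by (rule has_derivative_inner)
      thus ?thesis by (rule has_derivative_imp_has_field_derivative) (simp add: algebra_simps)
    qed
    have dq: "(q has_real_derivative 2 * (al s \<bullet> A s)) (at s)" if "\<bar>s\<bar> < d" for s
    proof -
      have "(q has_real_derivative 2 * (u (Y s)) * (grad u (Y s) \<bullet> \<eta>)
          + ((A s - \<eta>) \<bullet> al s + al s \<bullet> (A s - \<eta>))) (at s)"
        unfolding q_def by (rule derivative_eq_intros du[OF that] inner[OF dal[OF that] dal[OF that]] refl)+ simp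
      moreover have "2 * (u (Y s)) * (grad u (Y s) \<bullet> \<eta>) = 2 * (al s \<bullet> \<eta>)" by (simp add: al_def)
      hence "2 * (u (Y s)) * (grad u (Y s) \<bullet> \<eta>) + ((A s - \<eta>) \<bullet> al s + al s \<bullet> (A s - \<eta>)) = 2 * (al s \<bullet> A s)"
        by (simp only: inner_diff_left inner_diff_right inner_commute[of "A s"] inner_commute[of \<eta>])
      ultimately show ?thesis by simp
    qed
    have dsq: "((\<lambda>s. sqrt (q s)) has_real_derivative (al s \<bullet> A s) / sqrt (q s)) (at s)" if "\<bar>s\<bar> < d" for s
      using DERIV_real_sqrt_generic[of "q s" 1] DERIV_chain2[OF DERIV_real_sqrt[OF qpos[OF that]] dq[OF that]]
      by (simp add: field_simps)
    have dxc: "((\<lambda>s. X s - Y s - al s) has_vector_derivative (\<xi> - A s)) (at s)" if "\<bar>s\<bar> < d" for s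
      using has_vector_derivative_diff[OF has_vector_derivative_diff[OF dX dY] dal[OF that]] by simp
    have dg: "(g has_real_derivative g' s) (at s)" if s: "\<bar>s\<bar> < d" for s
    proof -
      have "(g has_real_derivative 2 * (al s \<bullet> A s)
        - ((\<xi> - A s) \<bullet> (X s - Y s - al s) + (X s - Y s - al s) \<bullet> (\<xi> - A s))
        - 2 * V s * V' s - 2 * T * (V' s * sqrt (q s) + V s * ((al s \<bullet> A s) / sqrt (q s)))) (at s)"
        unfolding g_def
        by (rule derivative_eq_intros dq[OF s] inner[OF dxc[OF s] dxc[OF s]] dV[OF s] dsq[OF s] refl)+
           (simp add: algebra_simps)
      moreover have "2 * (al s \<bullet> A s)
        - ((\<xi> - A s) \<bullet> (X s - Y s - al s) + (X s - Y s - al s) \<bullet> (\<xi> - A s))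
        - 2 * V s * V' s - 2 * T * (V' s * sqrt (q s) + V s * ((al s \<bullet> A s) / sqrt (q s))) = g' s"
        unfolding g'_def E_def by (simp add: inner_diff_left inner_diff_right inner_commute algebra_simps)
      ultimately show ?thesis by simp
    qed
    define E' where "E' = (\<xi> - \<eta>) - (T * (grad v x0 \<bullet> \<xi>) / R - T * v x0 * (a \<bullet> A 0) / R ^ 3) *\<^sub>R a - k *\<^sub>R (A 0 - \<eta>)"
    have dE: "(E has_vector_derivative E') (at 0)"
    proof -
      have d0: "\<bar>0\<bar> < d" using d by simp
      have R': "sqrt (q 0) \<noteq> 0" using q0 Rpos by simp
      have "((\<lambda>s. T * V s / sqrt (q s)) has_real_derivative
          (T * (grad v x0 \<bullet> \<xi>) * R - T * v x0 * ((a \<bullet> A 0) / R)) / (R * R)) (at 0)"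
        by (rule derivative_eq_intros dV[OF d0] dsq[OF d0] R' refl)+
           (simp add: q0 al0 V0 V'0)
      moreover have "(T * (grad v x0 \<bullet> \<xi>) * R - T * v x0 * ((a \<bullet> A 0) / R)) / (R * R)
          = T * (grad v x0 \<bullet> \<xi>) / R - T * v x0 * (a \<bullet> A 0) / R ^ 3"
        using Rpos by (simp add: field_simps power3_eq_cube)
      ultimately have c: "((\<lambda>s. T * V s / sqrt (q s)) has_real_derivative
          T * (grad v x0 \<bullet> \<xi>) / R - T * v x0 * (a \<bullet> A 0) / R ^ 3) (at 0)" by simp
      have "(E has_vector_derivative ((\<xi> - \<eta>) - ((T * V 0 / sqrt (q 0)) *\<^sub>R (A 0 - \<eta>) +
         (T * (grad v x0 \<bullet> \<xi>) / R - T * v x0 * (a \<bullet> A 0) / R ^ 3) *\<^sub>R al 0))) (at 0)"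
        unfolding E_def
        by (intro has_vector_derivative_diff dX dY has_vector_derivative_scaleR c dal d0)
      thus ?thesis by (simp add: E'_def q0 al0 V0 k algebra_simps)
    qed
    define D where "D = 2 * (A 0 \<bullet> E') - 2 * ((\<xi> - A 0) \<bullet> \<xi>)
       - 2 * ((grad v x0 \<bullet> \<xi> + T * ((a \<bullet> A 0) / R)) * (grad v x0 \<bullet> \<xi>) + (v x0 + T * R) * (\<xi> \<bullet> (hess v x0 *v \<xi>)))"
    \<comment> \<open>\<open>A\<close> contains second derivatives of u, but its partner
      \<open>E\<close> vanishes at 0, so continuity of \<open>A\<close> is enough.\<close>
    have dg': "(g' has_real_derivative D) (at 0)"
    proof -
      have d0: "\<bar>0\<bar> < d" using d by simp
      have cA: "continuous (at 0) A" unfolding A_def Y_def by (rule continuous_line_Amat[OF Cu O(1,3)])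
      have xi: "((\<lambda>s. (X s - Y s - al s) \<bullet> \<xi>) has_real_derivative (\<xi> - A 0) \<bullet> \<xi>) (at 0)"
        using inner[OF dxc[OF d0] has_vector_derivative_const[of \<xi>]] by simp
      show ?thesis unfolding g'_def D_def
        by (rule derivative_eq_intros has_derivative_inner_zero[OF cA dE E0] xi dV[OF d0] dV' dsq[OF d0] refl)+
           (simp add: q0 al0 V0 V'0 algebra_simps)
    qed
    have "g s \<le> g 0" if s: "\<bar>s\<bar> < d" for s
      using max[OF xin[OF s] yin[OF s]] g\<phi>[OF s] g\<phi>[of 0] d by (simp add: X0) (simp add: X_def Y_def)
    hence "- g' 0 = 0" "0 \<le> - D"
      using local_min_second_order[of d "\<lambda>s. - g s" "\<lambda>s. - g' s" "- D"] d
      by (auto intro!: DERIV_minus dg dg')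
    hence g0: "g' 0 = 0" and D: "D \<le> 0" by auto
    have 1: "(sphere_center u y0 - x0) \<bullet> \<xi> - (v x0 + T * R) * (grad v x0 \<bullet> \<xi>) = 0"
      using g0 by (simp add: g'_def E0 X0 al0 q0 V0 V'0 sphere_center_def a inner_diff_left inner_add_left)
    define gx m n where "gx = grad v x0 \<bullet> \<xi>" and "m = T / R" and "n = 1 / R\<^sup>2"
    have kv: "T * v x0 * (a \<bullet> A 0) / R ^ 3 = k * n * (a \<bullet> A 0)"
      by (simp add: k n_def power3_eq_cube power2_eq_square)
    have mg: "T * gx / R = m * gx" by (simp add: m_def)
    have e1: "A 0 \<bullet> E' = \<xi> \<bullet> A 0 - \<eta> \<bullet> A 0 - (m * gx - k * n * (a \<bullet> A 0)) * (a \<bullet> A 0) - k * (A 0 \<bullet> A 0 - \<eta> \<bullet> A 0)"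
      unfolding E'_def gx_def[symmetric] kv mg
      by (simp only: inner_diff_right inner_scaleR_right inner_commute[of "A 0" \<xi>] inner_commute[of "A 0" \<eta>] inner_commute[of "A 0" a])
    have e2: "\<xi> \<bullet> (Amat v x0 *v \<xi>) = \<xi> \<bullet> \<xi> + gx * gx + v x0 * (\<xi> \<bullet> (hess v x0 *v \<xi>))"
      by (simp add: Amat_mult metric_matrix_form inner_add_right gx_def)
    have e3: "(\<xi> - A 0) \<bullet> \<xi> = \<xi> \<bullet> \<xi> - \<xi> \<bullet> A 0" by (simp only: inner_diff_left inner_commute[of "A 0" \<xi>])
    have e4: "T * ((a \<bullet> A 0) / R) = m * (a \<bullet> A 0)" "(a \<bullet> A 0)\<^sup>2 / R\<^sup>2 = n * (a \<bullet> A 0)\<^sup>2" "T / R = m"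
      by (simp_all add: m_def n_def)
    have Deq: "D / 2 = 2 * (\<xi> \<bullet> A 0) - 2 * (T / R) * (a \<bullet> A 0) * gx
      - (1 - k) * (\<eta> \<bullet> A 0) - k * (A 0 \<bullet> A 0 - (a \<bullet> A 0)\<^sup>2 / R\<^sup>2)
      - (\<xi> \<bullet> (Amat v x0 *v \<xi>) + T * R * (\<xi> \<bullet> (hess v x0 *v \<xi>)))"
      unfolding D_def e1 e2 e3 gx_def[symmetric] e4
      by (simp add: power2_eq_square algebra_simps add_divide_distrib diff_divide_distrib)
    have "D / 2 \<le> 0" using D by simp
    thus ?thesis using 1 unfolding Deq unfolding A0 gx_def by linarith
  qed
  show "2 * (\<xi> \<bullet> (Amat u y0 *v \<eta>)) - 2 * (T / R) * (a \<bullet> (Amat u y0 *v \<eta>)) * (grad v x0 \<bullet> \<xi>)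
      - (1 - k) * (\<eta> \<bullet> (Amat u y0 *v \<eta>))
      - k * ((Amat u y0 *v \<eta>) \<bullet> (Amat u y0 *v \<eta>) - (a \<bullet> (Amat u y0 *v \<eta>))\<^sup>2 / R\<^sup>2)
      \<le> \<xi> \<bullet> (Amat v x0 *v \<xi>) + T * R * (\<xi> \<bullet> (hess v x0 *v \<xi>))"
    using main by blast
  have "((sphere_center u y0 - x0) - (v x0 + T * R) *\<^sub>R grad v x0) \<bullet> \<xi> = 0" for \<xi>
    using main[of \<xi>] by (simp add: inner_diff_left)
  hence "(sphere_center u y0 - x0) - (v x0 + T * R) *\<^sub>R grad v x0 = 0" by (metis inner_eq_zero_iff)
  thus "sphere_center u y0 - x0 = (v x0 + T * R) *\<^sub>R grad v x0" by simp
qed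

context curvature_function
begin

text \<open>The second-order inequality holds for every pair (\<xi>, \<eta>). For given \<xi> the
  \<eta> that maximises its left-hand side is inserted; what remains is the second fundamental form
  of the parallel hypersurface, in a frame obtained by transporting the eigenframe of u.\<close>

lemma no_contact:
  fixes u v :: "real^'n \<Rightarrow> real"
  assumes O: "open \<Omega>" "x0 \<in> \<Omega>" "y0 \<in> \<Omega>" and su: "solution \<Omega> \<epsilon> u" and sv: "solution \<Omega> \<epsilon> v"
    and T: "0 < T" "C = sqrt (1 + T\<^sup>2)"
    and xy: "x0 - y0 = (u y0 - C * v x0) *\<^sub>R grad u y0"
    and uT: "T * v x0 = (u y0 - C * v x0) * slope u y0"
    and max: "\<And>x y. x \<in> \<Omega> \<Longrightarrow> y \<in> \<Omega> \<Longrightarrow>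
      (u y * slope u y)\<^sup>2 - (norm (x - sphere_center u y))\<^sup>2 - (v x)\<^sup>2 - 2 * T * v x * (u y * slope u y) \<le> 0"
  shows False
proof -
  define p w r where "p = grad u y0" and "w = slope u y0" and "r = v x0"
  \<comment> \<open>\<open>k\<close> is the displacement from \<open>y0\<close> to \<open>x0\<close>
    as a fraction of \<open>a\<close>, the one from \<open>y0\<close> to the hemisphere centre;
    \<open>R\<close> is the radius of that hemisphere.\<close>
  define k R where "k = T / (C * w + T)" and "R = u y0 * w"
  define a where "a = u y0 *\<^sub>R p"
  have C2: "C\<^sup>2 = 1 + T\<^sup>2" and C: "C > 0" using T by (auto simp: add_pos_nonneg)
  have w: "w \<ge> 1" "w > 0" using slope_ge_1[of u y0] by (auto simp: w_def)
  have pp: "p \<bullet> p = w\<^sup>2 - 1" by (simp add: w_def p_def slope_sq)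
  have r: "r > 0" unfolding r_def by (rule solutionD(4)[OF sv O(2)])
  have S: "C * w + T > 0" "C + T * w > 0" using C T(1) w by (auto intro!: add_pos_pos)
  have u: "u y0 = r * (C + T / w)" using uT w by (simp add: r_def[symmetric] w_def[symmetric] field_simps)
  have R': "R = r * (C * w + T)" using w by (simp add: R_def u field_simps)
  have R: "R > 0" using r S by (simp add: R')
  have k: "k = T * r / R" using r S by (simp add: k_def R')
  have k01: "k > 0" "1 - k = C * w / (C * w + T)" "1 - k > 0"
    using S T w C by (auto simp: k_def field_simps)
  have ka: "k *\<^sub>R a = (u y0 - C * r) *\<^sub>R p"
  proof -
    have "u y0 = r * (C * w + T) / w" using w by (simp add: u field_simps)
    hence "k * u y0 = T * r / w" using S by (simp add: k_def)
    also have "\<dots> = u y0 - C * r" by (simp add: u algebra_simps)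
    finally show ?thesis by (simp add: a_def)
  qed
  have crit: "x0 - y0 = k *\<^sub>R a" using xy by (simp add: ka p_def r_def)
  have cx: "sphere_center u y0 - x0 = (C * r) *\<^sub>R p"
  proof -
    have "sphere_center u y0 - x0 = a - (x0 - y0)" by (simp add: sphere_center_def a_def p_def)
    thus ?thesis unfolding crit ka by (simp add: a_def scaleR_diff_left)
  qed
  define \<phi> where "\<phi> x y = (u y * slope u y)\<^sup>2 - (norm (x - sphere_center u y))\<^sup>2 - (v x)\<^sup>2 - 2 * T * v x * (u y * slope u y)" for x y
  \<comment> \<open>The contact point lies on the equidistant of the tangent hemisphere, so the
    bound \<open>max\<close> is attained at (x0, y0).\<close>
  have \<phi>0: "\<phi> x0 y0 = 0"
  proof -
    have "(norm (x0 - sphere_center u y0))\<^sup>2 = C\<^sup>2 * r\<^sup>2 * (w\<^sup>2 - 1)"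
      unfolding norm_minus_commute[of x0] cx power2_norm_eq_inner by (simp add: pp power2_eq_square)
    hence "\<phi> x0 y0 = R\<^sup>2 - C\<^sup>2 * r\<^sup>2 * (w\<^sup>2 - 1) - r\<^sup>2 - 2 * T * r * R"
      by (simp add: \<phi>_def R_def w_def r_def)
    also have "\<dots> = r\<^sup>2 * (C\<^sup>2 - T\<^sup>2 - 1)"
      by (simp add: R' power2_eq_square algebra_simps)
    finally show ?thesis by (simp add: C2)
  qed
  note so = contact_second_order[OF solutionD(1)[OF su] solutionD(1)[OF sv] O, of \<phi> T R a k]
  have upos: "u y > 0" if "y \<in> \<Omega>" for y by (rule solutionD(4)[OF su that])
  have max': "\<phi> x y \<le> \<phi> x0 y0" if "x \<in> \<Omega>" "y \<in> \<Omega>" for x y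
    using max[OF that] \<phi>0 by (simp add: \<phi>_def)
  have so1: "sphere_center u y0 - x0 = (v x0 + T * R) *\<^sub>R grad v x0"
    by (rule so(1)) (use upos max' k crit in \<open>auto simp: \<phi>_def R_def w_def a_def p_def r_def\<close>)
  have so2: "2 * (\<xi> \<bullet> (Amat u y0 *v \<eta>)) - 2 * (T / R) * (a \<bullet> (Amat u y0 *v \<eta>)) * (grad v x0 \<bullet> \<xi>)
      - (1 - k) * (\<eta> \<bullet> (Amat u y0 *v \<eta>))
      - k * ((Amat u y0 *v \<eta>) \<bullet> (Amat u y0 *v \<eta>) - (a \<bullet> (Amat u y0 *v \<eta>))\<^sup>2 / R\<^sup>2)
      \<le> \<xi> \<bullet> (Amat v x0 *v \<xi>) + T * R * (\<xi> \<bullet> (hess v x0 *v \<xi>))" for \<xi> \<eta>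
    by (rule so(2)) (use upos max' k crit in \<open>auto simp: \<phi>_def R_def w_def a_def p_def r_def\<close>)
  have rTR: "r + T * R = r * (C * (C + T * w))"
    using C2 by (simp add: R' algebra_simps power2_eq_square)
  define l where "l = 1 / (C + T * w)"
  \<comment> \<open>First-order contact: v has the gradient of the parallel hypersurface, and hence
    the slope \<open>sv'\<close>.\<close>
  have q: "grad v x0 = l *\<^sub>R p"
  proof -
    have "(r * (C * (C + T * w))) *\<^sub>R grad v x0 = (C * r) *\<^sub>R p"
      using so1 cx rTR by (simp add: r_def)
    hence "(1 / (r * (C * (C + T * w)))) *\<^sub>R ((r * (C * (C + T * w))) *\<^sub>R grad v x0)
      = (1 / (r * (C * (C + T * w)))) *\<^sub>R ((C * r) *\<^sub>R p)" by simp
    thus ?thesis using r C S by (simp add: l_def)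
  qed
  have sv': "slope v x0 = (C * w + T) / (C + T * w)"
  proof -
    have "1 + grad v x0 \<bullet> grad v x0 = ((C * w + T) / (C + T * w))\<^sup>2"
    proof -
      have "(C + T * w)\<^sup>2 + (w\<^sup>2 - 1) = (C * w + T)\<^sup>2"
        using C2 by (simp add: power2_sum power_mult_distrib algebra_simps)
      moreover have "grad v x0 \<bullet> grad v x0 = (w\<^sup>2 - 1) / (C + T * w)\<^sup>2"
        by (simp add: q pp l_def power2_eq_square)
      moreover have "1 + (w\<^sup>2 - 1) / (C + T * w)\<^sup>2 = ((C + T * w)\<^sup>2 + (w\<^sup>2 - 1)) / (C + T * w)\<^sup>2"
        using S by (simp add: add_divide_distrib)
      ultimately show ?thesis by (simp add: power_divide)
    qed
    thus ?thesis using S unfolding slope_def by (simp add: less_imp_le)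
  qed
  obtain \<kappa> b where K: "\<kappa> \<in> Kpos" "f \<kappa> = \<sigma>" and b: "orthonormal_wrt (metric_matrix u y0) b"
    "\<And>i. Amat u y0 *v b i = (slope u y0 * \<kappa> $ i) *\<^sub>R (metric_matrix u y0 *v b i)"
    using curvature_basis[OF O(1,3) su] by blast
  have Kp: "\<kappa> $ i > 0" for i using K by (simp add: Kpos_def)
  \<comment> \<open>The eigenframe of u carried to v: only the component along \<open>p\<close>
    changes, by the factor that makes the frame orthonormal in the metric of v.\<close>
  define e where "e i = b i + (k * (p \<bullet> b i)) *\<^sub>R p" for i
  have kP: "1 + k * (w\<^sup>2 - 1) = w * (C + T * w) / (C * w + T)"
    using S by (simp add: k_def field_simps power2_eq_square)
  have pe: "p \<bullet> e i = (p \<bullet> b i) * (w * (C + T * w) / (C * w + T))" for i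
    unfolding kP[symmetric] by (simp add: e_def inner_add_right pp algebra_simps)
  have eo: "orthonormal_wrt (metric_matrix v x0) e"
    unfolding orthonormal_wrt_def
  proof (intro allI)
    fix i j
    have kk: "2 * k + k * k * (w\<^sup>2 - 1) + (w / (C * w + T))\<^sup>2 = 1"
    proof -
      have "2 * T * (C * w + T) + T\<^sup>2 * (w\<^sup>2 - 1) + w\<^sup>2 = (C * w + T)\<^sup>2"
        using C2 by (simp add: power2_sum power_mult_distrib algebra_simps) (simp add: power2_eq_square)
      moreover have "2 * k + k * k * (w\<^sup>2 - 1) + (w / (C * w + T))\<^sup>2
        = (2 * T * (C * w + T) + T\<^sup>2 * (w\<^sup>2 - 1) + w\<^sup>2) / (C * w + T)\<^sup>2"
        using S by (simp add: k_def power2_eq_square divide_simps)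
      ultimately show ?thesis using S by simp
    qed
    have "e i \<bullet> e j = b i \<bullet> b j + (2 * k + k * k * (w\<^sup>2 - 1)) * ((p \<bullet> b i) * (p \<bullet> b j))"
      by (simp add: e_def inner_add_left inner_add_right pp inner_commute[of "b i" p] algebra_simps)
    moreover have "(grad v x0 \<bullet> e i) * (grad v x0 \<bullet> e j) = (w / (C * w + T))\<^sup>2 * ((p \<bullet> b i) * (p \<bullet> b j))"
      using S by (simp add: q pe l_def power2_eq_square)
    ultimately have "e i \<bullet> (metric_matrix v x0 *v e j) = b i \<bullet> b j
        + (2 * k + k * k * (w\<^sup>2 - 1) + (w / (C * w + T))\<^sup>2) * ((p \<bullet> b i) * (p \<bullet> b j))"
      unfolding metric_matrix_form by (simp add: algebra_simps)
    also have "\<dots> = b i \<bullet> (metric_matrix u y0 *v b j)" unfolding kk metric_matrix_form by (simp add: p_def)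
    finally show "e i \<bullet> (metric_matrix v x0 *v e j) = (if i = j then 1 else 0)"
      using b(1) by (simp add: orthonormal_wrt_def)
  qed
  show False
  proof (rule no_touching_parallel[OF O(1,2) sv K T eo])
    fix c :: "'n \<Rightarrow> real"
    define \<xi> where "\<xi> = (\<Sum>i\<in>UNIV. c i *\<^sub>R e i)"
    \<comment> \<open>Maximises 2 w \<kappa> h c - (1 - k) w \<kappa> h^2 - k (w \<kappa> h)^2, the
      contribution of index i to the left-hand side.\<close>
    define h where "h i = c i / ((1 - k) + k * w * \<kappa> $ i)" for i
    define \<eta> where "\<eta> = (\<Sum>i\<in>UNIV. h i *\<^sub>R b i)"
    define y where "y = (\<Sum>i\<in>UNIV. (w * \<kappa> $ i * h i) *\<^sub>R b i)"
    define s where "s = (\<Sum>i\<in>UNIV. c i *\<^sub>R b i)"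
    define z where "z = Amat u y0 *v \<eta>"
    have den: "(1 - k) + k * w * \<kappa> $ i > 0" for i
      using k01 w Kp[of i] by (intro add_pos_pos mult_pos_pos) auto
    have z: "z = metric_matrix u y0 *v y"
      by (simp add: z_def \<eta>_def y_def matrix_vector_mult_sum_right matrix_vector_mult_scaleR b(2) w_def mult_ac)
    have Gsum: "(\<Sum>i\<in>UNIV. m i *\<^sub>R b i) \<bullet> (metric_matrix u y0 *v (\<Sum>i\<in>UNIV. n i *\<^sub>R b i)) = (\<Sum>i\<in>UNIV. m i * n i)" for m n
    proof -
      have "(\<Sum>i\<in>UNIV. m i *\<^sub>R b i) \<bullet> (metric_matrix u y0 *v (\<Sum>i\<in>UNIV. n i *\<^sub>R b i))
          = (\<Sum>i\<in>UNIV. \<Sum>j\<in>UNIV. m j * (n i * (if j = i then 1 else 0)))"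
        using b(1) by (simp add: matrix_vector_mult_sum_right inner_sum_left inner_sum_right
            matrix_vector_mult_scaleR orthonormal_wrt_def sum_distrib_left mult_ac)
      also have "\<dots> = (\<Sum>i\<in>UNIV. m i * n i)" by (simp add: if_distrib cong: if_cong)
      finally show ?thesis .
    qed
    have xis: "\<xi> = s + (k * (p \<bullet> s)) *\<^sub>R p"
      by (simp add: \<xi>_def s_def e_def scaleR_add_right sum.distrib inner_sum_right sum_distrib_left
          scaleR_sum_left mult_ac)
    have pxi: "p \<bullet> \<xi> = (p \<bullet> s) * (w * (C + T * w) / (C * w + T))"
      unfolding kP[symmetric] by (simp add: xis inner_add_right pp algebra_simps)
    \<comment> \<open>The component of \<xi> - s along \<open>p\<close> cancels the gradient term
      exactly, leaving the pairing of \<open>s\<close> with \<open>z\<close>.\<close>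
    have t1: "\<xi> \<bullet> z - (T / R) * (a \<bullet> z) * (grad v x0 \<bullet> \<xi>) = (\<Sum>i\<in>UNIV. w * \<kappa> $ i * h i * c i)"
    proof -
      have TR: "(T / R) * (a \<bullet> z) = (T / w) * (p \<bullet> z)"
        using upos[OF O(3)] w by (simp add: a_def R_def)
      have "(T / R) * (a \<bullet> z) * (grad v x0 \<bullet> \<xi>) = (k * (p \<bullet> s)) * (p \<bullet> z)"
        unfolding TR q inner_scaleR_left pxi using S w by (simp add: l_def k_def)
      hence "\<xi> \<bullet> z - (T / R) * (a \<bullet> z) * (grad v x0 \<bullet> \<xi>) = s \<bullet> z"
        by (simp add: xis inner_add_left)
      also have "\<dots> = (\<Sum>i\<in>UNIV. c i * (w * \<kappa> $ i * h i))"
        unfolding z s_def y_def by (rule Gsum)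
      finally show ?thesis by (simp add: mult_ac)
    qed
    have t2: "\<eta> \<bullet> z = (\<Sum>i\<in>UNIV. w * \<kappa> $ i * (h i)\<^sup>2)"
    proof -
      have "\<eta> \<bullet> z = (\<Sum>i\<in>UNIV. h i * (w * \<kappa> $ i * h i))" unfolding z \<eta>_def y_def by (rule Gsum)
      thus ?thesis by (simp add: power2_eq_square mult_ac)
    qed
    have t3: "z \<bullet> z - (a \<bullet> z)\<^sup>2 / R\<^sup>2 = (\<Sum>i\<in>UNIV. (w * \<kappa> $ i * h i)\<^sup>2)"
    proof -
      have z': "z = y + (p \<bullet> y) *\<^sub>R p" by (simp add: z metric_matrix_mult p_def)
      have pz: "p \<bullet> z = (p \<bullet> y) * w\<^sup>2" by (simp add: z' inner_add_right pp algebra_simps)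
      have "(a \<bullet> z)\<^sup>2 / R\<^sup>2 = (p \<bullet> y)\<^sup>2 * w\<^sup>2"
        using upos[OF O(3)] w by (simp add: a_def R_def pz power2_eq_square)
      moreover have "z \<bullet> z = y \<bullet> y + 2 * (p \<bullet> y)\<^sup>2 + (p \<bullet> y)\<^sup>2 * (w\<^sup>2 - 1)"
        by (simp add: z' inner_add_left inner_add_right pp inner_commute[of y p] power2_eq_square algebra_simps)
      ultimately have "z \<bullet> z - (a \<bullet> z)\<^sup>2 / R\<^sup>2 = y \<bullet> y + (p \<bullet> y)\<^sup>2" by (simp add: algebra_simps)
      also have "\<dots> = y \<bullet> (metric_matrix u y0 *v y)" by (simp add: metric_matrix_form p_def power2_eq_square)
      also have "\<dots> = (\<Sum>i\<in>UNIV. (w * \<kappa> $ i * h i) * (w * \<kappa> $ i * h i))" unfolding y_def by (rule Gsum)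
      finally show ?thesis by (simp add: power2_eq_square)
    qed
    have lhs: "2 * (\<xi> \<bullet> z) - 2 * (T / R) * (a \<bullet> z) * (grad v x0 \<bullet> \<xi>) - (1 - k) * (\<eta> \<bullet> z)
      - k * (z \<bullet> z - (a \<bullet> z)\<^sup>2 / R\<^sup>2) = (\<Sum>i\<in>UNIV. (\<kappa> $ i * (C * w + T) / (C + T * \<kappa> $ i)) * (c i)\<^sup>2)"
    proof -
      have "2 * (\<xi> \<bullet> z) - 2 * (T / R) * (a \<bullet> z) * (grad v x0 \<bullet> \<xi>) - (1 - k) * (\<eta> \<bullet> z)
          - k * (z \<bullet> z - (a \<bullet> z)\<^sup>2 / R\<^sup>2)
        = 2 * (\<xi> \<bullet> z - (T / R) * (a \<bullet> z) * (grad v x0 \<bullet> \<xi>)) - (1 - k) * (\<eta> \<bullet> z)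
          - k * (z \<bullet> z - (a \<bullet> z)\<^sup>2 / R\<^sup>2)" by (simp add: algebra_simps)
      also have "\<dots> = (\<Sum>i\<in>UNIV. 2 * (w * \<kappa> $ i * h i * c i) - (1 - k) * (w * \<kappa> $ i * (h i)\<^sup>2)
          - k * (w * \<kappa> $ i * h i)\<^sup>2)"
        unfolding t1 t2 t3 by (simp add: sum_subtractf sum_distrib_left)
      also have "\<dots> = (\<Sum>i\<in>UNIV. (\<kappa> $ i * (C * w + T) / (C + T * \<kappa> $ i)) * (c i)\<^sup>2)"
      proof (rule sum.cong[OF refl])
        fix i
        have c: "c i = h i * ((1 - k) + k * w * \<kappa> $ i)" using den[of i] by (simp add: h_def)
        have d: "(1 - k) + k * w * \<kappa> $ i = w * (C + T * \<kappa> $ i) / (C * w + T)"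
          unfolding k01(2) by (simp add: k_def add_divide_distrib distrib_left mult_ac)
        have pos: "C + T * \<kappa> $ i > 0" using C T(1) Kp[of i] by (intro add_pos_pos mult_pos_pos)
        have "2 * (w * \<kappa> $ i * h i * c i) - (1 - k) * (w * \<kappa> $ i * (h i)\<^sup>2) - k * (w * \<kappa> $ i * h i)\<^sup>2
          = w * \<kappa> $ i * (h i)\<^sup>2 * ((1 - k) + k * w * \<kappa> $ i)"
          unfolding c by (simp add: power2_eq_square algebra_simps)
        also have "\<dots> = (\<kappa> $ i * (C * w + T) / (C + T * \<kappa> $ i)) * (c i)\<^sup>2"
        proof -
          have "(C * w + T) / (C + T * \<kappa> $ i) * ((1 - k) + k * w * \<kappa> $ i) = w"
            unfolding d using S pos by simp
          moreover have "(\<kappa> $ i * (C * w + T) / (C + T * \<kappa> $ i)) * (c i)\<^sup>2 = \<kappa> $ i * (h i)\<^sup>2 *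
            ((1 - k) + k * w * \<kappa> $ i) * ((C * w + T) / (C + T * \<kappa> $ i) * ((1 - k) + k * w * \<kappa> $ i))"
            unfolding c by (simp add: power2_eq_square)
          ultimately show ?thesis by simp
        qed
        finally show "2 * (w * \<kappa> $ i * h i * c i) - (1 - k) * (w * \<kappa> $ i * (h i)\<^sup>2) - k * (w * \<kappa> $ i * h i)\<^sup>2
          = (\<kappa> $ i * (C * w + T) / (C + T * \<kappa> $ i)) * (c i)\<^sup>2" .
      qed
      finally show ?thesis .
    qed
    define Q where "Q = \<xi> \<bullet> (Amat v x0 *v \<xi>)"
    define H where "H = \<xi> \<bullet> (hess v x0 *v \<xi>)"
    \<comment> \<open>Eliminates the Hessian of v: the right-hand side of the second-order
      inequality becomes a combination of \<open>Q\<close> and the metric square of \<xi>.\<close>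
    have Qg: "Q = (\<Sum>i\<in>UNIV. (c i)\<^sup>2) + r * H"
      using orthonormal_wrt_sum[OF eo, of UNIV c]
      by (simp add: Q_def H_def r_def Amat_mult inner_add_right \<xi>_def)
    have "(\<Sum>i\<in>UNIV. (\<kappa> $ i * (C * w + T) / (C + T * \<kappa> $ i)) * (c i)\<^sup>2) \<le> Q + T * R * H"
      unfolding lhs[symmetric] using so2[of \<xi> \<eta>] by (simp only: z_def Q_def H_def)
    hence "r * (\<Sum>i\<in>UNIV. (\<kappa> $ i * (C * w + T) / (C + T * \<kappa> $ i)) * (c i)\<^sup>2) \<le> r * (Q + T * R * H)"
      using r by simp
    also have "\<dots> = r * Q + T * R * (Q - (\<Sum>i\<in>UNIV. (c i)\<^sup>2))" by (simp add: Qg algebra_simps)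
    finally have "T * R * (\<Sum>i\<in>UNIV. (c i)\<^sup>2) + r * (\<Sum>i\<in>UNIV. (\<kappa> $ i * (C * w + T) / (C + T * \<kappa> $ i)) * (c i)\<^sup>2)
      \<le> (r + T * R) * Q" by (simp add: algebra_simps)
    moreover have "(\<Sum>i\<in>UNIV. (t + r * \<beta> i) * (c i)\<^sup>2) = t * (\<Sum>i\<in>UNIV. (c i)\<^sup>2) + r * (\<Sum>i\<in>UNIV. \<beta> i * (c i)\<^sup>2)" for t \<beta>
      by (simp add: distrib_right sum.distrib sum_distrib_left mult.assoc)
    ultimately have le: "(\<Sum>i\<in>UNIV. (T * R + r * (\<kappa> $ i * (C * w + T) / (C + T * \<kappa> $ i))) * (c i)\<^sup>2) \<le> (r * (C * (C + T * w))) * Q"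
      by (simp only: rTR)
    \<comment> \<open>Rests on T (C + T \<kappa>) + \<kappa> = C (T + C \<kappa>), a form of C^2 = 1
      + T^2; here the parallel curvature emerges.\<close>
    have fac: "T * R + r * (\<kappa> $ i * (C * w + T) / (C + T * \<kappa> $ i))
      = (r * (C * (C + T * w))) * (slope v x0 * ((T + C * \<kappa> $ i) / (C + T * \<kappa> $ i)))" for i
    proof -
      have pos: "C + T * \<kappa> $ i > 0" using C T(1) Kp[of i] by (intro add_pos_pos mult_pos_pos)
      have "T * (C + T * \<kappa> $ i) + \<kappa> $ i = C * (T + C * \<kappa> $ i)"
        using C2 by (simp add: power2_eq_square algebra_simps)
          (metis (no_types, lifting) distrib_left mult.left_commute mult.right_neutral add.commute)
      hence "T + \<kappa> $ i / (C + T * \<kappa> $ i) = C * (T + C * \<kappa> $ i) / (C + T * \<kappa> $ i)"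
        using pos by (simp add: field_simps)
      moreover have "T * R + r * (\<kappa> $ i * (C * w + T) / (C + T * \<kappa> $ i))
          = r * (C * w + T) * (T + \<kappa> $ i / (C + T * \<kappa> $ i))"
        by (simp add: R' algebra_simps)
      moreover have "(r * (C * (C + T * w))) * (slope v x0 * ((T + C * \<kappa> $ i) / (C + T * \<kappa> $ i)))
          = r * (C * w + T) * (C * (T + C * \<kappa> $ i) / (C + T * \<kappa> $ i))"
        unfolding sv' using S by (simp add: mult_ac)
      ultimately show ?thesis by (simp only:)
    qed
    have "(r * (C * (C + T * w))) * (\<Sum>i\<in>UNIV. slope v x0 * ((T + C * \<kappa> $ i) / (C + T * \<kappa> $ i)) * (c i)\<^sup>2)
       \<le> (r * (C * (C + T * w))) * Q"
      using le unfolding fac sum_distrib_left by (simp add: mult_ac)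
    moreover have "r * (C * (C + T * w)) > 0" using r C S by simp
    ultimately have "(\<Sum>i\<in>UNIV. slope v x0 * ((T + C * \<kappa> $ i) / (C + T * \<kappa> $ i)) * (c i)\<^sup>2) \<le> Q"
      by (simp only: mult_le_cancel_left_pos)
    thus "(\<Sum>i\<in>UNIV. slope v x0 * ((T + C * \<kappa> $ i) / (C + T * \<kappa> $ i)) * (c i)\<^sup>2)
      \<le> (\<Sum>i\<in>UNIV. c i *\<^sub>R e i) \<bullet> (Amat v x0 *v (\<Sum>i\<in>UNIV. c i *\<^sub>R e i))"
      by (simp only: Q_def \<xi>_def)
  qed
qed

end

section \<open>Global convexity and nearest points\<close>

text \<open>Subtract the chord and suppose that the maximum is positive. At the first point where it
  is attained the support line must be horizontal, so the maximum is also attained a little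
  earlier.\<close>

lemma below_chord_of_local_support:
  fixes \<theta> :: "real \<Rightarrow> real"
  assumes c: "continuous_on {0..1} \<theta>"
    and sup: "\<And>s. 0 < s \<Longrightarrow> s < 1 \<Longrightarrow> \<exists>m d. 0 < d \<and> (\<forall>t. \<bar>t - s\<bar> < d \<longrightarrow> \<theta> s + m * (t - s) \<le> \<theta> t)"
    and s: "0 \<le> s" "s \<le> 1"
  shows "\<theta> s \<le> (1 - s) * \<theta> 0 + s * \<theta> 1"
proof (rule ccontr)
  assume n: "\<not> ?thesis"
  define h where "h s = \<theta> s - ((1 - s) * \<theta> 0 + s * \<theta> 1)" for s
  have ch: "continuous_on {0..1} h" unfolding h_def by (intro continuous_intros c)
  have sI: "s \<in> {0..1}" using s by simp
  obtain m0 where m0: "m0 \<in> {0..1}" "\<And>y. y \<in> {0..1} \<Longrightarrow> h y \<le> h m0"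
    using continuous_attains_sup[OF compact_Icc _ ch] sI by blast
  have pos: "h m0 > 0" using n m0(2)[OF sI] by (simp add: h_def)
  define Q where "Q = {t \<in> {0..1}. h t = h m0}"
  have "closed Q" unfolding Q_def by (rule continuous_closed_preimage_constant[OF ch]) simp
  hence "compact ({0..1} \<inter> Q)" by (rule compact_Int_closed[OF compact_Icc])
  moreover have "{0..1} \<inter> Q = Q" by (auto simp: Q_def)
  ultimately have "compact Q" by simp
  moreover have "Q \<noteq> {}" using m0 by (auto simp: Q_def)
  ultimately obtain q where q: "q \<in> Q" "\<And>t. t \<in> Q \<Longrightarrow> q \<le> t"
    using compact_attains_inf[of Q] by auto
  have hq: "h q = h m0" and qI: "0 \<le> q" "q \<le> 1" using q(1) by (auto simp: Q_def)
  have "h 0 = 0" "h 1 = 0" by (simp_all add: h_def)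
  hence "q \<noteq> 0" "q \<noteq> 1" using hq pos by force+
  hence q01: "0 < q" "q < 1" using qI by auto
  obtain m d where md: "0 < d" "\<And>t. \<bar>t - q\<bar> < d \<Longrightarrow> \<theta> q + m * (t - q) \<le> \<theta> t"
    using sup[OF q01] by blast
  define m' where "m' = m + \<theta> 0 - \<theta> 1"
  have hs: "h q + m' * (t - q) \<le> h t" if "\<bar>t - q\<bar> < d" for t
    using md(2)[OF that] by (simp add: h_def m'_def algebra_simps)
  define e where "e = min d (min q (1 - q)) / 2"
  have e: "0 < e" "e < d" "e < q" "e < 1 - q" using md q01 by (auto simp: e_def min_def)
  have "h (q + e) \<le> h m0" "h (q - e) \<le> h m0" using e q01 by (auto intro!: m0(2))
  moreover have "h q + m' * e \<le> h (q + e)" "h q - m' * e \<le> h (q - e)"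
    using hs[of "q + e"] hs[of "q - e"] e by auto
  ultimately have "h (q - e) = h m0" using hq by linarith
  hence "q - e \<in> Q" using e q01 by (auto simp: Q_def)
  thus False using q(2) e by force
qed

text \<open>\<open>u\<^sup>2 + |y|\<^sup>2\<close> is the height function in the paraboloid (projective) model, in which totally
  geodesic hypersurfaces are affine; half of its Hessian is \<open>Amat u\<close>, half of its gradient \<open>sphere_center u\<close>.\<close>

lemma height_local_support:
  fixes u :: "real^'n::finite \<Rightarrow> real"
  assumes C: "Ck 2 \<Omega> u" and O: "open \<Omega>" "ball x r \<subseteq> \<Omega>"
    and A: "\<And>y \<xi>. y \<in> \<Omega> \<Longrightarrow> 0 \<le> \<xi> \<bullet> (Amat u y *v \<xi>)" and y: "y \<in> ball x r"
  shows "(u x)\<^sup>2 + x \<bullet> x + 2 * (sphere_center u x \<bullet> (y - x)) \<le> (u y)\<^sup>2 + y \<bullet> y"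
proof -
  define \<eta> where "\<eta> = y - x"
  define Y where "Y s = x + s *\<^sub>R \<eta>" for s
  define g where "g s = (u (Y s))\<^sup>2 + Y s \<bullet> Y s" for s
  define g' where "g' s = 2 * ((u (Y s) *\<^sub>R grad u (Y s)) \<bullet> \<eta>) + 2 * (Y s \<bullet> \<eta>)" for s
  have Yin: "Y s \<in> \<Omega>" if "0 \<le> s" "s \<le> 1" for s
  proof -
    have "norm (s *\<^sub>R \<eta>) \<le> norm \<eta>" using that by (simp add: mult_left_le_one_le)
    also have "norm \<eta> < r" using y by (simp add: \<eta>_def dist_norm norm_minus_commute)
    finally have "Y s \<in> ball x r" by (simp add: Y_def dist_norm)
    thus ?thesis using O by blast
  qed
  have C1: "Ck (Suc 1) \<Omega> u" using C by (simp add: numeral_2_eq_2)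
  have Yexp: "Y s \<bullet> Y s = x \<bullet> x + 2 * s * (x \<bullet> \<eta>) + s\<^sup>2 * (\<eta> \<bullet> \<eta>)" "Y s \<bullet> \<eta> = x \<bullet> \<eta> + s * (\<eta> \<bullet> \<eta>)" for s
    by (simp_all add: Y_def inner_add_left inner_add_right inner_commute[of \<eta> x] power2_eq_square algebra_simps)
  have d1: "(g has_real_derivative g' s) (at s)" if "0 \<le> s" "s \<le> 1" for s
  proof -
    have "((\<lambda>s. u (Y s)) has_real_derivative grad u (Y s) \<bullet> \<eta>) (at s)"
      unfolding Y_def by (rule Ck_line_deriv[OF C1 O(1)]) (use Yin[OF that] in \<open>simp add: Y_def\<close>)
    thus ?thesis unfolding g_def g'_def Yexp
      by (auto intro!: derivative_eq_intros simp: algebra_simps)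
  qed
  have d2: "(g' has_real_derivative 2 * (\<eta> \<bullet> (Amat u (Y s) *v \<eta>))) (at s)" if "0 \<le> s" "s \<le> 1" for s
  proof -
    have "((\<lambda>s. u (Y s) *\<^sub>R grad u (Y s)) has_vector_derivative (Amat u (Y s) *v \<eta> - \<eta>)) (at s)"
      unfolding Y_def by (rule u_grad_line_deriv[OF C O(1)]) (use Yin[OF that] in \<open>simp add: Y_def\<close>)
    hence "((\<lambda>s. (u (Y s) *\<^sub>R grad u (Y s)) \<bullet> \<eta>) has_real_derivative (Amat u (Y s) *v \<eta> - \<eta>) \<bullet> \<eta>) (at s)"
      using bounded_linear.has_vector_derivative[OF bounded_linear_inner_left]
      by (simp only: has_real_derivative_iff_has_vector_derivative)
    moreover have "((\<lambda>s. x \<bullet> \<eta> + s * (\<eta> \<bullet> \<eta>)) has_real_derivative \<eta> \<bullet> \<eta>) (at s)"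
      by (auto intro!: derivative_eq_intros)
    ultimately have "(g' has_real_derivative 2 * ((Amat u (Y s) *v \<eta> - \<eta>) \<bullet> \<eta>) + 2 * (\<eta> \<bullet> \<eta>)) (at s)"
      unfolding g'_def Yexp by (intro DERIV_add DERIV_cmult)
    moreover have "2 * ((Amat u (Y s) *v \<eta> - \<eta>) \<bullet> \<eta>) + 2 * (\<eta> \<bullet> \<eta>) = 2 * (\<eta> \<bullet> (Amat u (Y s) *v \<eta>))"
      by (simp add: inner_diff_left inner_commute[of "Amat u (Y s) *v \<eta>"])
    ultimately show ?thesis by simp
  qed
  have "\<exists>z>0. z < 1 \<and> g 1 - g 0 = (1 - 0) * g' z" by (rule MVT2) (use d1 in auto)
  then obtain z where z: "0 < z" "z < 1" "g 1 - g 0 = g' z" by auto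
  have "\<exists>w>0. w < z \<and> g' z - g' 0 = (z - 0) * (2 * (\<eta> \<bullet> (Amat u (Y w) *v \<eta>)))"
    by (rule MVT2) (use d2 z in auto)
  then obtain w where w: "0 < w" "w < z" "g' z - g' 0 = z * (2 * (\<eta> \<bullet> (Amat u (Y w) *v \<eta>)))" by auto
  have "0 \<le> \<eta> \<bullet> (Amat u (Y w) *v \<eta>)" using w z by (intro A Yin) auto
  hence "g' 0 \<le> g' z" using w(3) z by (smt (verit) mult_nonneg_nonneg)
  hence "g 0 + g' 0 \<le> g 1" using z by linarith
  thus ?thesis by (simp add: g_def g'_def Y_def \<eta>_def sphere_center_def inner_add_left)
qed

definition extend :: "(real^'n::finite) set \<Rightarrow> real \<Rightarrow> (real^'n \<Rightarrow> real) \<Rightarrow> real^'n \<Rightarrow> real" where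
  "extend \<Omega> \<epsilon> u y = (if y \<in> \<Omega> then u y else \<epsilon>)"

lemma nonneg_linear_part:
  fixes a b :: real
  assumes "\<And>t. 0 < t \<Longrightarrow> t \<le> 1 \<Longrightarrow> 0 \<le> a * t + b * t\<^sup>2"
  shows "0 \<le> a"
proof (rule ccontr)
  assume a: "\<not> 0 \<le> a"
  define t where "t = min 1 (- a / (2 * (\<bar>b\<bar> + 1)))"
  have "0 < - a / (2 * (\<bar>b\<bar> + 1))" using a by (intro divide_pos_pos) auto
  hence t: "0 < t" "t \<le> 1" by (auto simp: t_def)
  have "t * (\<bar>b\<bar> + 1) \<le> - a / (2 * (\<bar>b\<bar> + 1)) * (\<bar>b\<bar> + 1)" by (intro mult_right_mono) (auto simp: t_def)
  also have "\<dots> = - a / 2" by (simp add: field_simps)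
  finally have "t * (\<bar>b\<bar> + 1) \<le> - a / 2" .
  moreover have "b * t \<le> (\<bar>b\<bar> + 1) * t" using t by (intro mult_right_mono) auto
  ultimately have "b * t < - a" using a by (simp add: mult.commute)
  hence "(a + b * t) * t < 0" using t by (intro mult_neg_pos) auto
  thus False using assms[OF t] by (simp add: algebra_simps power2_eq_square)
qed

text \<open>Points on the far side of a hemisphere are at hyperbolic distance at least that of the hemisphere.\<close>

lemma cosh_distance_ge:
  fixes x y c :: "'a::real_inner" and r s R :: real
  assumes R: "0 < R" and rs: "0 < r" "0 < s" and N: "N = R\<^sup>2 - (norm (x - c))\<^sup>2 - r\<^sup>2" "0 < N"
    and far: "R\<^sup>2 \<le> s\<^sup>2 + (norm (y - c))\<^sup>2"
  shows "4 * r\<^sup>2 * s\<^sup>2 * (1 + (N / (2 * r * R))\<^sup>2) \<le> ((norm (x - y))\<^sup>2 + r\<^sup>2 + s\<^sup>2)\<^sup>2"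
proof -
  define a b where "a = norm (x - c)" and "b = norm (y - c)"
  define P q where "P = a\<^sup>2 + r\<^sup>2" and "q = sqrt (b\<^sup>2 + s\<^sup>2)"
  \<comment> \<open>Chosen so that P + q^2 - q e = (q - R) (q - P / R), which is nonnegative on the
    far side, where \<open>R \<le> q\<close>.\<close>
  define e where "e = (R\<^sup>2 + P) / R"
  have ab: "a \<ge> 0" "b \<ge> 0" by (auto simp: a_def b_def)
  have q2: "q\<^sup>2 = b\<^sup>2 + s\<^sup>2" by (simp add: q_def)
  have q0: "q > 0" using rs by (simp add: q_def add_nonneg_pos)
  have qb: "b \<le> q" unfolding q_def by (rule real_le_rsqrt) simp
  have qR: "R \<le> q" unfolding q_def using far by (intro real_le_rsqrt) (simp add: b_def add.commute)
  have NP: "N = R\<^sup>2 - P" using N by (simp add: P_def a_def)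
  have e2: "e\<^sup>2 - 4 * a\<^sup>2 = N\<^sup>2 / R\<^sup>2 + 4 * r\<^sup>2"
  proof -
    have "(R\<^sup>2 + P)\<^sup>2 = N\<^sup>2 + 4 * P * R\<^sup>2" by (simp add: NP power2_sum power2_diff)
    hence "e\<^sup>2 = N\<^sup>2 / R\<^sup>2 + 4 * P" using R unfolding e_def power_divide by (simp add: add_divide_distrib)
    thus ?thesis by (simp add: P_def)
  qed
  have ea: "2 * a \<le> e"
  proof -
    have "(2 * a)\<^sup>2 \<le> e\<^sup>2" using e2 by (simp add: power_mult_distrib)
      (smt (verit) divide_nonneg_nonneg zero_le_power2)
    moreover have "0 \<le> e" using R by (simp add: e_def P_def)
    ultimately show ?thesis by (rule power2_le_imp_le)
  qed
  have lower: "q * e - 2 * a * b \<le> (norm (x - y))\<^sup>2 + r\<^sup>2 + s\<^sup>2"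
  proof -
    have "(x - c) \<bullet> (y - c) \<le> a * b" unfolding a_def b_def by (rule norm_cauchy_schwarz)
    moreover have "(norm (x - y))\<^sup>2 = a\<^sup>2 + b\<^sup>2 - 2 * ((x - c) \<bullet> (y - c))"
      unfolding a_def b_def power2_norm_eq_inner
      by (simp add: inner_diff_left inner_diff_right inner_commute algebra_simps)
    moreover have "q * e \<le> P + q\<^sup>2"
    proof -
      have "P / R \<le> R" using NP N(2) R by (simp add: divide_le_eq power2_eq_square)
      hence "0 \<le> (q - R) * (q - P / R)" using qR by (intro mult_nonneg_nonneg) auto
      also have "\<dots> = P + q\<^sup>2 - q * e" using R by (simp add: e_def power2_eq_square field_simps)
      finally show ?thesis by simp
    qed
    ultimately show ?thesis using q2 by (simp add: P_def)
  qed
  have "2 * a * b \<le> e * q" using mult_mono[OF ea qb] ab ea by (simp add: mult.assoc)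
  hence "0 \<le> q * e - 2 * a * b" by (simp add: mult.commute)
  hence "(q * e - 2 * a * b)\<^sup>2 \<le> ((norm (x - y))\<^sup>2 + r\<^sup>2 + s\<^sup>2)\<^sup>2" using lower by (rule power_mono[rotated])
  \<comment> \<open>The identity behind the reversed Cauchy-Schwarz inequality for the timelike
    vectors (q, b) and (e, 2 a).\<close>
  moreover have "(q * e - 2 * a * b)\<^sup>2 = (q\<^sup>2 - b\<^sup>2) * (e\<^sup>2 - 4 * a\<^sup>2) + (2 * a * q - b * e)\<^sup>2"
    by (simp add: power2_eq_square algebra_simps)
  moreover have "0 \<le> (2 * a * q - b * e)\<^sup>2" by simp
  moreover have "(q\<^sup>2 - b\<^sup>2) * (e\<^sup>2 - 4 * a\<^sup>2) = 4 * r\<^sup>2 * s\<^sup>2 * (1 + (N / (2 * r * R))\<^sup>2)"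
    unfolding e2 q2 using R rs by (simp add: power_divide power_mult_distrib field_simps)
  ultimately show ?thesis by linarith
qed

context curvature_function
begin

lemma extend_continuous:
  assumes O: "open \<Omega>" and s: "solution \<Omega> \<epsilon> u"
  shows "continuous_on UNIV (extend \<Omega> \<epsilon> u)"
proof -
  have "continuous_on (closure \<Omega> \<union> - \<Omega>) (\<lambda>y. if y \<in> \<Omega> then u y else \<epsilon>)"
  proof (rule continuous_on_cases)
    show "\<forall>x. x \<in> closure \<Omega> \<and> x \<notin> \<Omega> \<or> x \<in> - \<Omega> \<and> x \<in> \<Omega> \<longrightarrow> u x = \<epsilon>"
      using solutionD(3)[OF s] O by (auto simp: frontier_def interior_open)
  qed (use O solutionD(2)[OF s] in auto)
  moreover have "closure \<Omega> \<union> - \<Omega> = UNIV" using closure_subset by blast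
  ultimately show ?thesis by (simp add: extend_def[abs_def])
qed

context
  fixes \<Omega> :: "(real^'n) set" and \<epsilon> :: real and u :: "real^'n \<Rightarrow> real"
  assumes O: "open \<Omega>" and eps: "0 \<le> \<epsilon>" and s: "solution \<Omega> \<epsilon> u"
    and ge: "\<And>x. x \<in> \<Omega> \<Longrightarrow> \<epsilon> \<le> u x"
begin

definition "height y = (extend \<Omega> \<epsilon> u y)\<^sup>2 + y \<bullet> y"

lemma extend_ge: "\<epsilon> \<le> extend \<Omega> \<epsilon> u y"
  using ge by (simp add: extend_def)

lemma height_continuous: "continuous_on UNIV height"
  unfolding height_def by (intro continuous_intros extend_continuous[OF O s])

lemma Amat_nonneg: "x \<in> \<Omega> \<Longrightarrow> 0 \<le> \<xi> \<bullet> (Amat u x *v \<xi>)"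
  using solutionD(5)[OF s, of x \<xi>] by (cases "\<xi> = 0") auto

text \<open>Local support suffices. Over \<Omega> the tangents of the height serve; elsewhere those
  of the paraboloid \<epsilon>^2 + |x|^2, which lies below the extended height because u is at least
  \<epsilon>. So gluing across the frontier keeps convexity.\<close>

lemma height_chord:
  assumes t: "0 \<le> t" "t \<le> 1"
  shows "height (y + t *\<^sub>R (z - y)) \<le> (1 - t) * height y + t * height z"
proof -
  define \<eta> where "\<eta> = z - y"
  define \<theta> where "\<theta> t = height (y + t *\<^sub>R \<eta>)" for t
  have "\<theta> t \<le> (1 - t) * \<theta> 0 + t * \<theta> 1"
  proof (rule below_chord_of_local_support[OF _ _ t])
    show "continuous_on {0..1} \<theta>" unfolding \<theta>_def
      by (rule continuous_on_compose2[OF height_continuous]) (auto intro!: continuous_intros)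
    fix s0 :: real
    define x where "x = y + s0 *\<^sub>R \<eta>"
    have pt: "y + t *\<^sub>R \<eta> = x + (t - s0) *\<^sub>R \<eta>" for t by (simp add: x_def algebra_simps)
    show "\<exists>m d. 0 < d \<and> (\<forall>t. \<bar>t - s0\<bar> < d \<longrightarrow> \<theta> s0 + m * (t - s0) \<le> \<theta> t)"
    proof (cases "x \<in> \<Omega>")
      case True
      obtain r where r: "r > 0" "ball x r \<subseteq> \<Omega>" using O True openE by blast
      obtain d where d: "d > 0" "\<And>t. \<bar>t\<bar> < d \<Longrightarrow> x + t *\<^sub>R \<eta> \<in> ball x r"
        using line_in_ball[OF r(1)] by metis
      have "\<theta> s0 + (2 * (sphere_center u x \<bullet> \<eta>)) * (t - s0) \<le> \<theta> t" if "\<bar>t - s0\<bar> < d" for t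
        using height_local_support[OF solutionD(1)[OF s] O r(2) Amat_nonneg d(2)[OF that]] True d(2)[OF that] r(2)
        by (simp add: \<theta>_def pt x_def[symmetric] height_def extend_def subset_iff mult_ac)
      thus ?thesis using d(1) by blast
    next
      case False
      have "\<theta> s0 + (2 * (x \<bullet> \<eta>)) * (t - s0) \<le> \<theta> t" for t
      proof -
        have "\<theta> s0 + (2 * (x \<bullet> \<eta>)) * (t - s0) \<le> \<epsilon>\<^sup>2 + x \<bullet> x + (2 * (x \<bullet> \<eta>)) * (t - s0) + (t - s0)\<^sup>2 * (\<eta> \<bullet> \<eta>)"
          using False by (simp add: \<theta>_def x_def[symmetric] height_def extend_def)
        also have "\<dots> = \<epsilon>\<^sup>2 + (x + (t - s0) *\<^sub>R \<eta>) \<bullet> (x + (t - s0) *\<^sub>R \<eta>)"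
          by (simp add: inner_add_left inner_add_right inner_commute[of \<eta> x] power2_eq_square algebra_simps)
        also have "\<dots> \<le> \<theta> t"
          unfolding \<theta>_def pt height_def by (auto intro!: power_mono extend_ge eps)
        finally show ?thesis .
      qed
      thus ?thesis by (intro exI[of _ "2 * (x \<bullet> \<eta>)"] exI[of _ 1]) simp
    qed
  qed
  thus ?thesis by (simp add: \<theta>_def \<eta>_def)
qed

text \<open>The tangent plane supports near y, and convexity along the segment to z makes this
  global.\<close>

lemma height_support:
  assumes y: "y \<in> \<Omega>"
  shows "(u y)\<^sup>2 + y \<bullet> y + 2 * (sphere_center u y \<bullet> (z - y)) \<le> height z"
proof -
  obtain r where r: "r > 0" "ball y r \<subseteq> \<Omega>" using O y openE by blast
  obtain d where d: "d > 0" "\<And>t. \<bar>t\<bar> < d \<Longrightarrow> y + t *\<^sub>R (z - y) \<in> ball y r"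
    using line_in_ball[OF r(1)] by metis
  define t where "t = min 1 (d / 2)"
  have t: "0 < t" "t \<le> 1" "\<bar>t\<bar> < d" using d by (auto simp: t_def)
  have hy: "height y = (u y)\<^sup>2 + y \<bullet> y" using y by (simp add: height_def extend_def)
  have "height y + t * (2 * (sphere_center u y \<bullet> (z - y))) \<le> height (y + t *\<^sub>R (z - y))"
    using height_local_support[OF solutionD(1)[OF s] O r(2) Amat_nonneg d(2)[OF t(3)]] y d(2)[OF t(3)] r(2)
    by (simp add: height_def extend_def subset_iff mult_ac)
  also have "\<dots> \<le> (1 - t) * height y + t * height z" using t by (intro height_chord) auto
  finally have "t * (height y + 2 * (sphere_center u y \<bullet> (z - y))) \<le> t * height z" by (simp add: algebra_simps)
  thus ?thesis using t by (simp add: hy)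
qed

text \<open>The point of the convex region above the graph of \<open>u\<close> nearest to a point below the graph
  lies higher, hence over \<open>\<Omega>\<close>; \<open>C\<close> is the hyperbolic cosine of the distance.\<close>

lemma nearest_point:
  assumes r: "\<epsilon> \<le> r" "0 < r" "r < extend \<Omega> \<epsilon> u x" and K: "extend \<Omega> \<epsilon> u y0 \<le> s0" "0 < s0"
    and Cdef: "(norm (x - y0))\<^sup>2 + r\<^sup>2 + s0\<^sup>2 = 2 * r * s0 * C" and C: "1 \<le> C"
    and min: "\<And>y t. extend \<Omega> \<epsilon> u y \<le> t \<Longrightarrow> 0 < t \<Longrightarrow> 2 * r * t * C \<le> (norm (x - y))\<^sup>2 + r\<^sup>2 + t\<^sup>2"
  shows "y0 \<in> \<Omega>" "s0 = u y0" "x - y0 = (u y0 - C * r) *\<^sub>R grad u y0" "C * r < u y0"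
proof -
  define z0 where "z0 = s0\<^sup>2 + y0 \<bullet> y0"
  have ext0: "0 \<le> extend \<Omega> \<epsilon> u y" for y using extend_ge[of y] eps by linarith
  \<comment> \<open>Variational inequality of the nearest point in the projective coordinates (y,
    z), in which the region is convex. Along a segment to a competitor the squared comparison of
    cosh values is quadratic in t without constant term, so its linear coefficient is
    nonnegative.\<close>
  have var: "2 * ((s0 *\<^sub>R x - (r * C) *\<^sub>R y0) \<bullet> (y - y0)) \<le> (s0 - r * C) * (z - z0)"
    if z: "height y \<le> z" "y \<bullet> y < z" for y z
  proof -
    let ?y = "\<lambda>t. y0 + t *\<^sub>R (y - y0)" and ?z = "\<lambda>t. z0 + t * (z - z0)"
    define m where "m = (z - z0) - 2 * (x \<bullet> (y - y0))"
    define n where "n = (z - z0) - 2 * (y0 \<bullet> (y - y0))"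
    define a b where "a = 4 * r * s0 * C * m - 4 * r\<^sup>2 * C\<^sup>2 * n" and "b = m\<^sup>2 + 4 * r\<^sup>2 * C\<^sup>2 * ((y - y0) \<bullet> (y - y0))"
    have "0 \<le> a * t + b * t\<^sup>2" if t: "0 < t" "t \<le> 1" for t
    proof -
      \<comment> \<open>The squared half-space height of the point of the segment at parameter
        \<open>t\<close>.\<close>
      define S where "S = ?z t - ?y t \<bullet> ?y t"
      have S1: "S = (1 - t) * s0\<^sup>2 + t * (z - y \<bullet> y) + t * (1 - t) * ((y - y0) \<bullet> (y - y0))"
        by (simp add: S_def z0_def inner_add_left inner_add_right inner_diff_left inner_diff_right algebra_simps)
      have S2: "S = s0\<^sup>2 + n * t - t\<^sup>2 * ((y - y0) \<bullet> (y - y0))"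
        by (simp add: S_def z0_def n_def inner_add_left inner_add_right inner_diff_left inner_diff_right inner_commute[of y y0] power2_eq_square algebra_simps)
      have Sp: "S > 0" unfolding S1 using t z K by (intro add_nonneg_pos add_pos_nonneg) (auto intro!: add_nonneg_pos)
      have "(1 - t) * height y0 + t * height y \<le> ?z t"
      proof -
        have "height y0 \<le> z0" using K(1) ext0[of y0] by (simp add: height_def z0_def power_mono)
        hence "(1 - t) * height y0 + t * height y \<le> (1 - t) * z0 + t * z"
          using t z by (intro add_mono mult_left_mono) auto
        thus ?thesis by (simp add: algebra_simps)
      qed
      hence "height (?y t) \<le> ?z t" using height_chord[of t y0 y] t by linarith
      hence "(extend \<Omega> \<epsilon> u (?y t))\<^sup>2 \<le> S" by (simp add: height_def S_def)
      hence "extend \<Omega> \<epsilon> u (?y t) \<le> sqrt S" by (rule real_le_rsqrt)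
      hence "2 * r * sqrt S * C \<le> (norm (x - ?y t))\<^sup>2 + r\<^sup>2 + (sqrt S)\<^sup>2" using Sp by (intro min) auto
      moreover have "(norm (x - ?y t))\<^sup>2 + r\<^sup>2 + (sqrt S)\<^sup>2 = 2 * r * s0 * C + t * m"
      proof -
        have "(norm (x - ?y t))\<^sup>2 + S = x \<bullet> x - 2 * (x \<bullet> ?y t) + ?z t"
          unfolding power2_norm_eq_inner S_def by (simp add: inner_diff_left inner_diff_right inner_commute algebra_simps)
        also have "\<dots> = (norm (x - y0))\<^sup>2 + s0\<^sup>2 + t * m"
          unfolding power2_norm_eq_inner by (simp add: z0_def m_def inner_diff_left inner_diff_right inner_add_right inner_commute algebra_simps)
        finally show ?thesis using Cdef Sp by simp
      qed
      ultimately have le: "2 * r * sqrt S * C \<le> 2 * r * s0 * C + t * m" by simp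
      have "(2 * r * sqrt S * C)\<^sup>2 \<le> (2 * r * s0 * C + t * m)\<^sup>2"
        by (rule power_mono[OF le]) (use r C Sp in simp)
      hence "4 * r\<^sup>2 * C\<^sup>2 * S \<le> (2 * r * s0 * C + t * m)\<^sup>2" using Sp by (simp add: power_mult_distrib mult_ac)
      moreover have "(2 * r * s0 * C + t * m)\<^sup>2 - 4 * r\<^sup>2 * C\<^sup>2 * S = a * t + b * t\<^sup>2"
        unfolding S2 a_def b_def by (simp add: power2_eq_square algebra_simps)
      ultimately show ?thesis by linarith
    qed
    hence "0 \<le> a" by (rule nonneg_linear_part)
    also have "a = (4 * r * C) * (s0 * m - r * C * n)" by (simp add: a_def power2_eq_square algebra_simps)
    finally have "(4 * r * C) * 0 \<le> (4 * r * C) * (s0 * m - r * C * n)" by simp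
    moreover have "0 < 4 * r * C" using r C by simp
    ultimately have "0 \<le> s0 * m - r * C * n" by (simp only: mult_le_cancel_left_pos)
    thus ?thesis by (simp add: m_def n_def inner_diff_left algebra_simps)
  qed
  have h0: "height y0 \<le> z0" using K(1) ext0[of y0] by (simp add: height_def z0_def power_mono)
  have "0 \<le> s0 - r * C"
    using var[of y0 "z0 + 1"] h0 K by (simp add: z0_def add_nonneg_pos)
  \<comment> \<open>Otherwise a competitor over \<open>x\<close> itself gives \<open>x = y0\<close>
    and then \<open>r = s0\<close>, although the given point is strictly below the graph.\<close>
  moreover have "s0 \<noteq> r * C"
  proof
    assume e: "s0 = r * C"
    have "2 * ((s0 *\<^sub>R x - (r * C) *\<^sub>R y0) \<bullet> (x - y0)) \<le> (s0 - r * C) * (max (height x) (x \<bullet> x + 1) - z0)"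
      by (rule var) (auto simp: less_max_iff_disj)
    hence "s0 * ((x - y0) \<bullet> (x - y0)) \<le> 0" by (simp add: e[symmetric] scaleR_diff_right[symmetric])
    hence "(x - y0) \<bullet> (x - y0) \<le> 0" using K(2) by (simp add: mult_le_0_iff)
    hence xy: "x = y0" by (metis eq_iff_diff_eq_0 inner_eq_zero_iff inner_ge_zero order_antisym)
    have "r\<^sup>2 + s0\<^sup>2 = 2 * s0 * s0" using Cdef by (simp add: xy e mult_ac)
    hence "r\<^sup>2 = s0\<^sup>2" by (simp add: power2_eq_square)
    hence "r = s0" using r K by (simp add: power2_eq_iff_nonneg)
    thus False using r(3) K(1) xy by simp
  qed
  ultimately have sr: "r * C < s0" by simp
  \<comment> \<open>If the point were above the graph, lowering \<open>z\<close> over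
    \<open>y0\<close> would contradict \<open>var\<close>.\<close>
  have s0e: "extend \<Omega> \<epsilon> u y0 = s0"
  proof (rule ccontr)
    assume "extend \<Omega> \<epsilon> u y0 \<noteq> s0"
    hence "(extend \<Omega> \<epsilon> u y0)\<^sup>2 < s0\<^sup>2" using K ext0[of y0] by (intro power_strict_mono) auto
    hence "height y0 < z0" "y0 \<bullet> y0 < z0" using K by (auto simp: height_def z0_def)
    then obtain z where z: "height y0 < z" "y0 \<bullet> y0 < z" "z < z0"
      using dense[of "max (height y0) (y0 \<bullet> y0)" z0] by auto
    from var[of y0 z] z have "0 \<le> (s0 - r * C) * (z - z0)" by simp
    thus False using sr z by (simp add: zero_le_mult_iff)
  qed
  have "r \<le> r * C" using r C by simp
  hence "\<epsilon> < s0" using r sr by linarith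
  thus yO: "y0 \<in> \<Omega>" using s0e by (auto simp: extend_def split: if_splits)
  thus su: "s0 = u y0" using s0e by (simp add: extend_def)
  show "C * r < u y0" using sr su by (simp add: mult.commute)
  have z0h: "z0 = height y0" using s0e by (simp add: z0_def height_def)
  obtain q where q: "q > 0" "ball y0 q \<subseteq> \<Omega>" using O yO openE by blast
  define l where "l = s0 *\<^sub>R x - (r * C) *\<^sub>R y0"
  \<comment> \<open>On the graph over \<Omega>, \<open>var\<close> says that \<open>g\<close> has a
    local minimum at 0; the left-hand side is half its derivative there.\<close>
  have "((s0 - r * C) *\<^sub>R sphere_center u y0 - l) \<bullet> \<xi> = 0" for \<xi>
  proof -
    obtain d where d: "d > 0" "\<And>t. \<bar>t\<bar> < d \<Longrightarrow> y0 + t *\<^sub>R \<xi> \<in> ball y0 q"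
      using line_in_ball[OF q(1)] by metis
    define g where "g t = (s0 - r * C) * ((u (y0 + t *\<^sub>R \<xi>))\<^sup>2 + (norm (y0 + t *\<^sub>R \<xi> - 0))\<^sup>2 - z0) - 2 * (l \<bullet> \<xi>) * t" for t
    have C1: "Ck (Suc 1) \<Omega> u" by (rule solutionD(1)[OF s])
    have "((\<lambda>t. u (y0 + t *\<^sub>R \<xi>)) has_real_derivative grad u (y0 + 0 *\<^sub>R \<xi>) \<bullet> \<xi>) (at 0)"
      by (rule Ck_line_deriv[OF C1 O]) (use yO in simp)
    note der = this[simplified]
    have dg: "(g has_real_derivative 2 * (((s0 - r * C) *\<^sub>R sphere_center u y0 - l) \<bullet> \<xi>)) (at 0)"
      unfolding g_def
      by (rule derivative_eq_intros der norm_line_deriv refl)+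
         (simp add: sphere_center_def inner_diff_left inner_add_left algebra_simps)
    have gmin: "g 0 \<le> g t" if "\<bar>t - 0\<bar> < d" for t
    proof -
      have inO: "y0 + t *\<^sub>R \<xi> \<in> \<Omega>" using d(2)[of t] that q by auto
      hence h: "height (y0 + t *\<^sub>R \<xi>) = (u (y0 + t *\<^sub>R \<xi>))\<^sup>2 + (norm (y0 + t *\<^sub>R \<xi> - 0))\<^sup>2"
        by (simp add: height_def extend_def power2_norm_eq_inner)
      have "2 * (l \<bullet> (y0 + t *\<^sub>R \<xi> - y0)) \<le> (s0 - r * C) * (height (y0 + t *\<^sub>R \<xi>) - z0)"
        unfolding l_def
      proof (rule var)
        have "0 < (u (y0 + t *\<^sub>R \<xi>))\<^sup>2" using solutionD(4)[OF s inO] by simp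
        thus "(y0 + t *\<^sub>R \<xi>) \<bullet> (y0 + t *\<^sub>R \<xi>) < height (y0 + t *\<^sub>R \<xi>)"
          using inO by (simp add: height_def extend_def)
      qed simp
      hence "0 \<le> g t" unfolding h g_def by (simp add: mult_ac)
      moreover have "g 0 = 0" using yO by (simp add: g_def z0h height_def extend_def power2_norm_eq_inner)
      ultimately show ?thesis by simp
    qed
    have "2 * (((s0 - r * C) *\<^sub>R sphere_center u y0 - l) \<bullet> \<xi>) = 0"
      by (rule DERIV_local_min[OF dg d(1)]) (use gmin in auto)
    thus ?thesis by simp
  qed
  hence "(s0 - r * C) *\<^sub>R sphere_center u y0 = l" by (metis eq_iff_diff_eq_0 inner_eq_zero_iff)
  hence "s0 *\<^sub>R (x - y0) = s0 *\<^sub>R ((s0 - C * r) *\<^sub>R grad u y0)"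
    by (simp add: l_def sphere_center_def su[symmetric] algebra_simps)
  hence "x - y0 = (s0 - C * r) *\<^sub>R grad u y0" by (rule scaleR_left_imp_eq[rotated]) (use K(2) in simp)
  thus "x - y0 = (u y0 - C * r) *\<^sub>R grad u y0" by (simp only: su)
qed

end

end

section \<open>Boundary behaviour\<close>

lemma matrix_form_bound:
  fixes H :: "real^'n::finite^'n" and h :: "real^'n"
  assumes "\<And>i j. \<bar>H $ i $ j\<bar> \<le> L"
  shows "\<bar>h \<bullet> (H *v h)\<bar> \<le> L * (real CARD('n))\<^sup>2 * (norm h)\<^sup>2"
proof -
  have "\<bar>h \<bullet> (H *v h)\<bar> \<le> (\<Sum>i\<in>UNIV. \<Sum>j\<in>UNIV. \<bar>h $ i * (H $ i $ j * h $ j)\<bar>)"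
    unfolding inner_vec_def matrix_vector_mult_def
    unfolding inner_real_def vec_lambda_beta sum_distrib_left by (intro order_trans[OF sum_abs] sum_mono sum_abs)
  also have "\<dots> \<le> (\<Sum>i\<in>(UNIV::'n set). \<Sum>j\<in>(UNIV::'n set). norm h * (L * norm h))"
    unfolding abs_mult
    by (intro sum_mono mult_mono component_le_norm_cart assms mult_nonneg_nonneg) 
       (use order_trans[OF abs_ge_zero assms] in auto)
  also have "\<dots> = L * (real CARD('n))\<^sup>2 * (norm h)\<^sup>2" by (simp add: power2_eq_square)
  finally show ?thesis .
qed

lemma second_order_taylor_bound:
  fixes g :: "real^'n::finite \<Rightarrow> real"
  assumes C: "Ck 2 S g" and S: "open S" and B: "convex B" "B \<subseteq> S"
    and L: "\<And>z i j. z \<in> B \<Longrightarrow> \<bar>pd i (pd j g) z\<bar> \<le> L" and x: "x \<in> B" "x + h \<in> B"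
  shows "\<bar>g (x + h) - g x - grad g x \<bullet> h\<bar> \<le> L * (real CARD('n))\<^sup>2 * (norm h)\<^sup>2"
proof -
  have C1: "Ck (Suc 1) S g" using C by (simp add: numeral_2_eq_2)
  have inB: "x + s *\<^sub>R h \<in> B" if "0 \<le> s" "s \<le> 1" for s
  proof -
    have "(1 - s) *\<^sub>R x + s *\<^sub>R (x + h) \<in> B" using B x that by (intro convexD) auto
    thus ?thesis by (simp add: algebra_simps)
  qed
  have "\<exists>z>0. z < 1 \<and> g (x + 1 *\<^sub>R h) - g (x + 0 *\<^sub>R h) = (1 - 0) * (grad g (x + z *\<^sub>R h) \<bullet> h)"
    by (rule MVT2) (auto intro!: Ck_line_deriv[OF C1 S] subsetD[OF B(2)] inB)
  then obtain z where z: "0 < z" "z < 1" "g (x + h) - g x = grad g (x + z *\<^sub>R h) \<bullet> h" by auto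
  have "\<exists>w>0. w < z \<and> grad g (x + z *\<^sub>R h) \<bullet> h - grad g (x + 0 *\<^sub>R h) \<bullet> h =
      (z - 0) * (h \<bullet> (hess g (x + w *\<^sub>R h) *v h))"
    by (rule MVT2) (use z in \<open>auto intro!: grad_hess_line_deriv[OF C S] subsetD[OF B(2)] inB\<close>)
  then obtain w where w: "0 < w" "w < z"
    "grad g (x + z *\<^sub>R h) \<bullet> h - grad g x \<bullet> h = z * (h \<bullet> (hess g (x + w *\<^sub>R h) *v h))" by auto
  have "\<bar>h \<bullet> (hess g (x + w *\<^sub>R h) *v h)\<bar> \<le> L * (real CARD('n))\<^sup>2 * (norm h)\<^sup>2"
    by (rule matrix_form_bound) (use L inB w z in \<open>auto simp: hess_def\<close>)
  moreover have "\<bar>z * (h \<bullet> (hess g (x + w *\<^sub>R h) *v h))\<bar> \<le> 1 * \<bar>h \<bullet> (hess g (x + w *\<^sub>R h) *v h)\<bar>"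
    unfolding abs_mult using z by (intro mult_right_mono) auto
  ultimately show ?thesis using z(3) w(3) by linarith
qed

text \<open>In a ball of radius r touching at y, the square of the displacement h is less than 2 r
  times its component along the normal pointing into the ball. The Taylor remainder of \<rho>, at
  most Q |h|^2, thus loses against the linear term once \<open>2 * r * Q \<le> m\<close>, where
  \<open>m\<close> bounds the gradient on the frontier from below.\<close>

lemma uniform_sphere_condition:
  fixes \<Omega> :: "(real^'n::finite) set"
  assumes "bounded_smooth_domain \<Omega>"
  obtains r where "0 < r" "\<And>y. y \<in> frontier \<Omega> \<Longrightarrow>
    \<exists>\<nu>. norm \<nu> = 1 \<and> ball (y + r *\<^sub>R \<nu>) r \<inter> \<Omega> = {} \<and> ball (y - r *\<^sub>R \<nu>) r \<subseteq> \<Omega>"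
proof -
  obtain \<rho> where \<rho>: "smooth_on UNIV \<rho>" "\<Omega> = {x. \<rho> x < 0}" "\<And>x. \<rho> x = 0 \<Longrightarrow> \<exists>i. pd i \<rho> x \<noteq> 0"
    and O: "open \<Omega>" "bounded \<Omega>" using assms by (auto simp: bounded_smooth_domain_def)
  have Ck: "Ck k UNIV \<rho>" for k using \<rho>(1) by (simp add: smooth_on_def)
  have c: "continuous_on UNIV \<rho>" "continuous_on UNIV (pd i \<rho>)" "continuous_on UNIV (pd i (pd j \<rho>))" for i j
    using Ck[of 2] by (auto simp: numeral_2_eq_2)
  have cg: "continuous_on UNIV (\<lambda>x. norm (grad \<rho> x))"
    unfolding grad_def using c(2) by (intro continuous_intros continuous_on_vec_lambda)
  have fr0: "\<rho> y = 0" if "y \<in> frontier \<Omega>" for y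
  proof -
    have "closed {x. \<rho> x \<le> 0}" using c(1) by (intro closed_Collect_le) auto
    hence "closure \<Omega> \<subseteq> {x. \<rho> x \<le> 0}" by (intro closure_minimal) (auto simp: \<rho>(2))
    hence "\<rho> y \<le> 0" using that by (auto simp: frontier_def)
    moreover have "y \<notin> \<Omega>" using that O by (simp add: frontier_def interior_open)
    ultimately show ?thesis by (simp add: \<rho>(2))
  qed
  obtain M where M: "\<Omega> \<subseteq> cball 0 M" using bounded_subset_ballD[OF O(2), of 0] ball_subset_cball by blast
  have frM: "frontier \<Omega> \<subseteq> cball 0 M" using closure_minimal[OF M] by (auto simp: frontier_def)
  define B where "B = cball (0::real^'n) (M + 1)"
  have "\<exists>L. \<forall>z\<in>B. \<bar>pd i (pd j \<rho>) z\<bar> \<le> L" for i j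
  proof -
    have "bounded (pd i (pd j \<rho>) ` B)" unfolding B_def
      by (intro compact_imp_bounded compact_continuous_image continuous_on_subset[OF c(3)]) auto
    thus ?thesis by (auto simp: bounded_iff)
  qed
  then obtain Lf where Lf: "\<And>i j z. z \<in> B \<Longrightarrow> \<bar>pd i (pd j \<rho>) z\<bar> \<le> Lf i j" by metis
  define L where "L = Max (range (\<lambda>(i, j). \<bar>Lf i j\<bar>))"
  have L: "\<bar>pd i (pd j \<rho>) z\<bar> \<le> L" if "z \<in> B" for i j z
  proof -
    have "\<bar>Lf i j\<bar> \<in> range (\<lambda>(i, j). \<bar>Lf i j\<bar>)" by (rule range_eqI[of _ _ "(i, j)"]) simp
    hence "\<bar>Lf i j\<bar> \<le> L" unfolding L_def by (intro Max_ge) auto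
    thus ?thesis using Lf[OF that, of i j] by linarith
  qed
  define Q where "Q = \<bar>L * (real CARD('n))\<^sup>2\<bar> + 1"
  have taylor: "\<bar>\<rho> (y + h) - grad \<rho> y \<bullet> h\<bar> \<le> Q * (norm h)\<^sup>2" if "y \<in> frontier \<Omega>" "norm h \<le> 1" for y h
  proof -
    have y: "norm y \<le> M" using that(1) frM by auto
    have "norm (y + h) \<le> M + 1" using norm_triangle_ineq[of y h] y that(2) by linarith
    hence "\<bar>\<rho> (y + h) - \<rho> y - grad \<rho> y \<bullet> h\<bar> \<le> L * (real CARD('n))\<^sup>2 * (norm h)\<^sup>2"
      using y by (intro second_order_taylor_bound[OF Ck open_UNIV, of B]) (auto simp: B_def intro!: L)
    also have "\<dots> \<le> Q * (norm h)\<^sup>2" unfolding Q_def by (intro mult_right_mono) auto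
    finally show ?thesis using fr0[OF that(1)] by simp
  qed
  have g0: "grad \<rho> y \<noteq> 0" if y: "y \<in> frontier \<Omega>" for y
    using \<rho>(3)[OF fr0[OF y]] by (auto simp: grad_def vec_eq_iff)
  obtain m where m: "0 < m" "\<And>y. y \<in> frontier \<Omega> \<Longrightarrow> m \<le> norm (grad \<rho> y)"
  proof (cases "frontier \<Omega> = {}")
    case True thus ?thesis using that[of 1] by auto
  next
    case False
    have "compact (frontier \<Omega>)" using O by (simp add: compact_frontier_bounded)
    then obtain y where "y \<in> frontier \<Omega>" "\<And>z. z \<in> frontier \<Omega> \<Longrightarrow> norm (grad \<rho> y) \<le> norm (grad \<rho> z)"
      using continuous_attains_inf[of "frontier \<Omega>"] False continuous_on_subset[OF cg] by blast
    thus ?thesis using that[of "norm (grad \<rho> y)"] g0 by auto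
  qed
  have Q1: "Q > 0" by (simp add: Q_def)
  define r where "r = min (1/2) (m / (2 * Q))"
  have r: "0 < r" "2 * r \<le> 1" "2 * r * Q \<le> m"
    using m Q1 by (auto simp: r_def min_le_iff_disj) (simp add: min_def field_simps)
  show ?thesis
  proof (rule that[OF r(1)])
    fix y assume y: "y \<in> frontier \<Omega>"
    define G where "G = norm (grad \<rho> y)"
    have G: "G > 0" "m \<le> G" using g0[OF y] m(2)[OF y] by (auto simp: G_def)
    define \<nu> where "\<nu> = (1 / G) *\<^sub>R grad \<rho> y"
    have n: "norm \<nu> = 1" using G by (simp add: \<nu>_def G_def)
    have gn: "grad \<rho> y = G *\<^sub>R \<nu>" using G by (simp add: \<nu>_def)
    \<comment> \<open>Both tangent balls at once: \<open>s\<close> is 1 for the exterior and -1 for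
      the interior one.\<close>
    have key: "\<bar>\<rho> (y + h) - G * (\<nu> \<bullet> h)\<bar> < G * (s * (\<nu> \<bullet> h))"
      if s: "s * s = 1" and h: "norm (h - (s * r) *\<^sub>R \<nu>) < r" for h s
    proof -
      have sa: "\<bar>s\<bar> = 1" using s by (metis abs_mult_self_eq abs_one power2_eq_iff_nonneg abs_ge_zero power2_eq_square zero_le_one mult_1)
      have "(norm (h - (s * r) *\<^sub>R \<nu>))\<^sup>2 < r\<^sup>2" using h r by (intro power_strict_mono) auto
      moreover have "(norm (h - (s * r) *\<^sub>R \<nu>))\<^sup>2 = (norm h)\<^sup>2 - 2 * r * (s * (\<nu> \<bullet> h)) + (s * s) * r\<^sup>2 * (norm \<nu>)\<^sup>2"
        unfolding power2_norm_eq_inner by (simp add: inner_diff_left inner_diff_right inner_commute power2_eq_square algebra_simps)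
      ultimately have hn: "(norm h)\<^sup>2 < 2 * r * (s * (\<nu> \<bullet> h))" using s n by simp
      have "norm h \<le> norm (h - (s * r) *\<^sub>R \<nu>) + norm ((s * r) *\<^sub>R \<nu>)"
        using norm_triangle_ineq[of "h - (s * r) *\<^sub>R \<nu>" "(s * r) *\<^sub>R \<nu>"] by simp
      hence h1: "norm h \<le> 1" using h r n sa by (simp add: abs_mult)
      have "\<bar>\<rho> (y + h) - G * (\<nu> \<bullet> h)\<bar> \<le> Q * (norm h)\<^sup>2" using taylor[OF y h1] by (simp add: gn)
      also have "\<dots> < Q * (2 * r * (s * (\<nu> \<bullet> h)))" using hn Q1 by simp
      also have "\<dots> = (2 * r * Q) * (s * (\<nu> \<bullet> h))" by simp
      also have "\<dots> \<le> G * (s * (\<nu> \<bullet> h))"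
      proof (rule mult_right_mono)
        have "0 < 2 * r * (s * (\<nu> \<bullet> h))" using hn zero_le_power2[of "norm h"] by linarith
        moreover have "0 < 2 * r" using r by simp
        ultimately show "0 \<le> s * (\<nu> \<bullet> h)" by (rule less_imp_le[OF zero_less_mult_pos])
      qed (use r G in linarith)
      finally show ?thesis .
    qed
    have "z \<notin> \<Omega>" if "z \<in> ball (y + r *\<^sub>R \<nu>) r" for z
    proof -
      have "norm ((z - y) - (1 * r) *\<^sub>R \<nu>) < r" using that by (simp add: dist_norm norm_minus_commute algebra_simps)
      from key[OF _ this] have "0 < \<rho> z" by (simp add: algebra_simps)
      thus ?thesis by (simp add: \<rho>(2))
    qed
    moreover have "z \<in> \<Omega>" if "z \<in> ball (y - r *\<^sub>R \<nu>) r" for z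
    proof -
      have "norm ((z - y) - (-1 * r) *\<^sub>R \<nu>) < r" using that by (simp add: dist_norm norm_minus_commute algebra_simps)
      from key[OF _ this] have "\<rho> z < 0" by (simp add: algebra_simps)
      thus ?thesis by (simp add: \<rho>(2))
    qed
    ultimately show "\<exists>\<nu>. norm \<nu> = 1 \<and> ball (y + r *\<^sub>R \<nu>) r \<inter> \<Omega> = {} \<and> ball (y - r *\<^sub>R \<nu>) r \<subseteq> \<Omega>"
      using n by blast
  qed
qed

text \<open>The ball about x inside \<Omega> and the exterior ball are disjoint, so their centres
  are at distance at least \<delta> + r, the length of the path through y. Equality in the triangle
  inequality puts y on the segment between them.\<close>

lemma nearest_frontier_normal:
  fixes x :: "real^'n::finite"
  assumes x: "x \<in> \<Omega>" and r: "0 < r" and n: "norm \<nu> = 1" and e: "ball (y + r *\<^sub>R \<nu>) r \<inter> \<Omega> = {}"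
    and b: "ball x \<delta> \<subseteq> \<Omega>" and d: "\<delta> = dist x y" "0 < \<delta>"
  shows "x = y - \<delta> *\<^sub>R \<nu>"
proof -
  define c where "c = y + r *\<^sub>R \<nu>"
  have "\<delta> + r \<le> norm (x - c)"
  proof (rule ccontr)
    assume lt: "\<not> \<delta> + r \<le> norm (x - c)"
    \<comment> \<open>Divides the segment from \<open>c\<close> to \<open>x\<close> in the ratio r
      to \<delta>; were the centres closer, it would lie in both balls.\<close>
    define p where "p = c + (r / (\<delta> + r)) *\<^sub>R (x - c)"
    have s: "\<delta> + r > 0" by (rule add_pos_pos[OF d(2) r])
    have "dist c p = r / (\<delta> + r) * norm (x - c)" using r s by (simp add: p_def dist_norm)
    also have "\<dots> < r" using mult_strict_left_mono[of "norm (x - c)" "\<delta> + r" r] lt s r by (simp add: pos_divide_less_eq)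
    finally have "p \<notin> \<Omega>" using e by (auto simp: c_def)
    have "x - p = (\<delta> / (\<delta> + r)) *\<^sub>R (x - c)"
    proof -
      have "1 - r / (\<delta> + r) = \<delta> / (\<delta> + r)" using s by (simp add: field_simps)
      moreover have "x - p = (1 - r / (\<delta> + r)) *\<^sub>R (x - c)" by (simp add: p_def algebra_simps)
      ultimately show ?thesis by simp
    qed
    hence "dist x p = \<delta> / (\<delta> + r) * norm (x - c)" using d(2) s by (simp add: dist_norm)
    also have "\<dots> < \<delta>"
      using mult_strict_left_mono[of "norm (x - c)" "\<delta> + r" \<delta>] lt s d(2) by (simp add: pos_divide_less_eq)
    finally show False using b \<open>p \<notin> \<Omega>\<close> by auto
  qed
  moreover have xc: "x - c = (x - y) + (- r *\<^sub>R \<nu>)" by (simp add: c_def)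
  moreover have n1: "norm (x - y) = \<delta>" "norm (- r *\<^sub>R \<nu>) = r" using d n r by (auto simp: dist_norm)
  ultimately have "norm ((x - y) + (- r *\<^sub>R \<nu>)) = norm (x - y) + norm (- r *\<^sub>R \<nu>)"
    using norm_triangle_ineq[of "x - y" "- r *\<^sub>R \<nu>"] by simp
  hence "norm (x - y) *\<^sub>R (- r *\<^sub>R \<nu>) = norm (- r *\<^sub>R \<nu>) *\<^sub>R (x - y)" by (simp only: norm_triangle_eq)
  hence "\<delta> *\<^sub>R (- r *\<^sub>R \<nu>) = r *\<^sub>R (x - y)" by (simp only: n1)
  hence "r *\<^sub>R (x - y) = r *\<^sub>R (- \<delta> *\<^sub>R \<nu>)" by (simp add: mult.commute)
  hence "x - y = - \<delta> *\<^sub>R \<nu>" by (rule scaleR_left_imp_eq[rotated]) (use r in simp)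
  thus ?thesis by (simp add: algebra_simps)
qed

context curvature_function
begin

text \<open>The barriers are equidistant caps over interior and exterior tangent balls; both leave the
  boundary with the slope of an equidistant surface of curvature \<open>\<sigma>\<close>.\<close>

lemma boundary_ratio:
  fixes u v :: "real^'n \<Rightarrow> real"
  assumes D: "bounded_smooth_domain \<Omega>" and su: "solution \<Omega> 0 u" and sv: "solution \<Omega> 0 v" and \<eta>: "0 < \<eta>"
  shows "\<exists>K. compact K \<and> K \<subseteq> \<Omega> \<and> (\<forall>x\<in>\<Omega> - K. u x \<le> (1 + \<eta>) * v x)"
proof -
  have O: "open \<Omega>" "bounded \<Omega>" "\<Omega> \<noteq> {}" using D by (auto simp: bounded_smooth_domain_def)
  obtain r where r: "0 < r" "\<And>y. y \<in> frontier \<Omega> \<Longrightarrow>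
    \<exists>\<nu>. norm \<nu> = 1 \<and> ball (y + r *\<^sub>R \<nu>) r \<inter> \<Omega> = {} \<and> ball (y - r *\<^sub>R \<nu>) r \<subseteq> \<Omega>"
    using uniform_sphere_condition[OF D] by blast
  have F: "compact (frontier \<Omega>)" "frontier \<Omega> \<noteq> {}"
    using O by (auto simp: compact_frontier_bounded frontier_eq_empty)
  \<comment> \<open>Relative error allowed in each barrier: \<open>8 * \<theta> \<le> \<eta>\<close>
    and \<open>\<theta> \<le> 1\<close> give (2 + \<theta>)^2 \<le> (1 + \<eta>) (2 - \<theta>)^2,
    as the final estimate needs.\<close>
  define \<theta> where "\<theta> = min 1 (\<eta> / 8)"
  have \<theta>: "0 < \<theta>" "\<theta> \<le> 1" "8 * \<theta> \<le> \<eta>" using \<eta> by (auto simp: \<theta>_def)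
  define T where "T = \<sigma>sinh"
  have T: "0 < T" using \<sigma>sinh(1) by (simp add: T_def)
  \<comment> \<open>Below this height the quadratic terms \<open>(u x)\<^sup>2\<close> and
    \<open>(v x)\<^sup>2\<close> of the barriers are at most \<theta> r T times u x and v x.\<close>
  define h where "h = \<theta> * (r * T)"
  have h: "h > 0" using \<theta> r T by (simp add: h_def)
  define K where "K = {x \<in> closure \<Omega>. \<theta> * r \<le> infdist x (frontier \<Omega>)} \<union> {x \<in> closure \<Omega>. h \<le> u x} \<union> {x \<in> closure \<Omega>. h \<le> v x}"
  have cO: "compact (closure \<Omega>)" using O by (simp add: compact_closure)
  have "closed K" unfolding K_def
    by (intro closed_Un continuous_on_closed_Collect_le continuous_intros solutionD(2)[OF su] solutionD(2)[OF sv]) auto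
  hence "compact (closure \<Omega> \<inter> K)" by (rule compact_Int_closed[OF cO])
  moreover have "closure \<Omega> \<inter> K = K" by (auto simp: K_def)
  ultimately have cK: "compact K" by simp
  have KO: "K \<subseteq> \<Omega>"
  proof
    fix x assume x: "x \<in> K"
    show "x \<in> \<Omega>"
    proof (rule ccontr)
      assume "x \<notin> \<Omega>"
      hence "x \<in> frontier \<Omega>" using x O(1) by (auto simp: K_def frontier_def interior_open)
      hence "u x = 0" "v x = 0" "infdist x (frontier \<Omega>) = 0"
        using solutionD(3)[OF su] solutionD(3)[OF sv] by auto
      moreover have "0 < \<theta> * r" using \<theta> r by simp
      ultimately show False using x h by (auto simp: K_def)
    qed
  qed
  have "u x \<le> (1 + \<eta>) * v x" if x: "x \<in> \<Omega> - K" for x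
  proof -
    have xO: "x \<in> \<Omega>" using x by simp
    have ux: "0 < u x" "u x < h" and vx: "0 < v x" "v x < h"
      using x solutionD(4)[OF su xO] solutionD(4)[OF sv xO] closure_subset by (auto simp: K_def not_le)
    obtain y where y: "y \<in> frontier \<Omega>" "infdist x (frontier \<Omega>) = dist x y"
      using infdist_attains_inf[OF compact_imp_closed[OF F(1)] F(2)] by blast
    define \<delta> where "\<delta> = dist x y"
    have d1: "\<delta> < \<theta> * r" using x y closure_subset by (auto simp: K_def \<delta>_def not_le)
    have "x \<noteq> y" using xO y(1) O(1) by (auto simp: frontier_def interior_open)
    hence d0: "0 < \<delta>" by (simp add: \<delta>_def)
    have b: "ball x \<delta> \<subseteq> \<Omega>"
    proof (rule ccontr)
      assume "\<not> ball x \<delta> \<subseteq> \<Omega>"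
      hence "ball x \<delta> - \<Omega> \<noteq> {}" by blast
      moreover have "x \<in> ball x \<delta> \<inter> \<Omega>" using xO d0 by simp
      hence "ball x \<delta> \<inter> \<Omega> \<noteq> {}" by blast
      ultimately obtain z where "z \<in> ball x \<delta>" "z \<in> frontier \<Omega>"
        using connected_Int_frontier[of "ball x \<delta>" \<Omega>] by auto
      thus False using infdist_le[of z "frontier \<Omega>" x] y by (simp add: \<delta>_def)
    qed
    obtain \<nu> where \<nu>: "norm \<nu> = 1" "ball (y + r *\<^sub>R \<nu>) r \<inter> \<Omega> = {}" "ball (y - r *\<^sub>R \<nu>) r \<subseteq> \<Omega>"
      using r(2)[OF y(1)] by blast
    have xy: "x = y - \<delta> *\<^sub>R \<nu>" by (rule nearest_frontier_normal[OF xO r(1) \<nu>(1,2) b \<delta>_def d0])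
    have dr: "\<delta> < r" using d1 \<theta> r by (smt (verit) mult_left_le_one_le)
    have ni: "norm (x - (y - r *\<^sub>R \<nu>)) = r - \<delta>"
    proof -
      have "x - (y - r *\<^sub>R \<nu>) = (r - \<delta>) *\<^sub>R \<nu>" by (simp add: xy algebra_simps)
      thus ?thesis using \<nu> dr by simp
    qed
    have ne: "norm (x - (y + r *\<^sub>R \<nu>)) = r + \<delta>"
    proof -
      have "x - (y + r *\<^sub>R \<nu>) = (- (r + \<delta>)) *\<^sub>R \<nu>" by (simp add: xy algebra_simps)
      thus ?thesis using \<nu> d0 r by simp
    qed
    \<comment> \<open>The barriers require closed balls inside \<Omega> and a gap outside, so they
      are applied with radius t < r, and t tends to r.\<close>
    have lim: "((\<lambda>t. a + b * t\<^sup>2 + c * t) \<longlongrightarrow> a + b * r\<^sup>2 + c * r) (at_left r)" for a b c :: real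
      by (intro tendsto_intros)
    have ev: "\<forall>\<^sub>F t in at_left r. r - \<delta> < t \<and> t < r"
      using eventually_at_left_real[of "r - \<delta>" r] d0 by (auto elim: eventually_mono)
    have inn: "2 * r * \<delta> - \<delta>\<^sup>2 \<le> (v x)\<^sup>2 + 2 * v x * r * T"
    proof -
      have "- (r - \<delta>)\<^sup>2 - (v x)\<^sup>2 + 1 * r\<^sup>2 + (- 2 * v x * T) * r \<le> 0"
      proof (rule tendsto_upperbound[OF lim[of "- (r - \<delta>)\<^sup>2 - (v x)\<^sup>2" 1 "- 2 * v x * T"]])
        show "\<forall>\<^sub>F t in at_left r. - (r - \<delta>)\<^sup>2 - (v x)\<^sup>2 + 1 * t\<^sup>2 + (- 2 * v x * T) * t \<le> 0"
        proof (rule eventually_mono[OF ev])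
          fix t assume t: "r - \<delta> < t \<and> t < r"
          have "cball (y - r *\<^sub>R \<nu>) t \<subseteq> ball (y - r *\<^sub>R \<nu>) r" using t by auto
          hence "cball (y - r *\<^sub>R \<nu>) t \<subseteq> \<Omega>" using \<nu>(3) by (rule order_trans)
          moreover have "x \<in> cball (y - r *\<^sub>R \<nu>) t" using ni t by (simp add: dist_norm norm_minus_commute)
          ultimately have "t\<^sup>2 - (r - \<delta>)\<^sup>2 - (v x)\<^sup>2 \<le> 2 * v x * t * \<sigma>sinh"
            using interior_cap[OF O(1) sv, of t "y - r *\<^sub>R \<nu>" x] t dr ni by simp
          thus "- (r - \<delta>)\<^sup>2 - (v x)\<^sup>2 + 1 * t\<^sup>2 + (- 2 * v x * T) * t \<le> 0" by (simp add: T_def mult_ac)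
        qed
      qed simp
      thus ?thesis by (simp add: power2_diff mult_ac)
    qed
    have out: "2 * u x * r * T \<le> 2 * r * \<delta> + \<delta>\<^sup>2 + (u x)\<^sup>2"
    proof -
      have "0 \<le> (r + \<delta>)\<^sup>2 + (u x)\<^sup>2 + (-1) * r\<^sup>2 + (- 2 * u x * T) * r"
      proof (rule tendsto_lowerbound[OF lim[of "(r + \<delta>)\<^sup>2 + (u x)\<^sup>2" "-1" "- 2 * u x * T"]])
        show "\<forall>\<^sub>F t in at_left r. 0 \<le> (r + \<delta>)\<^sup>2 + (u x)\<^sup>2 + (-1) * t\<^sup>2 + (- 2 * u x * T) * t"
        proof (rule eventually_mono[OF ev])
          fix t assume t: "r - \<delta> < t \<and> t < r"
          have t0: "0 < t" using t dr by linarith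
          have "t\<^sup>2 + (r\<^sup>2 - t\<^sup>2) \<le> (norm (z - (y + r *\<^sub>R \<nu>)))\<^sup>2" if "z \<in> \<Omega>" for z
          proof -
            have "z \<notin> ball (y + r *\<^sub>R \<nu>) r" using \<nu>(2) that by blast
            hence "r \<le> norm (z - (y + r *\<^sub>R \<nu>))"
              using norm_minus_commute[of z "y + r *\<^sub>R \<nu>"] by (simp add: dist_norm not_less)
            thus ?thesis using r(1) by (simp add: power_mono)
          qed
          moreover have "0 < r\<^sup>2 - t\<^sup>2" using t t0 by (simp add: power_strict_mono)
          ultimately have "2 * u x * t * \<sigma>sinh \<le> (r + \<delta>)\<^sup>2 - t\<^sup>2 + (u x)\<^sup>2"
            using exterior_cap_aux[OF O(1,2) su t0, of "r\<^sup>2 - t\<^sup>2" "y + r *\<^sub>R \<nu>" x] xO ne by simp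
          thus "0 \<le> (r + \<delta>)\<^sup>2 + (u x)\<^sup>2 + (-1) * t\<^sup>2 + (- 2 * u x * T) * t" by (simp add: T_def mult_ac)
        qed
      qed simp
      thus ?thesis by (simp add: power2_sum mult_ac)
    qed
    have rT: "r * T > 0" using r T by simp
    have v1: "\<delta> * (2 - \<theta>) \<le> v x * (T * (2 + \<theta>))"
    proof -
      have "r * (\<delta> * (2 - \<theta>)) = 2 * r * \<delta> - \<delta> * (\<theta> * r)" by (simp add: algebra_simps)
      also have "\<dots> \<le> 2 * r * \<delta> - \<delta>\<^sup>2" using d0 d1 by (simp add: power2_eq_square)
      also have "\<dots> \<le> (v x)\<^sup>2 + 2 * v x * r * T" by (rule inn)
      also have "\<dots> \<le> v x * h + 2 * v x * r * T" using vx by (simp add: power2_eq_square)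
      also have "\<dots> = r * (v x * (T * (2 + \<theta>)))" by (simp add: h_def algebra_simps)
      finally show ?thesis using r by simp
    qed
    have u1: "u x * (T * (2 - \<theta>)) \<le> \<delta> * (2 + \<theta>)"
    proof -
      have "r * (u x * (T * (2 - \<theta>))) = 2 * u x * r * T - u x * h" by (simp add: h_def algebra_simps)
      also have "\<dots> \<le> 2 * u x * r * T - (u x)\<^sup>2" using ux by (simp add: power2_eq_square)
      also have "\<dots> \<le> 2 * r * \<delta> + \<delta>\<^sup>2" using out by simp
      also have "\<dots> \<le> 2 * r * \<delta> + \<delta> * (\<theta> * r)" using d0 d1 by (simp add: power2_eq_square)
      also have "\<dots> = r * (\<delta> * (2 + \<theta>))" by (simp add: algebra_simps)
      finally show ?thesis using r by simp
    qed
    have "T * (u x * (2 - \<theta>)\<^sup>2) = (u x * (T * (2 - \<theta>))) * (2 - \<theta>)" by (simp add: power2_eq_square)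
    also have "\<dots> \<le> (\<delta> * (2 + \<theta>)) * (2 - \<theta>)" using u1 \<theta> by (intro mult_right_mono) auto
    also have "\<dots> = (\<delta> * (2 - \<theta>)) * (2 + \<theta>)" by simp
    also have "\<dots> \<le> (v x * (T * (2 + \<theta>))) * (2 + \<theta>)" using v1 \<theta> by (intro mult_right_mono) auto
    also have "\<dots> = T * (v x * (2 + \<theta>)\<^sup>2)" by (simp add: power2_eq_square)
    finally have "u x * (2 - \<theta>)\<^sup>2 \<le> v x * (2 + \<theta>)\<^sup>2" using T by simp
    also have "\<dots> \<le> v x * ((1 + \<eta>) * (2 - \<theta>)\<^sup>2)"
    proof (rule mult_left_mono)
      have "1 \<le> (2 - \<theta>)\<^sup>2" using \<theta> by (intro one_le_power) simp
      hence "8 * \<theta> * 1 \<le> \<eta> * (2 - \<theta>)\<^sup>2" using \<theta> \<eta> by (intro mult_mono) auto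
      moreover have "(2 + \<theta>)\<^sup>2 = (2 - \<theta>)\<^sup>2 + 8 * \<theta>" by (simp add: power2_eq_square algebra_simps)
      ultimately show "(2 + \<theta>)\<^sup>2 \<le> (1 + \<eta>) * (2 - \<theta>)\<^sup>2" by (simp add: distrib_right)
    qed (use vx in simp)
    also have "\<dots> = ((1 + \<eta>) * v x) * (2 - \<theta>)\<^sup>2" by simp
    finally show ?thesis using \<theta> by (simp add: mult_le_cancel_right)
  qed
  thus ?thesis using cK KO by blast
qed

end

section \<open>Comparison of solutions\<close>

text \<open>The quotient is cosh of the hyperbolic distance of two points at heights r and s and
  horizontal distance n.\<close>

lemma cosh_ge_1:
  fixes n r s :: real
  assumes "0 < r" "0 < s"
  shows "1 \<le> (n\<^sup>2 + r\<^sup>2 + s\<^sup>2) / (2 * r * s)"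
proof -
  have "0 \<le> (r - s)\<^sup>2" "0 \<le> n\<^sup>2" by simp_all
  hence "2 * r * s \<le> n\<^sup>2 + r\<^sup>2 + s\<^sup>2" unfolding power2_diff by linarith
  thus ?thesis using assms by simp
qed

context curvature_function
begin

text \<open>The region above the graph is not compact, but its points no farther than (x, u x) are:
  a bounded distance bounds the horizontal displacement and keeps the height between two positive
  numbers.\<close>

lemma ex_nearest_point:
  fixes x :: "real^'n" and r :: real
  assumes O: "open \<Omega>" and s: "solution \<Omega> \<epsilon> u" and x: "x \<in> \<Omega>" and r: "0 < r"
  shows "\<exists>y t. extend \<Omega> \<epsilon> u y \<le> t \<and> 0 < t \<and> (\<forall>y' t'. extend \<Omega> \<epsilon> u y' \<le> t' \<longrightarrow> 0 < t' \<longrightarrow>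
    ((norm (x - y))\<^sup>2 + r\<^sup>2 + t\<^sup>2) / (2 * r * t) \<le> ((norm (x - y'))\<^sup>2 + r\<^sup>2 + t'\<^sup>2) / (2 * r * t'))"
proof -
  define F where "F p = ((norm (x - fst p))\<^sup>2 + r\<^sup>2 + (snd p)\<^sup>2) / (2 * r * snd p)" for p :: "(real^'n) \<times> real"
  define c where "c = F (x, u x)"
  have ux: "u x > 0" by (rule solutionD(4)[OF s x])
  have c1: "1 \<le> c" unfolding c_def F_def using cosh_ge_1[OF r ux, of 0] by simp
  \<comment> \<open>Read off from r^2 \<le> 2 r t c and t^2 \<le> 2 r t c, both consequences of
    \<open>F (y, t) \<le> c\<close>.\<close>
  define a b where "a = r / (2 * c)" and "b = 2 * r * c"
  have a0: "0 < a" using r c1 by (simp add: a_def)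
  define Q where "Q = {p \<in> cball x (sqrt (2 * r * b * c)) \<times> {a..b}. extend \<Omega> \<epsilon> u (fst p) \<le> snd p}"
  have inQ: "(y, t) \<in> Q" if "extend \<Omega> \<epsilon> u y \<le> t" "0 < t" "F (y, t) \<le> c" for y t
  proof -
    have le: "(norm (x - y))\<^sup>2 + r\<^sup>2 + t\<^sup>2 \<le> 2 * r * t * c"
      using that(2,3) r by (simp add: F_def pos_divide_le_eq mult_ac)
    have sq: "0 \<le> (norm (x - y))\<^sup>2" "0 < r\<^sup>2" "0 < t\<^sup>2" using r that(2) by auto
    have "t\<^sup>2 \<le> 2 * r * t * c" "r\<^sup>2 \<le> 2 * r * t * c" using le sq by linarith+
    hence "t * t \<le> (2 * r * c) * t" "r * r \<le> (2 * c * t) * r" by (simp_all add: power2_eq_square mult_ac)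
    hence tb: "t \<le> b" using that(2) by (simp add: b_def)
    have "r \<le> 2 * c * t" using \<open>r * r \<le> (2 * c * t) * r\<close> r by simp
    hence ta: "a \<le> t" using c1 by (simp add: a_def pos_divide_le_eq mult_ac)
    have "2 * r * t * c \<le> 2 * r * b * c" using tb r c1 by simp
    hence "(norm (x - y))\<^sup>2 \<le> 2 * r * b * c" using le sq by linarith
    hence "norm (x - y) \<le> sqrt (2 * r * b * c)" by (rule real_le_rsqrt)
    thus ?thesis using that(1) ta tb by (simp add: Q_def dist_norm)
  qed
  have c: "compact (cball x (sqrt (2 * r * b * c)) \<times> {a..b})" by (intro compact_Times) auto
  have "closed Q"
    unfolding Q_def
    by (intro continuous_on_closed_Collect_le continuous_on_compose2[OF extend_continuous[OF O s]] continuous_intros)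
       (auto intro: compact_imp_closed[OF c])
  hence "compact ((cball x (sqrt (2 * r * b * c)) \<times> {a..b}) \<inter> Q)" by (rule compact_Int_closed[OF c])
  moreover have "(cball x (sqrt (2 * r * b * c)) \<times> {a..b}) \<inter> Q = Q" by (auto simp: Q_def)
  ultimately have "compact Q" by simp
  moreover have "continuous_on Q F"
    unfolding F_def using a0 r by (intro continuous_intros) (auto simp: Q_def)
  moreover have xQ: "(x, u x) \<in> Q" by (rule inQ) (use x ux in \<open>auto simp: extend_def c_def\<close>)
  ultimately obtain p where p: "p \<in> Q" "\<And>q. q \<in> Q \<Longrightarrow> F p \<le> F q"
    using continuous_attains_inf[of Q F] by blast
  have "F p \<le> F (y, t)" if "extend \<Omega> \<epsilon> u y \<le> t" "0 < t" for y t
  proof (cases "F (y, t) \<le> c")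
    case True thus ?thesis using inQ[OF that True] p(2) by blast
  next
    case False thus ?thesis using p(2)[OF xQ] by (simp add: c_def)
  qed
  moreover have "extend \<Omega> \<epsilon> u (fst p) \<le> snd p" "0 < snd p" using p(1) a0 by (auto simp: Q_def)
  ultimately show ?thesis by (intro exI[of _ "fst p"] exI[of _ "snd p"]) (auto simp: F_def)
qed

text \<open>\<open>bd\<close> is a bound on a ratio because the hyperbolic distance of (x, u x) and
  (x, v x) depends on u x / v x only. It makes the distance to the region small near the boundary,
  so the maximum can be sought on a compact set.\<close>

lemma comparison:
  fixes u v :: "real^'n \<Rightarrow> real"
  assumes O: "open \<Omega>" "bounded \<Omega>" and eps: "0 \<le> \<epsilon>" and su: "solution \<Omega> \<epsilon> u" and sv: "solution \<Omega> \<epsilon> v"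
    and bd: "\<And>\<eta>. 0 < \<eta> \<Longrightarrow> \<exists>K. compact K \<and> K \<subseteq> \<Omega> \<and> (\<forall>x\<in>\<Omega> - K. u x \<le> (1 + \<eta>) * v x)"
    and x1: "x1 \<in> \<Omega>"
  shows "u x1 \<le> v x1"
proof (rule ccontr)
  assume "\<not> u x1 \<le> v x1"
  hence uv1: "v x1 < u x1" by simp
  have u0: "u x > 0" and v0: "v x > 0" if "x \<in> \<Omega>" for x
    using solutionD(4)[OF su that] solutionD(4)[OF sv that] by auto
  have geu: "\<epsilon> \<le> u x" and gev: "\<epsilon> \<le> v x" if "x \<in> \<Omega>" for x
    using minimum_principle[OF O su that] minimum_principle[OF O sv that] by auto
  define F where "F x y t = ((norm (x - y))\<^sup>2 + (v x)\<^sup>2 + t\<^sup>2) / (2 * v x * t)" for x y t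
  have "\<exists>y t. extend \<Omega> \<epsilon> u y \<le> t \<and> 0 < t \<and> (\<forall>y' t'. extend \<Omega> \<epsilon> u y' \<le> t' \<longrightarrow> 0 < t' \<longrightarrow> F x y t \<le> F x y' t')"
    if "x \<in> \<Omega>" for x
    unfolding F_def by (rule ex_nearest_point[OF O(1) su that v0[OF that]])
  then obtain Y S where YS: "\<And>x. x \<in> \<Omega> \<Longrightarrow> extend \<Omega> \<epsilon> u (Y x) \<le> S x" "\<And>x. x \<in> \<Omega> \<Longrightarrow> 0 < S x"
    "\<And>x y t. x \<in> \<Omega> \<Longrightarrow> extend \<Omega> \<epsilon> u y \<le> t \<Longrightarrow> 0 < t \<Longrightarrow> F x (Y x) (S x) \<le> F x y t" by metis
  define m where "m x = F x (Y x) (S x)" for x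
  have m1: "1 \<le> m x" if "x \<in> \<Omega>" for x
    unfolding m_def F_def by (rule cosh_ge_1[OF v0[OF that] YS(2)[OF that]])
  have mF: "m x \<le> F x y t" if "x \<in> \<Omega>" "extend \<Omega> \<epsilon> u y \<le> t" "0 < t" for x y t
    unfolding m_def using YS(3) that by blast
  have mu: "m x \<le> F x x (u x)" if "x \<in> \<Omega>" for x
    using that u0[OF that] by (intro mF) (auto simp: extend_def)
  have mle1: "m x \<le> 1" if "x \<in> \<Omega>" "u x \<le> v x" for x
  proof -
    have "m x \<le> F x x (v x)" using that v0 by (intro mF) (auto simp: extend_def)
    also have "\<dots> = 1" using v0[OF that(1)] by (simp add: F_def power2_eq_square)
    finally show ?thesis .
  qed
  have mgt: "1 < m x1"
  proof (rule ccontr)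
    assume "\<not> 1 < m x1"
    hence "m x1 = 1" using m1[OF x1] by simp
    hence "(norm (x1 - Y x1))\<^sup>2 + (v x1)\<^sup>2 + (S x1)\<^sup>2 = 2 * v x1 * S x1"
      using v0[OF x1] YS(2)[OF x1] by (simp add: m_def F_def)
    hence "(norm (x1 - Y x1))\<^sup>2 + (v x1 - S x1)\<^sup>2 = 0" by (simp add: power2_diff)
    hence "Y x1 = x1" "S x1 = v x1" by (simp_all add: sum_power2_eq_zero_iff)
    thus False using YS(1)[OF x1] uv1 x1 by (simp add: extend_def)
  qed
  \<comment> \<open>Makes 1 + \<eta> / 2, a bound for \<open>m\<close> off \<open>K\<close> where v
    is below u, smaller than \<open>m x1\<close>.\<close>
  define \<eta> where "\<eta> = min 1 (m x1 - 1)"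
  have \<eta>: "0 < \<eta>" "\<eta> \<le> 1" "\<eta> \<le> m x1 - 1" using mgt by (auto simp: \<eta>_def)
  obtain K where K: "compact K" "K \<subseteq> \<Omega>" "\<And>x. x \<in> \<Omega> - K \<Longrightarrow> u x \<le> (1 + \<eta>) * v x"
    using bd[OF \<eta>(1)] by blast
  have out: "m x < m x1" if "x \<in> \<Omega> - K" for x
  proof (cases "u x \<le> v x")
    case True thus ?thesis using mle1[of x] that mgt by simp
  next
    case False
    have xO: "x \<in> \<Omega>" using that by simp
    have "(u x - v x)\<^sup>2 \<le> (\<eta> * v x)\<^sup>2"
      using K(3)[OF that] False by (intro power_mono) (auto simp: algebra_simps)
    also have "\<dots> \<le> \<eta> * (v x)\<^sup>2"
    proof -
      have "\<eta> * (v x)\<^sup>2 \<le> 1 * (v x)\<^sup>2" using \<eta> by (intro mult_right_mono) auto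
      hence "\<eta> * (\<eta> * (v x)\<^sup>2) \<le> \<eta> * (v x)\<^sup>2" using \<eta> by (intro mult_left_mono) auto
      thus ?thesis by (simp add: power2_eq_square mult_ac)
    qed
    also have "\<dots> \<le> \<eta> * (v x * u x)"
      using \<eta> False v0[OF xO] by (simp add: power2_eq_square)
    finally have "(v x)\<^sup>2 + (u x)\<^sup>2 \<le> (2 + \<eta>) * (v x * u x)" by (simp add: power2_diff algebra_simps)
    hence "F x x (u x) \<le> 1 + \<eta> / 2"
      using v0[OF xO] u0[OF xO] by (simp add: F_def pos_divide_le_eq algebra_simps)
    also have "\<dots> < m x1" using \<eta> by linarith
    finally show ?thesis using mu[OF xO] by linarith
  qed
  have x1K: "x1 \<in> K" using out[of x1] x1 by blast
  have cv: "continuous_on \<Omega> v" and cu: "continuous_on \<Omega> u"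
    using Ck_continuous_on[OF solutionD(1)[OF sv]] Ck_continuous_on[OF solutionD(1)[OF su]] by auto
  have "continuous_on K (\<lambda>x. F x x (u x))"
    unfolding F_def using K(2) u0 v0
    by (intro continuous_intros continuous_on_subset[OF cv] continuous_on_subset[OF cu]) force+
  then obtain x2 where x2: "\<And>x. x \<in> K \<Longrightarrow> F x x (u x) \<le> F x2 x2 (u x2)"
    using continuous_attains_sup[OF K(1), of "\<lambda>x. F x x (u x)"] x1K by blast
  have bdd: "bdd_above (m ` K)"
    by (rule bdd_aboveI2[of _ _ "F x2 x2 (u x2)"]) (use mu x2 K(2) order_trans in blast)
  \<comment> \<open>As an infimum of functions continuous in x, \<open>m\<close> is upper
    semicontinuous; a convergent maximising sequence therefore attains the supremum.\<close>
  define M where "M = Sup (m ` K)"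
  have "\<exists>x\<in>K. M - 1 / real (Suc n) < m x" for n
  proof -
    have "M - 1 / real (Suc n) < Sup (m ` K)" by (simp add: M_def)
    thus ?thesis using less_cSup_iff[of "m ` K" "M - 1 / real (Suc n)"] bdd x1K by auto
  qed
  then obtain X where X: "\<And>n. X n \<in> K" "\<And>n. M - 1 / real (Suc n) < m (X n)" by metis
  obtain x0 \<phi> where x0: "x0 \<in> K" "strict_mono \<phi>" "(X \<circ> \<phi>) \<longlonglongrightarrow> x0"
    using K(1) X(1) unfolding compact_def by metis
  have x0O: "x0 \<in> \<Omega>" using x0 K by blast
  have "M \<le> F x0 y t" if "extend \<Omega> \<epsilon> u y \<le> t" "0 < t" for y t
  proof (rule tendsto_le[OF trivial_limit_sequentially])
    have "isCont v x0" using cv O(1) x0O continuous_on_eq_continuous_at by blast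
    hence "isCont (\<lambda>x. F x y t) x0" unfolding F_def using v0[OF x0O] that(2)
      by (intro continuous_intros) auto
    thus "(\<lambda>n. F ((X \<circ> \<phi>) n) y t) \<longlonglongrightarrow> F x0 y t" using x0(3) by (rule isCont_tendsto_compose)
    have "(\<lambda>n. M - 1 / real (Suc n)) \<longlonglongrightarrow> M - 0"
      by (intro tendsto_diff tendsto_const LIMSEQ_inverse_real_of_nat[unfolded inverse_eq_divide])
    from LIMSEQ_subseq_LIMSEQ[OF this x0(2)] show "(\<lambda>n. M - 1 / real (Suc (\<phi> n))) \<longlonglongrightarrow> M"
      by (simp add: o_def)
    have "M - 1 / real (Suc (\<phi> n)) \<le> F ((X \<circ> \<phi>) n) y t" for n
      using X(2)[of "\<phi> n"] mF[OF _ that, of "X (\<phi> n)"] X(1)[of "\<phi> n"] K(2) by (force simp: o_def)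
    thus "\<forall>\<^sub>F n in sequentially. M - 1 / real (Suc (\<phi> n)) \<le> F ((X \<circ> \<phi>) n) y t" by simp
  qed
  hence "M \<le> m x0" unfolding m_def using YS(1,2)[OF x0O] by blast
  moreover have "m x \<le> M" if "x \<in> K" for x unfolding M_def using bdd that by (intro cSup_upper) auto
  ultimately have maxK: "m x \<le> m x0" if "x \<in> K" for x using that by (meson order_trans)
  have maxm: "m x \<le> m x0" if "x \<in> \<Omega>" for x
    using out[of x] maxK[of x] maxK[OF x1K] that by fastforce
  define C where "C = m x0"
  have C1: "C > 1" using maxK[OF x1K] mgt by (simp add: C_def)
  define T where "T = sqrt (C\<^sup>2 - 1)"
  have "C\<^sup>2 > 1" using C1 by simp
  hence T: "T > 0" "T\<^sup>2 = C\<^sup>2 - 1" by (auto simp: T_def)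
  have CT: "C = sqrt (1 + T\<^sup>2)" using C1 by (simp add: T(2))
  define y0 where "y0 = Y x0"
  have np: "y0 \<in> \<Omega>" "S x0 = u y0" "x0 - y0 = (u y0 - C * v x0) *\<^sub>R grad u y0" "C * v x0 < u y0"
  proof -
    have r: "\<epsilon> \<le> v x0" "0 < v x0" using gev v0 x0O by auto
    have r3: "v x0 < extend \<Omega> \<epsilon> u x0" using mle1[OF x0O] C1 x0O by (force simp: extend_def C_def)
    have K': "extend \<Omega> \<epsilon> u y0 \<le> S x0" "0 < S x0" using YS(1,2)[OF x0O] by (auto simp: y0_def)
    have Cd: "(norm (x0 - y0))\<^sup>2 + (v x0)\<^sup>2 + (S x0)\<^sup>2 = 2 * v x0 * S x0 * C"
      using r K' by (simp add: C_def m_def F_def y0_def)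
    have mn: "2 * v x0 * t * C \<le> (norm (x0 - y))\<^sup>2 + (v x0)\<^sup>2 + t\<^sup>2" if "extend \<Omega> \<epsilon> u y \<le> t" "0 < t" for y t
      using mF[OF x0O that] r that unfolding C_def F_def by (simp add: pos_le_divide_eq mult_ac)
    note n = nearest_point[OF O(1) eps su geu r r3 K' Cd less_imp_le[OF C1] mn]
    show "y0 \<in> \<Omega>" "S x0 = u y0" "x0 - y0 = (u y0 - C * v x0) *\<^sub>R grad u y0" "C * v x0 < u y0"
      using n by blast+
  qed
  have uT: "T * v x0 = (u y0 - C * v x0) * slope u y0"
  proof -
    have "(norm (x0 - y0))\<^sup>2 + (v x0)\<^sup>2 + (u y0)\<^sup>2 = 2 * v x0 * u y0 * C"
      using v0[OF x0O] u0[OF np(1)] by (simp add: C_def m_def F_def y0_def np(2)[symmetric])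
        (simp add: np(2) y0_def)
    moreover have "((u y0 - C * v x0) * slope u y0)\<^sup>2 = (u y0 - C * v x0)\<^sup>2 + (norm (x0 - y0))\<^sup>2"
      unfolding np(3) power2_norm_eq_inner power_mult_distrib slope_sq by (simp add: power2_eq_square algebra_simps)
    ultimately have "((u y0 - C * v x0) * slope u y0)\<^sup>2 = (C\<^sup>2 - 1) * (v x0)\<^sup>2"
      by (simp add: power2_diff power_mult_distrib algebra_simps)
    also have "\<dots> = (T * v x0)\<^sup>2" by (simp add: T(2) power_mult_distrib)
    finally show ?thesis
      using T(1) v0[OF x0O] np(4) slope_ge_1[of u y0] by (simp add: power2_eq_iff_nonneg)
  qed
  show False
  proof (rule no_contact[OF O(1) x0O np(1) su sv T(1) CT np(3) uT])
    fix x y assume x: "x \<in> \<Omega>" and y: "y \<in> \<Omega>"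
    define R N where "R = u y * slope u y" and "N = R\<^sup>2 - (norm (x - sphere_center u y))\<^sup>2 - (v x)\<^sup>2"
    have R: "R > 0" using u0[OF y] slope_ge_1[of u y] by (simp add: R_def)
    \<comment> \<open>The hemisphere tangent over y supports the convex region. If (x, v x) lies
      inside it, the distance to it, with sinh \<open>N / (2 * v x * R)\<close>, is at most that to
      the region, hence at most the maximal one.\<close>
    have "N \<le> 2 * T * v x * R"
    proof (cases "0 < N")
      case False
      have "0 \<le> 2 * T * v x * R" using T R v0[OF x] by simp
      thus ?thesis using False by linarith
    next
      case True
      have R2: "R\<^sup>2 = (u y)\<^sup>2 + (norm (y - sphere_center u y))\<^sup>2"
        unfolding R_def power_mult_distrib slope_sq power2_norm_eq_inner
        by (simp add: sphere_center_def power2_eq_square algebra_simps)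
      have "(u y)\<^sup>2 + y \<bullet> y + 2 * (sphere_center u y \<bullet> (Y x - y)) \<le> height \<Omega> \<epsilon> u (Y x)"
        by (rule height_support[OF O(1) eps su geu y])
      also have "\<dots> \<le> (S x)\<^sup>2 + Y x \<bullet> Y x"
        using YS(1)[OF x] extend_ge[OF O(1) eps su geu, of "Y x"] eps
        by (auto simp: height_def[OF O(1) eps su geu] intro!: power_mono)
      finally have far: "R\<^sup>2 \<le> (S x)\<^sup>2 + (norm (Y x - sphere_center u y))\<^sup>2"
        unfolding R2 power2_norm_eq_inner
        by (simp add: inner_diff_left inner_diff_right inner_commute algebra_simps)
      have "4 * (v x)\<^sup>2 * (S x)\<^sup>2 * (1 + (N / (2 * v x * R))\<^sup>2) \<le> ((norm (x - Y x))\<^sup>2 + (v x)\<^sup>2 + (S x)\<^sup>2)\<^sup>2"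
        by (rule cosh_distance_ge[OF R v0[OF x] YS(2)[OF x] N_def True far])
      also have "(norm (x - Y x))\<^sup>2 + (v x)\<^sup>2 + (S x)\<^sup>2 = 2 * v x * S x * m x"
        using v0[OF x] YS(2)[OF x] by (simp add: m_def F_def)
      also have "(2 * v x * S x * m x)\<^sup>2 = 4 * (v x)\<^sup>2 * (S x)\<^sup>2 * (m x)\<^sup>2" by (simp add: power_mult_distrib)
      finally have "1 + (N / (2 * v x * R))\<^sup>2 \<le> (m x)\<^sup>2"
        using v0[OF x] YS(2)[OF x] by (simp add: mult_le_cancel_left_pos)
      also have "\<dots> \<le> C\<^sup>2" using maxm[OF x] m1[OF x] by (intro power_mono) (auto simp: C_def)
      finally have "(N / (2 * v x * R))\<^sup>2 \<le> T\<^sup>2" using T(2) by simp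
      hence "N / (2 * v x * R) \<le> T" using T(1) by (metis less_imp_le power2_le_imp_le)
      thus ?thesis using v0[OF x] R by (simp add: pos_divide_le_eq mult_ac)
    qed
    thus "(u y * slope u y)\<^sup>2 - (norm (x - sphere_center u y))\<^sup>2 - (v x)\<^sup>2 - 2 * T * v x * (u y * slope u y) \<le> 0"
      by (simp add: N_def R_def)
  qed
qed

end

section \<open>Curvature functions\<close>

text \<open>The sign of the derivative is known only where h equals s. There h increases strictly,
  so it leaves s upwards at 0, and at a first return it would have been below s just before.\<close>

lemma stays_above:
  fixes h :: "real \<Rightarrow> real"
  assumes a: "0 < a" and d: "\<And>t. 0 \<le> t \<Longrightarrow> t \<le> a \<Longrightarrow> (h has_real_derivative h' t) (at t)"
    and pos: "\<And>t. 0 \<le> t \<Longrightarrow> t \<le> a \<Longrightarrow> h t = s \<Longrightarrow> 0 < h' t" and h0: "h 0 = s"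
  shows "s < h a"
proof (rule ccontr)
  assume ha: "\<not> s < h a"
  obtain e where e: "e > 0" "\<And>x. 0 < x \<Longrightarrow> x < e \<Longrightarrow> h 0 < h (0 + x)"
    using DERIV_pos_inc_right[OF d[of 0] pos[of 0]] h0 a by auto
  define b where "b = min (e / 2) a"
  have b: "0 < b" "b \<le> a" "b < e" using a e(1) by (auto simp: b_def)
  have hb: "s < h b" using e(2)[OF b(1,3)] h0 by simp
  have ch: "continuous_on {b..a} h"
    by (rule DERIV_continuous_on[where D=h'], rule has_field_derivative_at_within, rule d) (use b in auto)
  define Q where "Q = {t \<in> {b..a}. h t \<le> s}"
  have "closed Q" unfolding Q_def by (intro continuous_on_closed_Collect_le ch continuous_intros)
  hence "compact ({b..a} \<inter> Q)" by (rule compact_Int_closed[OF compact_Icc])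
  moreover have "{b..a} \<inter> Q = Q" by (auto simp: Q_def)
  moreover have "a \<in> Q" using ha b by (simp add: Q_def)
  ultimately obtain q where q: "q \<in> Q" "\<And>t. t \<in> Q \<Longrightarrow> q \<le> t"
    using compact_attains_inf[of Q] by auto
  have qI: "b \<le> q" "q \<le> a" "h q \<le> s" using q(1) by (auto simp: Q_def)
  have "q \<noteq> b" using hb qI by auto
  hence bq: "b < q" using qI by simp
  have hq: "h q = s"
  proof -
    have "\<exists>x\<ge>b. x \<le> q \<and> h x = s"
      by (rule IVT2') (use qI hb bq continuous_on_subset[OF ch] in auto)
    then obtain x where x: "b \<le> x" "x \<le> q" "h x = s" by blast
    hence "x \<in> Q" using qI by (simp add: Q_def)
    hence "q \<le> x" by (rule q(2))
    thus ?thesis using x by simp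
  qed
  have q0: "0 \<le> q" using bq b by simp
  obtain e' where e': "e' > 0" "\<And>x. 0 < x \<Longrightarrow> x < e' \<Longrightarrow> h (q - x) < h q"
    using DERIV_pos_inc_left[OF d[OF q0 qI(2)] pos[OF q0 qI(2) hq]] by auto
  define x where "x = min (e' / 2) (q - b)"
  have x: "0 < x" "x < e'" "b \<le> q - x" using e'(1) bq by (auto simp: x_def)
  have "q - x \<in> Q" using e'(2)[OF x(1,2)] x qI by (simp add: Q_def hq)
  thus False using q(2)[of "q - x"] x by simp
qed

text \<open>The principal curvatures \<open>x\<close> of a hypersurface evolve by \<open>x \<mapsto> parallel_curvature t x\<close> under moving it to
  hyperbolic distance \<open>artanh t\<close>.\<close>

definition parallel_curvature :: "real \<Rightarrow> real \<Rightarrow> real" where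
  "parallel_curvature t x = (x + t) / (1 + x * t)"

lemma parallel_curvature_pos: "0 < x \<Longrightarrow> 0 \<le> t \<Longrightarrow> 0 < parallel_curvature t x"
  by (simp add: parallel_curvature_def add_pos_nonneg)

lemma parallel_curvature_0: "parallel_curvature 0 x = x"
  by (simp add: parallel_curvature_def)

lemma parallel_curvature_inverse: "0 < x \<Longrightarrow> 0 \<le> t \<Longrightarrow> 1 / parallel_curvature t x = parallel_curvature t (1 / x)"
proof -
  assume x: "0 < x" "0 \<le> t"
  have "parallel_curvature t (1 / x) = (x * (1 / x + t)) / (x * (1 + 1 / x * t))" using x by (simp only: parallel_curvature_def) simp
  also have "\<dots> = (1 + x * t) / (x + t)" using x by (simp add: distrib_left)
  finally show "1 / parallel_curvature t x = parallel_curvature t (1 / x)" by (simp add: parallel_curvature_def)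
qed

text \<open>In the distance the law is \<kappa>' = 1 - \<kappa>^2; the denominator comes from
  differentiating the distance artanh t.\<close>

lemma parallel_curvature_deriv:
  assumes "0 < x" "0 \<le> t" "t < 1"
  shows "((\<lambda>t. parallel_curvature t x) has_real_derivative (1 - (parallel_curvature t x)\<^sup>2) / (1 - t\<^sup>2)) (at t)"
proof -
  have p: "1 + x * t > 0" using assms by (simp add: add_pos_nonneg)
  have t: "1 - t\<^sup>2 > 0" using assms by (simp add: power_less_one_iff)
  have "((\<lambda>t. parallel_curvature t x) has_real_derivative (1 * (1 + x * t) - (x + t) * x) / ((1 + x * t) * (1 + x * t))) (at t)"
    unfolding parallel_curvature_def by (rule derivative_eq_intros refl | use p in force)+
  moreover have "1 - (parallel_curvature t x)\<^sup>2 = (1 * (1 + x * t) - (x + t) * x) / ((1 + x * t) * (1 + x * t)) * (1 - t\<^sup>2)"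
  proof -
    have "1 - (parallel_curvature t x)\<^sup>2 = ((1 + x * t)\<^sup>2 - (x + t)\<^sup>2) / (1 + x * t)\<^sup>2"
      using p by (simp add: parallel_curvature_def power_divide diff_divide_distrib)
    also have "(1 + x * t)\<^sup>2 - (x + t)\<^sup>2 = (1 * (1 + x * t) - (x + t) * x) * (1 - t\<^sup>2)"
      by (simp add: power2_eq_square algebra_simps)
    finally show ?thesis by (simp add: power2_eq_square)
  qed
  ultimately show ?thesis using t by simp
qed

lemma flow_eq_parallel_curvature:
  assumes "0 < T" "C = sqrt (1 + T\<^sup>2)" "0 < x"
  shows "(T + C * x) / (C + T * x) = parallel_curvature (T / C) x" "0 < T / C" "T / C < 1"
proof -
  have "sqrt (T\<^sup>2) < C" unfolding assms(2) by (rule real_sqrt_less_mono) simp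
  hence C: "T < C" "C > 0" using assms(1) by auto
  thus "0 < T / C" "T / C < 1" using assms by auto
  have "parallel_curvature (T / C) x = (C * (x + T / C)) / (C * (1 + x * (T / C)))" using C by (simp add: parallel_curvature_def)
  also have "\<dots> = (T + C * x) / (C + T * x)" using C by (simp add: distrib_left mult_ac add_ac)
  finally show "(T + C * x) / (C + T * x) = parallel_curvature (T / C) x" ..
qed

lemma open_Kpos: "open (Kpos :: (real^'n::finite) set)"
proof -
  have "Kpos = (\<Inter>i\<in>UNIV. {\<mu> :: real^'n. 0 < \<mu> $ i})" by (auto simp: Kpos_def)
  moreover have "open (\<Inter>i\<in>UNIV. {\<mu> :: real^'n. 0 < \<mu> $ i})"
    by (intro open_INT finite ballI open_Collect_less continuous_intros)
  ultimately show ?thesis by (simp only:)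
qed

lemma curvature_function_general:
  fixes f :: "real^'n::finite \<Rightarrow> real"
  assumes sc: "structure_conditions f" and ex: "extra_condition f" and s: "0 < \<sigma>" "\<sigma> < 1"
  shows "curvature_function f \<sigma>"
proof
  have C: "Ck (Suc 0) Kpos f" and perm: "\<And>p \<mu>. p permutes UNIV \<Longrightarrow> \<mu> \<in> Kpos \<Longrightarrow> f (\<chi> i. \<mu> $ p i) = f \<mu>"
    and pd: "\<And>\<mu> i. \<mu> \<in> Kpos \<Longrightarrow> pd i f \<mu> > 0" and f1: "f (\<chi> i. 1) = 1"
    and hom: "\<And>\<mu> t. \<mu> \<in> Kpos \<Longrightarrow> t > 0 \<Longrightarrow> f (t *\<^sub>R \<mu>) = t * f \<mu>"
    using sc unfolding structure_conditions_def smooth_on_def by blast+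
  have C1: "Ck 1 Kpos f" using C by simp
  show "0 < \<sigma>" "\<sigma> < 1" by fact+
  show "f (\<chi> i. \<mu> $ p i) = f \<mu>" if "p permutes UNIV" "\<mu> \<in> Kpos" for p \<mu> using perm that by blast
  show "f (\<chi> i. t) = t" if "0 < t" for t
    using hom[of "\<chi> i. 1" t] that f1 by (simp add: Kpos_def scaleR_vec_def)
  show "f \<nu> \<le> f \<mu>" if n: "\<nu> \<in> Kpos" and m: "\<mu> \<in> Kpos" and le: "\<And>i. \<nu> $ i \<le> \<mu> $ i" for \<nu> \<mu>
  proof -
    have in_K: "\<nu> + t *\<^sub>R (\<mu> - \<nu>) \<in> Kpos" if "0 \<le> t" "t \<le> 1" for t
    proof -
      have "0 < \<nu> $ i + t * (\<mu> $ i - \<nu> $ i)" for i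
        using n le[of i] that by (intro add_pos_nonneg mult_nonneg_nonneg) (auto simp: Kpos_def)
      thus ?thesis by (simp add: Kpos_def)
    qed
    have "f (\<nu> + 0 *\<^sub>R (\<mu> - \<nu>)) \<le> f (\<nu> + 1 *\<^sub>R (\<mu> - \<nu>))"
    proof (rule DERIV_nonneg_imp_nondecreasing[where f="\<lambda>t. f (\<nu> + t *\<^sub>R (\<mu> - \<nu>))"])
      fix t :: real assume t: "0 \<le> t" "t \<le> 1"
      have "0 \<le> grad f (\<nu> + t *\<^sub>R (\<mu> - \<nu>)) \<bullet> (\<mu> - \<nu>)"
        unfolding inner_vec_def grad_def using le pd[OF in_K[OF t]]
        by (auto intro!: sum_nonneg mult_nonneg_nonneg simp: less_imp_le)
      thus "\<exists>y. ((\<lambda>t. f (\<nu> + t *\<^sub>R (\<mu> - \<nu>))) has_real_derivative y) (at t) \<and> 0 \<le> y"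
        using Ck_line_deriv[OF C open_Kpos in_K[OF t]] by blast
    qed simp
    thus ?thesis by simp
  qed
  fix \<kappa> T C assume k: "\<kappa> \<in> Kpos" "f \<kappa> = \<sigma>" and T: "(0::real) < T" "C = sqrt (1 + T\<^sup>2)"
  have kp: "0 < \<kappa> $ i" for i using k by (simp add: Kpos_def)
  note fl = flow_eq_parallel_curvature[OF T]
  define \<gamma> where "\<gamma> t = (\<chi> i. parallel_curvature t (\<kappa> $ i))" for t
  have gK: "\<gamma> t \<in> Kpos" if "0 \<le> t" for t using parallel_curvature_pos[OF kp that] by (simp add: \<gamma>_def Kpos_def)
  define \<gamma>' where "\<gamma>' t = (\<chi> i. (1 - (\<gamma> t $ i)\<^sup>2) / (1 - t\<^sup>2))" for t
  have dg: "(\<gamma> has_vector_derivative \<gamma>' t) (at t)" if "0 \<le> t" "t < 1" for t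
    unfolding has_vector_derivative_def
  proof (subst has_derivative_componentwise_within, rule ballI)
    fix b :: "real^'n" assume "b \<in> Basis"
    then obtain i where b: "b = axis i 1" by (auto simp: Basis_vec_def)
    have e: "(\<lambda>x. x *\<^sub>R \<gamma>' t \<bullet> b) = (*) ((1 - (parallel_curvature t (\<kappa> $ i))\<^sup>2) / (1 - t\<^sup>2))"
      by (simp add: b inner_axis \<gamma>'_def \<gamma>_def fun_eq_iff)
    show "((\<lambda>t. \<gamma> t \<bullet> b) has_derivative (\<lambda>x. x *\<^sub>R \<gamma>' t \<bullet> b)) (at t)"
      using parallel_curvature_deriv[OF kp that, of i] unfolding e has_field_derivative_def
      by (simp add: b inner_axis \<gamma>_def)
  qed
  have dh: "((\<lambda>t. f (\<gamma> t)) has_real_derivative grad f (\<gamma> t) \<bullet> \<gamma>' t) (at t)" if "0 \<le> t" "t < 1" for t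
  proof -
    have "((\<lambda>t. f (\<gamma> t)) has_derivative (\<lambda>h. grad f (\<gamma> t) \<bullet> (h *\<^sub>R \<gamma>' t))) (at t)"
      by (rule has_derivative_compose[where f=\<gamma> and g=f])
         (use dg[OF that] C1_has_derivative[OF C1 open_Kpos gK[OF that(1)]] in \<open>auto simp: has_vector_derivative_def\<close>)
    thus ?thesis by (rule has_derivative_imp_has_field_derivative) simp
  qed
  have "\<sigma> < f (\<gamma> (T / C))"
  proof (rule stays_above[of "T / C" "\<lambda>t. f (\<gamma> t)" "\<lambda>t. grad f (\<gamma> t) \<bullet> \<gamma>' t"])
    show "0 < T / C" using fl[OF kp] by blast
    fix t assume t: "0 \<le> t" "t \<le> T / C"
    hence t1: "t < 1" using fl(3)[OF kp] by (meson le_less_trans)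
    show "((\<lambda>t. f (\<gamma> t)) has_real_derivative grad f (\<gamma> t) \<bullet> \<gamma>' t) (at t)" by (rule dh[OF t(1) t1])
    assume e: "f (\<gamma> t) = \<sigma>"
    have t2: "0 < 1 - t\<^sup>2" using t(1) t1 by (simp add: power_less_one_iff)
    \<comment> \<open>Up to a positive factor this is the difference of the two sums in
      \<open>extra_condition\<close>, which applies because \<open>f (\<gamma> t) = \<sigma>\<close>
      lies between 0 and 1.\<close>
    have "grad f (\<gamma> t) \<bullet> \<gamma>' t = ((\<Sum>i\<in>UNIV. pd i f (\<gamma> t)) - (\<Sum>i\<in>UNIV. (\<gamma> t $ i)\<^sup>2 * pd i f (\<gamma> t))) / (1 - t\<^sup>2)"
      unfolding inner_vec_def grad_def \<gamma>'_def
      by (simp add: sum_subtractf[symmetric] sum_divide_distrib algebra_simps diff_divide_distrib)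
    moreover have "(\<Sum>i\<in>UNIV. (\<gamma> t $ i)\<^sup>2 * pd i f (\<gamma> t)) < (\<Sum>i\<in>UNIV. pd i f (\<gamma> t))"
      using ex gK[OF t(1)] e s unfolding extra_condition_def by blast
    ultimately show "0 < grad f (\<gamma> t) \<bullet> \<gamma>' t" using t2 by simp
  next
    show "f (\<gamma> 0) = \<sigma>" using k by (simp add: \<gamma>_def parallel_curvature_0)
  qed
  thus "\<sigma> < f (\<chi> i. (T + C * \<kappa> $ i) / (C + T * \<kappa> $ i))"
    using fl(1)[OF kp] by (simp add: \<gamma>_def)
qed

section \<open>Quotients of elementary symmetric polynomials\<close>

lemma Hsym_permute:
  fixes \<mu> :: "real^'n::finite"
  assumes p: "p permutes (UNIV::'n set)"
  shows "Hsym l (\<chi> i. \<mu> $ p i) = Hsym l \<mu>"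
proof -
  have inj: "inj p" and sp: "surj p" using p by (auto simp: permutes_inj permutes_surj)
  let ?A = "{S. S \<subseteq> (UNIV::'n set) \<and> card S = l}"
  have "(\<Sum>S\<in>?A. \<Prod>i\<in>S. \<mu> $ p i) = (\<Sum>S\<in>?A. \<Prod>i\<in>p ` S. \<mu> $ i)"
    using inj by (intro sum.cong refl) (simp add: prod.reindex inj_on_subset)
  also have "\<dots> = (\<Sum>S\<in>(`) p ` ?A. \<Prod>i\<in>S. \<mu> $ i)"
    using inj by (subst sum.reindex) (auto simp: inj_on_def inj_image_eq_iff)
  also have "(`) p ` ?A = ?A"
  proof
    show "(`) p ` ?A \<subseteq> ?A" using inj by (auto simp: card_image inj_on_subset)
    show "?A \<subseteq> (`) p ` ?A"
    proof
      fix S assume S: "S \<in> ?A"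
      have "S = p ` (inv p ` S)" using sp by (simp add: image_f_inv_f)
      moreover have "card (inv p ` S) = l" 
        using S card_image[OF inj_on_subset[OF surj_imp_inj_inv[OF sp] subset_UNIV]] by simp
      ultimately show "S \<in> (`) p ` ?A" by blast
    qed
  qed
  finally show ?thesis by (simp add: Hsym_def)
qed

lemma Hsym_mono:
  fixes \<nu> \<mu> :: "real^'n::finite"
  assumes "\<And>i. 0 \<le> \<nu> $ i" "\<And>i. \<nu> $ i \<le> \<mu> $ i"
  shows "Hsym l \<nu> \<le> Hsym l \<mu>"
  unfolding Hsym_def by (intro divide_right_mono sum_mono prod_mono) (use assms in auto)

lemma Hsym_pos:
  fixes \<mu> :: "real^'n::finite"
  assumes "\<mu> \<in> Kpos" "l \<le> CARD('n)"
  shows "0 < Hsym l \<mu>"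
proof -
  obtain S :: "'n set" where "card S = l" using obtain_subset_with_card_n[OF assms(2)] by metis
  hence "{S. S \<subseteq> (UNIV::'n set) \<and> card S = l} \<noteq> {}" by auto
  hence "0 < (\<Sum>S\<in>{S. S \<subseteq> (UNIV::'n set) \<and> card S = l}. \<Prod>i\<in>S. \<mu> $ i)"
    using assms(1) by (intro sum_pos prod_pos) (auto simp: Kpos_def)
  thus ?thesis unfolding Hsym_def using assms(2) by simp
qed

lemma Hsym_const:
  "l \<le> CARD('n) \<Longrightarrow> Hsym l (\<chi> i. t :: real^'n::finite) = t ^ l"
proof -
  assume l: "l \<le> CARD('n)"
  let ?A = "{S. S \<subseteq> (UNIV::'n set) \<and> card S = l}"
  have "(\<Sum>S\<in>?A. \<Prod>i\<in>S. t) = (\<Sum>S\<in>?A. t ^ l)" by (intro sum.cong) auto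
  also have "\<dots> = real (card ?A) * t ^ l" by simp
  also have "card ?A = CARD('n) choose l" by (rule n_subsets) simp
  finally have e: "(\<Sum>S\<in>?A. \<Prod>i\<in>S. t) = real (CARD('n) choose l) * t ^ l" .
  show ?thesis unfolding Hsym_def vec_lambda_beta e using l by simp
qed

text \<open>Complementation of index sets: the product over S is the full product times the product
  of the reciprocals over the complement, and the two binomial coefficients agree.\<close>

lemma Hquot_inverse:
  fixes \<mu> :: "real^'n::finite"
  assumes m: "\<mu> \<in> Kpos" and l: "l < CARD('n)"
  shows "Hquot l \<mu> = (Hsym (CARD('n) - l) (\<chi> i. 1 / \<mu> $ i)) powr (- 1 / real (CARD('n) - l))"
proof -
  define k where "k = CARD('n) - l"
  define P where "P = (\<Prod>i\<in>UNIV. \<mu> $ i)"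
  have mp: "0 < \<mu> $ i" for i using m by (simp add: Kpos_def)
  have P: "0 < P" unfolding P_def by (intro prod_pos) (simp add: mp)
  have top: "Hsym CARD('n) \<mu> = P"
  proof -
    have "{S. S \<subseteq> (UNIV::'n set) \<and> card S = CARD('n)} = {UNIV}"
      using card_subset_eq[of "UNIV::'n set"] by auto
    thus ?thesis by (simp add: Hsym_def P_def)
  qed
  let ?A = "\<lambda>l. {S. S \<subseteq> (UNIV::'n set) \<and> card S = l}"
  have "(\<Sum>S\<in>?A l. \<Prod>i\<in>S. \<mu> $ i) = (\<Sum>S\<in>?A k. P * (\<Prod>i\<in>S. 1 / \<mu> $ i))"
  proof (rule sum.reindex_bij_witness[of _ uminus uminus])
    fix S assume S: "S \<in> ?A l"
    show "- S \<in> ?A k" using S by (simp add: k_def Compl_eq_Diff_UNIV card_Diff_subset)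
    have "P = (\<Prod>i\<in>S. \<mu> $ i) * (\<Prod>i\<in>- S. \<mu> $ i)"
      unfolding P_def by (subst prod.union_disjoint[symmetric]) auto
    moreover have "(\<Prod>i\<in>- S. \<mu> $ i) \<noteq> 0" using mp by (simp add: less_imp_neq[symmetric])
    ultimately show "P * (\<Prod>i\<in>- S. 1 / \<mu> $ i) = (\<Prod>i\<in>S. \<mu> $ i)" by (simp add: prod_dividef)
  next
    fix S assume S: "S \<in> ?A k"
    show "- S \<in> ?A l" using S l by (simp add: k_def Compl_eq_Diff_UNIV card_Diff_subset)
  qed auto
  hence "Hsym l \<mu> = P * Hsym k (\<chi> i. 1 / \<mu> $ i)"
    using binomial_symmetric[of l "CARD('n)"] l by (simp add: Hsym_def k_def sum_distrib_left)
  hence "Hquot l \<mu> = (inverse (Hsym k (\<chi> i. 1 / \<mu> $ i))) powr (1 / real k)"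
    using P by (simp add: Hquot_def top k_def inverse_eq_divide)
  moreover have "0 \<le> Hsym k (\<chi> i. 1 / \<mu> $ i)"
    using Hsym_pos[of "\<chi> i. 1 / \<mu> $ i" k] mp by (simp add: Kpos_def k_def less_imp_le)
  ultimately show ?thesis by (simp add: k_def powr_minus inverse_powr)
qed

lemma Hsym_1: "Hsym 1 (\<mu> :: real^'n::finite) = (\<Sum>i\<in>UNIV. \<mu> $ i) / real CARD('n)"
proof -
  have "{S. S \<subseteq> (UNIV::'n set) \<and> card S = 1} = (\<lambda>i. {i}) ` UNIV" by (auto simp: card_1_singleton_iff)
  hence "(\<Sum>S\<in>{S. S \<subseteq> (UNIV::'n set) \<and> card S = 1}. \<Prod>i\<in>S. \<mu> $ i) = (\<Sum>i\<in>UNIV. \<mu> $ i)"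
    by (simp add: sum.reindex inj_on_def)
  thus ?thesis by (simp add: Hsym_def)
qed

text \<open>Each two-element set stems from two ordered pairs off the diagonal, and the diagonal
  completes the square of the sum.\<close>

lemma Hsym_2:
  assumes "2 \<le> CARD('n::finite)"
  shows "Hsym 2 (\<mu> :: real^'n) = ((\<Sum>i\<in>UNIV. \<mu> $ i)\<^sup>2 - (\<Sum>i\<in>UNIV. (\<mu> $ i)\<^sup>2)) / (real CARD('n) * (real CARD('n) - 1))"
proof -
  let ?A = "{S. S \<subseteq> (UNIV::'n set) \<and> card S = 2}"
  let ?P = "{(i, j). i \<noteq> (j::'n)}"
  have "(\<Sum>S\<in>?A. \<Sum>x\<in>{x \<in> ?P. {fst x, snd x} = S}. \<mu> $ fst x * \<mu> $ snd x) = (\<Sum>x\<in>?P. \<mu> $ fst x * \<mu> $ snd x)"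
    by (rule sum.group) (auto simp: card_2_iff, blast)
  moreover have "(\<Sum>x\<in>{x \<in> ?P. {fst x, snd x} = S}. \<mu> $ fst x * \<mu> $ snd x) = 2 * (\<Prod>i\<in>S. \<mu> $ i)" if "S \<in> ?A" for S
  proof -
    obtain a b where ab: "S = {a, b}" "a \<noteq> b" using \<open>S \<in> ?A\<close> by (auto simp: card_2_iff)
    hence "{x \<in> ?P. {fst x, snd x} = S} = {(a, b), (b, a)}" by (auto simp: doubleton_eq_iff)
    thus ?thesis using ab by simp
  qed
  ultimately have 1: "2 * (\<Sum>S\<in>?A. \<Prod>i\<in>S. \<mu> $ i) = (\<Sum>x\<in>?P. \<mu> $ fst x * \<mu> $ snd x)"
    by (simp add: sum_distrib_left)
  have "(\<Sum>i\<in>UNIV. \<mu> $ i)\<^sup>2 = (\<Sum>x\<in>UNIV \<times> UNIV. \<mu> $ fst x * \<mu> $ snd x)"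
    by (simp add: power2_eq_square sum_product sum.cartesian_product case_prod_beta)
  also have "UNIV \<times> UNIV = ?P \<union> (\<lambda>i. (i, i)) ` (UNIV::'n set)" by auto
  also have "(\<Sum>x\<in>\<dots>. \<mu> $ fst x * \<mu> $ snd x) = (\<Sum>x\<in>?P. \<mu> $ fst x * \<mu> $ snd x) + (\<Sum>i\<in>UNIV. (\<mu> $ i)\<^sup>2)"
    by (subst sum.union_disjoint) (auto simp: sum.reindex inj_on_def power2_eq_square)
  finally have 2: "2 * (\<Sum>S\<in>?A. \<Prod>i\<in>S. \<mu> $ i) = (\<Sum>i\<in>UNIV. \<mu> $ i)\<^sup>2 - (\<Sum>i\<in>UNIV. (\<mu> $ i)\<^sup>2)"
    using 1 by simp
  have ch: "real (CARD('n) choose 2) = real CARD('n) * (real CARD('n) - 1) / 2"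
    using assms by (simp add: choose_two real_of_nat_div of_nat_diff)
  hence "Hsym 2 \<mu> = (2 * (\<Sum>S\<in>?A. \<Prod>i\<in>S. \<mu> $ i)) / (real CARD('n) * (real CARD('n) - 1))"
    unfolding Hsym_def ch by simp
  thus ?thesis unfolding 2 .
qed

text \<open>Chebyshev's sum inequality for the families x i and x i (S - x i). They are ordered
  alike, since the latter differ by (x i - x j) (S - x i - x j), whose second factor is nonnegative
  by positivity.\<close>

lemma chebyshev_cubic:
  fixes x :: "'a::finite \<Rightarrow> real"
  assumes "\<And>i. 0 < x i"
  shows "(\<Sum>i\<in>UNIV. x i) * ((\<Sum>i\<in>UNIV. x i)\<^sup>2 - (\<Sum>i\<in>UNIV. (x i)\<^sup>2))
    \<le> real CARD('a) * ((\<Sum>i\<in>UNIV. x i) * (\<Sum>i\<in>UNIV. (x i)\<^sup>2) - (\<Sum>i\<in>UNIV. (x i)^3))"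
proof -
  define S where "S = (\<Sum>i\<in>UNIV. x i)"
  define b where "b i = x i * (S - x i)" for i
  have "0 \<le> (x i - x j) * (b i - b j)" for i j
  proof (cases "i = j")
    case False
    have "x i + x j = (\<Sum>k\<in>{i, j}. x k)" using False by simp
    also have "\<dots> \<le> S" unfolding S_def by (intro sum_mono2) (auto intro: less_imp_le assms)
    finally have "0 \<le> (x i - x j)\<^sup>2 * (S - x i - x j)" by simp
    also have "\<dots> = (x i - x j) * (b i - b j)" by (simp add: b_def power2_eq_square algebra_simps)
    finally show ?thesis .
  qed simp
  hence "0 \<le> (\<Sum>i\<in>UNIV. \<Sum>j\<in>UNIV. (x i - x j) * (b i - b j))" by (intro sum_nonneg) auto
  also have "\<dots> = 2 * (real CARD('a) * (\<Sum>i\<in>UNIV. x i * b i) - S * (\<Sum>i\<in>UNIV. b i))"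
    by (simp add: left_diff_distrib right_diff_distrib sum_subtractf sum.distrib sum_distrib_left[symmetric]
        sum_distrib_right[symmetric] S_def)
  finally have "S * (\<Sum>i\<in>UNIV. b i) \<le> real CARD('a) * (\<Sum>i\<in>UNIV. x i * b i)" by simp
  moreover have "(\<Sum>i\<in>UNIV. b i) = S\<^sup>2 - (\<Sum>i\<in>UNIV. (x i)\<^sup>2)"
    by (simp add: b_def right_diff_distrib sum_subtractf sum_distrib_right[symmetric] S_def power2_eq_square)
  moreover have "(\<Sum>i\<in>UNIV. x i * b i) = S * (\<Sum>i\<in>UNIV. (x i)\<^sup>2) - (\<Sum>i\<in>UNIV. (x i)^3)"
    by (simp add: b_def right_diff_distrib sum_subtractf sum_distrib_left power2_eq_square power3_eq_cube mult_ac)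
  ultimately show ?thesis by (simp add: S_def)
qed

text \<open>The reciprocals of the principal curvatures follow the same flow, and \<open>Hquot\<close> is a power of a
  symmetric polynomial of degree at most two in them.\<close>

lemma Hsym_flow_decreasing:
  fixes \<rho> :: "real^'n::finite"
  assumes r: "\<And>i. 0 < \<rho> $ i" and a: "0 < a" "a < 1" and k: "k \<in> {1, 2}" "k \<le> CARD('n)"
    and H: "1 < Hsym k \<rho>"
  shows "Hsym k (\<chi> i. parallel_curvature a (\<rho> $ i)) < Hsym k \<rho>"
proof -
  define \<gamma> where "\<gamma> t i = parallel_curvature t (\<rho> $ i)" for t i
  define g where "g t = (\<lambda>i. (1 - (\<gamma> t i)\<^sup>2) / (1 - t\<^sup>2))" for t
  define N where "N = real CARD('n)"
  have N: "N > 0" by (simp add: N_def)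
  have dg: "((\<lambda>t. \<gamma> t i) has_real_derivative g t i) (at t)" if "0 \<le> t" "t \<le> a" for t i
    unfolding \<gamma>_def g_def by (rule parallel_curvature_deriv) (use r that a in auto)
  have gp: "0 < \<gamma> t i" if "0 \<le> t" for t i unfolding \<gamma>_def by (rule parallel_curvature_pos[OF r that])
  have g0: "\<gamma> 0 i = \<rho> $ i" for i by (simp add: \<gamma>_def parallel_curvature_0)
  have t2: "0 < 1 - t\<^sup>2" if "0 \<le> t" "t \<le> a" for t using that a by (simp add: power_less_one_iff)
  consider "k = 1" | "k = 2" using k by auto
  thus ?thesis
  proof cases
    case 1
    \<comment> \<open>\<open>stays_above\<close> is applied to the negative. At the initial level
      the mean exceeds 1, hence by Cauchy-Schwarz so does the mean of the squares, and the mean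
      decreases.\<close>
    have "- Hsym k \<rho> < - ((\<Sum>i\<in>UNIV. \<gamma> a i) / N)"
    proof (rule stays_above[OF a(1), where h' = "\<lambda>t. - ((\<Sum>i\<in>UNIV. g t i) / N)"])
      fix t assume t: "0 \<le> t" "t \<le> a"
      show "((\<lambda>t. - ((\<Sum>i\<in>UNIV. \<gamma> t i) / N)) has_real_derivative - ((\<Sum>i\<in>UNIV. g t i) / N)) (at t)"
        by (intro DERIV_minus DERIV_cdivide DERIV_sum dg t)
      assume "- ((\<Sum>i\<in>UNIV. \<gamma> t i) / N) = - Hsym k \<rho>"
      hence S: "N < (\<Sum>i\<in>UNIV. \<gamma> t i)" using H N by (simp add: field_simps)
      have "N * N < (\<Sum>i\<in>UNIV. \<gamma> t i) * (\<Sum>i\<in>UNIV. \<gamma> t i)" using S N by (intro mult_strict_mono) auto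
      also have "\<dots> \<le> N * (\<Sum>i\<in>UNIV. (\<gamma> t i)\<^sup>2)"
        using sum_squared_le_sum_of_squares[of "\<gamma> t" UNIV] by (simp add: N_def power2_eq_square mult_ac)
      finally have "N < (\<Sum>i\<in>UNIV. (\<gamma> t i)\<^sup>2)" using N by simp
      moreover have "(\<Sum>i\<in>UNIV. g t i) = (N - (\<Sum>i\<in>UNIV. (\<gamma> t i)\<^sup>2)) / (1 - t\<^sup>2)"
        by (simp add: g_def sum_divide_distrib[symmetric] sum_subtractf N_def)
      ultimately have "(\<Sum>i\<in>UNIV. g t i) < 0" using t2[OF t] by (simp add: divide_neg_pos)
      thus "0 < - ((\<Sum>i\<in>UNIV. g t i) / N)" using N by (simp add: divide_neg_pos)
    next
      show "- ((\<Sum>i\<in>UNIV. \<gamma> 0 i) / N) = - Hsym k \<rho>" unfolding 1 Hsym_1 g0 N_def ..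
    qed
    thus ?thesis unfolding 1 Hsym_1 by (simp add: \<gamma>_def N_def)
  next
    case 2
    have N2: "2 \<le> CARD('n)" using k 2 by simp
    have N1: "N - 1 > 0" using N2 by (simp add: N_def)
    define h where "h t = ((\<Sum>i\<in>UNIV. \<gamma> t i)\<^sup>2 - (\<Sum>i\<in>UNIV. (\<gamma> t i)\<^sup>2)) / (N * (N - 1))" for t
    define h' where "h' t = (2 * (\<Sum>i\<in>UNIV. \<gamma> t i) * (\<Sum>i\<in>UNIV. g t i) - (\<Sum>i\<in>UNIV. 2 * \<gamma> t i * g t i)) / (N * (N - 1))" for t
    have h0: "h 0 = Hsym k \<rho>" unfolding 2 Hsym_2[OF N2] h_def g0 N_def ..
    have ha: "h a = Hsym k (\<chi> i. parallel_curvature a (\<rho> $ i))" unfolding 2 Hsym_2[OF N2] h_def N_def by (simp add: \<gamma>_def)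
    have "- Hsym k \<rho> < - h a"
    proof (rule stays_above[OF a(1), where h' = "\<lambda>t. - h' t"])
      fix t assume t: "0 \<le> t" "t \<le> a"
      have "((\<lambda>t. (\<Sum>i\<in>UNIV. \<gamma> t i)\<^sup>2) has_real_derivative 2 * (\<Sum>i\<in>UNIV. \<gamma> t i) * (\<Sum>i\<in>UNIV. g t i)) (at t)"
      proof -
        have "((\<lambda>t. \<Sum>i\<in>UNIV. \<gamma> t i) has_real_derivative (\<Sum>i\<in>UNIV. g t i)) (at t)"
          by (intro DERIV_sum dg t)
        from DERIV_power[OF this, where n=2] show ?thesis by (simp add: mult_ac)
      qed
      moreover have "((\<lambda>t. \<Sum>i\<in>UNIV. (\<gamma> t i)\<^sup>2) has_real_derivative (\<Sum>i\<in>UNIV. 2 * \<gamma> t i * g t i)) (at t)"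
      proof (rule DERIV_sum)
        fix i show "((\<lambda>t. (\<gamma> t i)\<^sup>2) has_real_derivative 2 * \<gamma> t i * g t i) (at t)"
          using DERIV_power[OF dg[OF t], where n=2] by (simp add: mult_ac)
      qed
      ultimately show "((\<lambda>t. - h t) has_real_derivative - h' t) (at t)"
        unfolding h_def h'_def by (intro DERIV_minus DERIV_cdivide DERIV_diff)
      define S p2 p3 where "S = (\<Sum>i\<in>UNIV. \<gamma> t i)" and "p2 = (\<Sum>i\<in>UNIV. (\<gamma> t i)\<^sup>2)" and "p3 = (\<Sum>i\<in>UNIV. (\<gamma> t i)^3)"
      assume "- h t = - Hsym k \<rho>"
      hence "1 < h t" using H by simp
      hence e2: "N * (N - 1) < S\<^sup>2 - p2" using N N1 by (simp add: h_def S_def p2_def pos_less_divide_eq)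
      have S: "0 < S" unfolding S_def by (intro sum_pos gp t) auto
      \<comment> \<open>The sign of \<open>h' t\<close> is that of S (N - 1) - (S p2 - p3).
        Chebyshev bounds N (S p2 - p3) below by S (S^2 - p2), which \<open>e2\<close> puts above S N
        (N - 1).\<close>
      have "S * (N * (N - 1)) < S * (S\<^sup>2 - p2)" using e2 S by simp
      also have "\<dots> \<le> N * (S * p2 - p3)"
        unfolding S_def p2_def p3_def N_def by (rule chebyshev_cubic) (rule gp[OF t(1)])
      finally have "N * (S * (N - 1)) < N * (S * p2 - p3)" by (simp add: mult_ac)
      hence lt: "S * (N - 1) < S * p2 - p3" using N by simp
      have s1: "(\<Sum>i\<in>UNIV. g t i) = (N - p2) / (1 - t\<^sup>2)"
        by (simp add: g_def sum_divide_distrib[symmetric] sum_subtractf N_def p2_def)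
      have s2: "(\<Sum>i\<in>UNIV. 2 * \<gamma> t i * g t i) = 2 * (S - p3) / (1 - t\<^sup>2)"
        by (simp add: g_def sum_divide_distrib[symmetric] sum_subtractf right_diff_distrib S_def p3_def
            power2_eq_square power3_eq_cube sum_distrib_left mult_ac)
      have h': "h' t = 2 * (S * (N - 1) - (S * p2 - p3)) / (1 - t\<^sup>2) / (N * (N - 1))"
        unfolding h'_def s1 s2 S_def[symmetric]
        by (simp add: diff_divide_distrib[symmetric] algebra_simps)
      have neg: "2 * (S * (N - 1) - (S * p2 - p3)) / (1 - t\<^sup>2) < 0"
        using lt t2[OF t] by (intro divide_neg_pos) auto
      have "h' t < 0" unfolding h' by (rule divide_neg_pos[OF neg]) (use N N1 in simp)
      thus "0 < - h' t" by simp
    next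
      show "- h 0 = - Hsym k \<rho>" by (simp add: h0)
    qed
    thus ?thesis by (simp add: ha)
  qed
qed

text \<open>In the reciprocals of the curvatures \<open>Hquot l\<close> is a negative power of
  \<open>Hsym k\<close> with k = 1 or 2. A value \<sigma> < 1 means that \<open>Hsym k\<close>
  exceeds 1, and then the flow decreases it.\<close>

lemma curvature_function_Hquot:
  assumes l: "l < CARD('n::finite)" "CARD('n) \<le> l + 2" and s: "0 < \<sigma>" "\<sigma> < 1"
  shows "curvature_function (Hquot l :: real^'n \<Rightarrow> real) \<sigma>"
proof
  define k where "k = CARD('n) - l"
  have k: "k \<in> {1, 2}" "k \<le> CARD('n)" "k > 0" using l by (auto simp: k_def)
  define inv where "inv \<mu> = (\<chi> i. 1 / \<mu> $ i)" for \<mu> :: "real^'n"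
  have invK: "inv \<mu> \<in> Kpos" if "\<mu> \<in> Kpos" for \<mu> using that by (simp add: inv_def Kpos_def)
  have Hq: "Hquot l \<mu> = Hsym k (inv \<mu>) powr (- 1 / real k)" if "\<mu> \<in> Kpos" for \<mu>
    unfolding inv_def k_def by (rule Hquot_inverse[OF that l(1)])
  have Hp: "0 < Hsym k (inv \<mu>)" if "\<mu> \<in> Kpos" for \<mu> by (rule Hsym_pos[OF invK[OF that] k(2)])
  show "0 < \<sigma>" "\<sigma> < 1" by fact+
  show "Hquot l (\<chi> i. \<mu> $ p i) = Hquot l \<mu>" if "p permutes UNIV" for p and \<mu> :: "real^'n"
    using that by (simp add: Hquot_def Hsym_permute)
  show "Hquot l \<nu> \<le> Hquot l \<mu>" if n: "\<nu> \<in> Kpos" and m: "\<mu> \<in> Kpos" and le: "\<And>i. \<nu> $ i \<le> \<mu> $ i" for \<nu> \<mu> :: "real^'n"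
  proof -
    have "Hsym k (inv \<mu>) \<le> Hsym k (inv \<nu>)"
      by (rule Hsym_mono) (use n m le in \<open>auto simp: inv_def Kpos_def less_imp_le intro: divide_left_mono\<close>)
    thus ?thesis unfolding Hq[OF n] Hq[OF m] using Hp[OF m] k by (intro powr_mono2') auto
  qed
  show "Hquot l (\<chi> i. t :: real^'n) = t" if t: "0 < t" for t
  proof -
    have "(\<chi> i. t) \<in> (Kpos :: (real^'n) set)" using t by (simp add: Kpos_def)
    hence "Hquot l (\<chi> i. t :: real^'n) = ((1 / t) ^ k) powr (- 1 / real k)"
      using Hsym_const[OF k(2), of "1 / t"] by (simp add: Hq inv_def)
    also have "\<dots> = t"
      using t k(3) by (simp add: powr_realpow[symmetric] powr_powr powr_minus powr_divide)
    finally show ?thesis .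
  qed
  fix \<kappa> :: "real^'n" and T C :: real
  assume K: "\<kappa> \<in> Kpos" "Hquot l \<kappa> = \<sigma>" and T: "0 < T" "C = sqrt (1 + T\<^sup>2)"
  have kp: "0 < \<kappa> $ i" for i using K by (simp add: Kpos_def)
  note fl = flow_eq_parallel_curvature[OF T]
  define a where "a = T / C"
  have a: "0 < a" "a < 1" using fl[OF kp] by (auto simp: a_def)
  define \<kappa>' where "\<kappa>' = (\<chi> i. (T + C * \<kappa> $ i) / (C + T * \<kappa> $ i))"
  have k'm: "\<kappa>' $ i = parallel_curvature a (\<kappa> $ i)" for i using fl(1)[OF kp] by (simp add: \<kappa>'_def a_def)
  have k'K: "\<kappa>' \<in> Kpos" using parallel_curvature_pos[OF kp] a by (simp add: Kpos_def k'm)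
  have inv': "inv \<kappa>' = (\<chi> i. parallel_curvature a (inv \<kappa> $ i))"
    using parallel_curvature_inverse[OF kp] a by (simp add: inv_def k'm)
  have "1 < Hsym k (inv \<kappa>)"
  proof (rule ccontr)
    assume "\<not> 1 < Hsym k (inv \<kappa>)"
    hence "1 powr (- 1 / real k) \<le> Hsym k (inv \<kappa>) powr (- 1 / real k)"
      using Hp[OF K(1)] by (intro powr_mono2') auto
    thus False using K s by (simp add: Hq)
  qed
  hence "Hsym k (inv \<kappa>') < Hsym k (inv \<kappa>)"
    unfolding inv' using invK[OF K(1)] a k by (intro Hsym_flow_decreasing) (auto simp: Kpos_def)
  hence "Hsym k (inv \<kappa>) powr (- 1 / real k) < Hsym k (inv \<kappa>') powr (- 1 / real k)"
    using Hp[OF k'K] k by (intro powr_less_mono2_neg) auto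
  thus "\<sigma> < Hquot l (\<chi> i. (T + C * \<kappa> $ i) / (C + T * \<kappa> $ i))"
    using K(2) by (simp add: Hq[OF K(1)] Hq[OF k'K] \<kappa>'_def[symmetric])
qed

section \<open>Uniqueness by comparison in both directions\<close>

lemma (in curvature_function) uniqueness_of_solutions:
  assumes D: "bounded_smooth_domain \<Omega>"
  shows "uniqueness f \<Omega> \<sigma>"
  unfolding uniqueness_def
proof (intro conjI allI impI ballI)
  have O: "open \<Omega>" "bounded \<Omega>" using D by (auto simp: bounded_smooth_domain_def)
  let ?P = "\<lambda>u. admissible \<Omega> u \<and> smooth_on \<Omega> u \<and> C1_upto \<Omega> u \<and>
    (\<forall>x\<in>\<Omega>. curv_eq f u x \<sigma>) \<and> (\<forall>x\<in>frontier \<Omega>. u x = 0)"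
  fix u v x assume u: "?P u" and v: "?P v" and x: "x \<in> \<Omega>"
  have s: "solution \<Omega> 0 u" "solution \<Omega> 0 v"
    using u v by (auto simp: solution_def C1_upto_def)
  show "u x = v x"
  proof (rule antisym)
    show "u x \<le> v x" by (rule comparison[OF O _ s boundary_ratio[OF D s] x]) auto
    show "v x \<le> u x" by (rule comparison[OF O _ s(2,1) boundary_ratio[OF D s(2,1)] x]) auto
  qed
next
  have O: "open \<Omega>" "bounded \<Omega>" using D by (auto simp: bounded_smooth_domain_def)
  fix \<epsilon> :: real
  let ?P = "\<lambda>u. admissible \<Omega> u \<and> smooth_upto \<Omega> u \<and>
    (\<forall>x\<in>\<Omega>. curv_eq f u x \<sigma>) \<and> (\<forall>x\<in>frontier \<Omega>. u x = \<epsilon>)"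
  fix u v x assume e: "0 < \<epsilon>" and u: "?P u" and v: "?P v" and x: "x \<in> \<Omega>"
  have s: "solution \<Omega> \<epsilon> u" "solution \<Omega> \<epsilon> v"
    using u v by (auto simp: solution_def smooth_upto_def)
  \<comment> \<open>For \<epsilon> > 0 the set where u is at least (1 + \<eta>) v is compact, and it
    avoids the frontier because both functions equal \<epsilon> there.\<close>
  have bd: "\<exists>K. compact K \<and> K \<subseteq> \<Omega> \<and> (\<forall>x\<in>\<Omega> - K. u x \<le> (1 + \<eta>) * v x)"
    if s: "solution \<Omega> \<epsilon> u" "solution \<Omega> \<epsilon> v" and \<eta>: "0 < \<eta>" for u v \<eta>
  proof -
    define K where "K = {x \<in> closure \<Omega>. (1 + \<eta>) * v x \<le> u x}"
    have c: "compact (closure \<Omega>)" using O by (simp add: compact_closure)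
    have "closed K" unfolding K_def
      by (intro continuous_on_closed_Collect_le continuous_intros solutionD(2)[OF s(1)] solutionD(2)[OF s(2)]) auto
    hence "compact (closure \<Omega> \<inter> K)" by (rule compact_Int_closed[OF c])
    moreover have "closure \<Omega> \<inter> K = K" by (auto simp: K_def)
    moreover have "K \<subseteq> \<Omega>"
    proof
      fix x assume x: "x \<in> K"
      show "x \<in> \<Omega>"
      proof (rule ccontr)
        assume "x \<notin> \<Omega>"
        hence "x \<in> frontier \<Omega>" using x O(1) by (auto simp: K_def frontier_def interior_open)
        hence "u x = \<epsilon>" "v x = \<epsilon>" using solutionD(3)[OF s(1)] solutionD(3)[OF s(2)] by auto
        hence "\<eta> * \<epsilon> \<le> 0" using x by (simp add: K_def algebra_simps)
        thus False using mult_pos_pos[OF \<eta> e] by linarith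
      qed
    qed
    moreover have "u x \<le> (1 + \<eta>) * v x" if "x \<in> \<Omega> - K" for x
      using that closure_subset[of \<Omega>] by (auto simp: K_def not_le intro: less_imp_le)
    ultimately show ?thesis by (intro exI[of _ K]) auto
  qed
  show "u x = v x"
  proof (rule antisym)
    show "u x \<le> v x" by (rule comparison[OF O less_imp_le[OF e] s bd[OF s] x])
    show "v x \<le> u x" by (rule comparison[OF O less_imp_le[OF e] s(2,1) bd[OF s(2,1)] x])
  qed
qed

theorem theorem1p6:
  fixes \<Omega> :: "(real^'n::finite) set" and \<sigma> :: real
  assumes "bounded_smooth_domain \<Omega>"
    and "0 < \<sigma>" and "\<sigma> < 1"
  shows "(\<forall>f :: real^'n \<Rightarrow> real. structure_conditions f \<and> extra_condition f \<longrightarrow>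
             uniqueness f \<Omega> \<sigma>) \<and>
         (\<forall>l. l < CARD('n) \<and> CARD('n) \<le> l + 2 \<longrightarrow> uniqueness (Hquot l :: real^'n \<Rightarrow> real) \<Omega> \<sigma>)"
proof (intro conjI allI impI)
  fix f :: "real^'n \<Rightarrow> real" assume "structure_conditions f \<and> extra_condition f"
  then interpret curvature_function f \<sigma>
    using assms(2,3) by (intro curvature_function_general) auto
  show "uniqueness f \<Omega> \<sigma>" by (rule uniqueness_of_solutions[OF assms(1)])
next
  fix l assume "l < CARD('n) \<and> CARD('n) \<le> l + 2"
  then interpret curvature_function "Hquot l :: real^'n \<Rightarrow> real" \<sigma>
    using assms(2,3) by (intro curvature_function_Hquot) auto
  show "uniqueness (Hquot l :: real^'n \<Rightarrow> real) \<Omega> \<sigma>" by (rule uniqueness_of_solutions[OF assms(1)])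
qed

end
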